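(* Let $F$ be a field of characteristic $2$, let $n\ge 2$, and let $S$ be a right-linked set of quadratic $n$-fold Pfister forms over $F$. The following are equivalent: (1) $S$ is pairwise left-linked, i.e. every two forms in $S$ are left-linked. (2) $S$ is strongly tight.
   Context: $[a,b]$ denotes the quadratic form $ax^2+xy+by^2$. $I_q^1F$ is the group of Witt classes of even-dimensional nonsingular quadratic forms over $F$ under orthogonal sum. Bilinear Pfister forms: $\langle\langle\beta\rangle\rangle=\langle 1,\beta\rangle$ (diagonal symmetric bilinear form) and $\langle\langle\beta_1,\dots,\beta_m\rangle\rangle=\langle\langle\beta_1\rangle\rangle\otimes\cdots\otimes\langle\langle\beta_m\rangle\rangle$, $\beta_i\in F^\times$. Quadratic Pfister forms: $\langle\langle\alpha]]=[1,\alpha]$ and $\langle\langle\beta_1,\dots,\beta_{n-1},\alpha]]=\langle\langle\beta_1,\dots,\beta_{n-1}\rangle\rangle\otimes\langle\langle\alpha]]$. $I_q^nF$ is the subgroup of $I_q^1F$ generated by scalar multiples of quadratic $n$-fold Pfister forms. A set of quadratic $n$-fold Pfister forms is right-linked if there is a quadratic $(n-1)$-fold Pfister form $\rho$ such that every form in the set is isometric to $\langle\langle\beta\rangle\rangle\otimes\rho$ for some $\beta\in F^\times$; it is left-linked if there is a bilinear $(n-1)$-fold Pfister form $b$ such that every form in the set is isometric to $b\otimes\langle\langle\alpha]]$ for some $\alpha\in F$. It is strongly tight if the subgroup it generates in $I_q^nF$ consists of (Witt classes of) $n$-fold Pfister forms. *)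

theory Defs
  imports
    "Jordan_Normal_Form.Matrix"
    "HOL-Algebra.Generated_Groups"
begin

section \<open>Quadratic forms and symmetric bilinear forms\<close>

text \<open>
  A form on the coordinate space \<open>F\<^sup>d\<close> is given by its dimension and its value function.
  Only the values on \<^term>\<open>carrier_vec d\<close> are meaningful; two forms which agree there are
  isometric and hence are not distinguished by any notion below.
\<close>

record 'a qform =
  qdim :: nat
  qval :: "'a vec \<Rightarrow> 'a"

record 'a bform =
  bdim :: nat
  bval :: "'a vec \<Rightarrow> 'a vec \<Rightarrow> 'a"

definition polar :: "'a::field qform \<Rightarrow> 'a vec \<Rightarrow> 'a vec \<Rightarrow> 'a" where
  "polar q u v = qval q (u + v) - qval q u - qval q v"

definition is_bform :: "'a::field bform \<Rightarrow> bool" where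
  "is_bform b \<longleftrightarrow>
     (\<forall>u \<in> carrier_vec (bdim b). \<forall>v \<in> carrier_vec (bdim b). bval b u v = bval b v u) \<and>
     (\<forall>u \<in> carrier_vec (bdim b). \<forall>v \<in> carrier_vec (bdim b). \<forall>w \<in> carrier_vec (bdim b).
        bval b (u + v) w = bval b u w + bval b v w) \<and>
     (\<forall>c. \<forall>u \<in> carrier_vec (bdim b). \<forall>v \<in> carrier_vec (bdim b).
        bval b (c \<cdot>\<^sub>v u) v = c * bval b u v)"

definition is_qform :: "'a::field qform \<Rightarrow> bool" where
  "is_qform q \<longleftrightarrow>
     (\<forall>c. \<forall>v \<in> carrier_vec (qdim q). qval q (c \<cdot>\<^sub>v v) = c\<^sup>2 * qval q v) \<and>
     is_bform \<lparr>bdim = qdim q, bval = polar q\<rparr>"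

definition nonsingular :: "'a::field qform \<Rightarrow> bool" where
  "nonsingular q \<longleftrightarrow>
     (\<forall>u \<in> carrier_vec (qdim q).
        (\<forall>v \<in> carrier_vec (qdim q). polar q u v = 0) \<longrightarrow> u = 0\<^sub>v (qdim q))"

definition q_isometric :: "'a::field qform \<Rightarrow> 'a qform \<Rightarrow> bool" (infix \<open>\<cong>\<^sub>q\<close> 50) where
  "p \<cong>\<^sub>q q \<longleftrightarrow> qdim p = qdim q \<and>
     (\<exists>A \<in> carrier_mat (qdim q) (qdim q). invertible_mat A \<and>
        (\<forall>v \<in> carrier_vec (qdim q). qval p v = qval q (A *\<^sub>v v)))"

definition b_isometric :: "'a::field bform \<Rightarrow> 'a bform \<Rightarrow> bool" (infix \<open>\<cong>\<^sub>b\<close> 50) where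
  "b \<cong>\<^sub>b c \<longleftrightarrow> bdim b = bdim c \<and>
     (\<exists>A \<in> carrier_mat (bdim c) (bdim c). invertible_mat A \<and>
        (\<forall>u \<in> carrier_vec (bdim c). \<forall>v \<in> carrier_vec (bdim c).
           bval b u v = bval c (A *\<^sub>v u) (A *\<^sub>v v)))"

definition q_orth :: "'a::field qform \<Rightarrow> 'a qform \<Rightarrow> 'a qform" (infixr \<open>\<bottom>\<^sub>q\<close> 65) where
  "p \<bottom>\<^sub>q q = \<lparr>qdim = qdim p + qdim q,
     qval = (\<lambda>v. qval p (vec_first v (qdim p)) + qval q (vec_last v (qdim q)))\<rparr>"

definition q_scale :: "'a::field \<Rightarrow> 'a qform \<Rightarrow> 'a qform" where
  "q_scale c q = \<lparr>qdim = qdim q, qval = (\<lambda>v. c * qval q v)\<rparr>"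

definition q_zero :: "'a::field qform" where
  "q_zero = \<lparr>qdim = 0, qval = (\<lambda>_. 0)\<rparr>"

text \<open>The quadratic form \<open>[a, b] = a x\<^sup>2 + x y + b y\<^sup>2\<close>.\<close>

definition binary_qform :: "'a::field \<Rightarrow> 'a \<Rightarrow> 'a qform" where
  "binary_qform a b = \<lparr>qdim = 2,
     qval = (\<lambda>v. a * (v $ 0)\<^sup>2 + v $ 0 * v $ 1 + b * (v $ 1)\<^sup>2)\<rparr>"

definition diag_bform :: "'a::field list \<Rightarrow> 'a bform" where
  "diag_bform as = \<lparr>bdim = length as, bval = (\<lambda>u v. \<Sum>i<length as. as ! i * u $ i * v $ i)\<rparr>"

section \<open>Tensor products\<close>

text \<open>
  \<open>F\<^sup>m \<otimes> F\<^sup>d\<close> is identified with \<open>F\<^bsup>m d\<^esup>\<close> by listing the \<open>d\<close>-blocks \<open>w\<^sub>0, \<dots>, w\<^bsub>m-1\<^esub>\<close> of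
  \<open>w = \<Sum>\<^sub>i e\<^sub>i \<otimes> w\<^sub>i\<close>.
\<close>

definition block :: "nat \<Rightarrow> 'a vec \<Rightarrow> nat \<Rightarrow> 'a vec" where
  "block d w i = vec d (\<lambda>k. w $ (i * d + k))"

definition bb_tensor :: "'a::field bform \<Rightarrow> 'a bform \<Rightarrow> 'a bform" (infixr \<open>\<otimes>\<^sub>b\<close> 70) where
  "b \<otimes>\<^sub>b c = \<lparr>bdim = bdim b * bdim c,
     bval = (\<lambda>u v. \<Sum>i<bdim b. \<Sum>j<bdim b.
        bval b (unit_vec (bdim b) i) (unit_vec (bdim b) j) *
        bval c (block (bdim c) u i) (block (bdim c) v j))\<rparr>"

text \<open>
  The product of a symmetric bilinear form \<open>b\<close> with a quadratic form \<open>q\<close> is the quadratic form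
  determined by \<open>v \<otimes> w \<mapsto> b(v, v) q(w)\<close> and by its polar form, the tensor product of \<open>b\<close> with
  the polar form of \<open>q\<close>. Expanding it on \<open>\<Sum>\<^sub>i e\<^sub>i \<otimes> w\<^sub>i\<close> gives the following expression.
\<close>

definition bq_tensor :: "'a::field bform \<Rightarrow> 'a qform \<Rightarrow> 'a qform" (infixr \<open>\<otimes>\<^sub>q\<close> 70) where
  "b \<otimes>\<^sub>q q = \<lparr>qdim = bdim b * qdim q,
     qval = (\<lambda>w.
       (\<Sum>i<bdim b. bval b (unit_vec (bdim b) i) (unit_vec (bdim b) i) *
          qval q (block (qdim q) w i)) +
       (\<Sum>j<bdim b. \<Sum>i<j. bval b (unit_vec (bdim b) i) (unit_vec (bdim b) j) *
          polar q (block (qdim q) w i) (block (qdim q) w j)))\<rparr>"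

section \<open>Pfister forms\<close>

text \<open>\<open>\<langle>\<langle>\<beta>\<^sub>1, \<dots>, \<beta>\<^sub>m\<rangle>\<rangle>\<close>; the empty product is \<open>\<langle>1\<rangle>\<close>, the unit of the tensor product.\<close>

primrec pfister_bform :: "'a::field list \<Rightarrow> 'a bform" where
  "pfister_bform [] = diag_bform [1]"
| "pfister_bform (\<beta> # \<beta>s) = diag_bform [1, \<beta>] \<otimes>\<^sub>b pfister_bform \<beta>s"

text \<open>\<open>\<langle>\<langle>\<beta>\<^sub>1, \<dots>, \<beta>\<^bsub>n-1\<^esub>, \<alpha>]]\<close>\<close>

definition pfister_qform :: "'a::field list \<Rightarrow> 'a \<Rightarrow> 'a qform" where
  "pfister_qform \<beta>s \<alpha> = pfister_bform \<beta>s \<otimes>\<^sub>q binary_qform 1 \<alpha>"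

text \<open>
  As usual, the forms isometric to these are called Pfister forms too.
\<close>

definition is_bpfister :: "nat \<Rightarrow> 'a::field bform \<Rightarrow> bool" where
  "is_bpfister m b \<longleftrightarrow> is_bform b \<and>
     (\<exists>\<beta>s. length \<beta>s = m \<and> 0 \<notin> set \<beta>s \<and> b \<cong>\<^sub>b pfister_bform \<beta>s)"

definition is_qpfister :: "nat \<Rightarrow> 'a::field qform \<Rightarrow> bool" where
  "is_qpfister n q \<longleftrightarrow> is_qform q \<and>
     (\<exists>\<beta>s \<alpha>. Suc (length \<beta>s) = n \<and> 0 \<notin> set \<beta>s \<and> q \<cong>\<^sub>q pfister_qform \<beta>s \<alpha>)"

section \<open>Witt classes\<close>

abbreviation hyperbolic_plane :: "'a::field qform" where
  "hyperbolic_plane \<equiv> binary_qform 0 0"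

definition hyperbolic :: "nat \<Rightarrow> 'a::field qform" where
  "hyperbolic k = ((\<lambda>q. hyperbolic_plane \<bottom>\<^sub>q q) ^^ k) q_zero"

definition even_nonsingular :: "'a::field qform set" where
  "even_nonsingular = {q. is_qform q \<and> even (qdim q) \<and> nonsingular q}"

definition witt_equiv :: "('a::field qform \<times> 'a qform) set" where
  "witt_equiv = {(p, q). p \<in> even_nonsingular \<and> q \<in> even_nonsingular \<and>
     (\<exists>i j. p \<bottom>\<^sub>q hyperbolic i \<cong>\<^sub>q q \<bottom>\<^sub>q hyperbolic j)}"

definition witt_class :: "'a::field qform \<Rightarrow> 'a qform set" where
  "witt_class q = witt_equiv `` {q}"

text \<open>The group \<open>I\<^sub>q\<^sup>1 F\<close> for \<open>F = UNIV :: 'a set\<close>.\<close>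

definition Iq1 :: "'a::field qform set monoid" where
  "Iq1 = \<lparr>carrier = even_nonsingular // witt_equiv,
     monoid.mult = (\<lambda>X Y. \<Union>p \<in> X. \<Union>q \<in> Y. witt_class (p \<bottom>\<^sub>q q)),
     one = witt_class q_zero\<rparr>"

definition Iq :: "nat \<Rightarrow> 'a::field qform set monoid" where
  "Iq n = Iq1\<lparr>carrier :=
     generate Iq1 {witt_class (q_scale c q) | c q. c \<noteq> 0 \<and> is_qpfister n q}\<rparr>"

section \<open>Linkage and tightness\<close>

definition right_linked :: "nat \<Rightarrow> 'a::field qform set \<Rightarrow> bool" where
  "right_linked n S \<longleftrightarrow>
     (\<exists>\<rho>. is_qpfister (n - 1) \<rho> \<and>
        (\<forall>q \<in> S. \<exists>\<beta>. \<beta> \<noteq> 0 \<and> q \<cong>\<^sub>q pfister_bform [\<beta>] \<otimes>\<^sub>q \<rho>))"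

definition left_linked :: "nat \<Rightarrow> 'a::field qform set \<Rightarrow> bool" where
  "left_linked n S \<longleftrightarrow>
     (\<exists>b. is_bpfister (n - 1) b \<and>
        (\<forall>q \<in> S. \<exists>\<alpha>. q \<cong>\<^sub>q b \<otimes>\<^sub>q binary_qform 1 \<alpha>))"

definition strongly_tight :: "nat \<Rightarrow> 'a::field qform set \<Rightarrow> bool" where
  "strongly_tight n S \<longleftrightarrow>
     generate (Iq n) (witt_class ` S) \<subseteq> {witt_class q | q. is_qpfister n q}"

end

theory Submission
  imports Defs "Jordan_Normal_Form.Determinant"
begin

text \<open>
  Let \<open>\<rho>\<close> be the common right factor. Since \<open>\<rho> \<bottom> \<rho>\<close> is hyperbolic in characteristic 2,
  \<open>\<langle>\<langle>a\<rangle>\<rangle>\<rho> + \<langle>\<langle>b\<rangle>\<rangle>\<rho> = a\<rho> \<bottom> b\<rho>\<close> in the Witt group, and everything is governed by the symmetric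
  relation \<open>R(a, b)\<close>: the form \<open>a\<rho> \<bottom> b\<rho>\<close> represents 1, equivalently \<open>\<rho> \<bottom> b\<rho>\<close> represents \<open>a\<close>.

  If the sum is a Pfister form, Witt cancellation shows that \<open>a\<rho> \<bottom> b\<rho>\<close> is isometric to it, whence
  \<open>R(a, b)\<close>; two left-linked forms \<open>B \<otimes> [1, \<gamma>]\<close>, \<open>B \<otimes> [1, \<delta>]\<close> are of this kind, with sum
  \<open>B \<otimes> [1, \<gamma> + \<delta>]\<close>. Conversely, write \<open>1 = a x + b y\<close> with values \<open>x, y\<close> of \<open>\<rho>\<close>. Rescaling the slots
  by \<open>x\<close> and \<open>y\<close> reduces to \<open>b = 1 + a\<close>, where \<open>\<langle>\<langle>a, \<alpha>]] = \<langle>\<langle>1 + a, \<alpha>(1 + a)/a]]\<close> exhibits the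
  common bilinear factor (if \<open>x\<close> or \<open>y\<close> is 0, one of the forms is hyperbolic).

  For strong tightness, \<open>R(a, b)\<close> gives \<open>a\<rho> \<bottom> b\<rho> = \<langle>\<langle>ab\<rangle>\<rangle>\<rho>\<close> because Pfister forms are round, and for
  the same reason \<open>R(\<cdot>, d)\<close> is closed under products. Hence the slots \<open>c\<close> which are \<open>R\<close>-related to
  everything that is \<open>R\<close>-related to all slots of \<open>S\<close> are closed under products, contain the slots of
  \<open>S\<close>, and \<open>c \<mapsto> \<langle>\<langle>c\<rangle>\<rangle>\<rho>\<close> is multiplicative on them.
\<close>

subsection \<open>Linear maps between coordinate spaces\<close>

definition linear_form :: "nat \<Rightarrow> ('a::field vec \<Rightarrow> 'a) \<Rightarrow> bool" where
  "linear_form d L \<longleftrightarrow>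
     (\<forall>u \<in> carrier_vec d. \<forall>v \<in> carrier_vec d. L (u + v) = L u + L v) \<and>
     (\<forall>c. \<forall>v \<in> carrier_vec d. L (c \<cdot>\<^sub>v v) = c * L v)"

text \<open>Linearity is demanded coordinate by coordinate, so that a map given by explicit formulas
  for its coordinates is checked by the closure rules for \<open>linear_form\<close>. Additivity and
  homogeneity as equations between vectors are derived below.\<close>

definition vec_linear :: "nat \<Rightarrow> nat \<Rightarrow> ('a::field vec \<Rightarrow> 'a vec) \<Rightarrow> bool" where
  "vec_linear d e f \<longleftrightarrow>
     (\<forall>v \<in> carrier_vec d. f v \<in> carrier_vec e) \<and> (\<forall>i < e. linear_form d (\<lambda>v. f v $ i))"

lemma linear_form_add: "\<lbrakk>linear_form d L; u \<in> carrier_vec d; v \<in> carrier_vec d\<rbrakk> \<Longrightarrow> L (u + v) = L u + L v"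
  and linear_form_smult: "\<lbrakk>linear_form d L; v \<in> carrier_vec d\<rbrakk> \<Longrightarrow> L (c \<cdot>\<^sub>v v) = c * L v"
  by (auto simp: linear_form_def)

lemma smult_zero_vec [simp]: "c \<cdot>\<^sub>v 0\<^sub>v d = (0\<^sub>v d :: 'a::mult_zero vec)"
  by (rule eq_vecI) auto

lemma linear_form_zero: "linear_form d L \<Longrightarrow> L (0\<^sub>v d) = 0"
  using linear_form_smult[of d L "0\<^sub>v d" 0] by simp

lemma linear_form_index: "i < d \<Longrightarrow> linear_form d (\<lambda>v. v $ i)"
  by (auto simp: linear_form_def)

lemma linear_form_0: "linear_form d (\<lambda>v. 0)"
  by (auto simp: linear_form_def)

lemma linear_form_plus: "\<lbrakk>linear_form d L; linear_form d M\<rbrakk> \<Longrightarrow> linear_form d (\<lambda>v. L v + M v)"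
  by (auto simp: linear_form_def algebra_simps)

lemma linear_form_mult: "linear_form d L \<Longrightarrow> linear_form d (\<lambda>v. c * L v)"
  by (auto simp: linear_form_def algebra_simps)

lemma linear_form_mult_right: "linear_form d L \<Longrightarrow> linear_form d (\<lambda>v. L v * c)"
  by (auto simp: linear_form_def algebra_simps)

lemma linear_form_divide: "linear_form d L \<Longrightarrow> linear_form d (\<lambda>v. L v / c)"
  by (auto simp: linear_form_def add_divide_distrib)

lemma linear_form_if: "\<lbrakk>P \<Longrightarrow> linear_form d L; \<not> P \<Longrightarrow> linear_form d M\<rbrakk> \<Longrightarrow> linear_form d (\<lambda>v. if P then L v else M v)"
  by (cases P) simp_all

lemma vec_linear_carrier: "\<lbrakk>vec_linear d e f; v \<in> carrier_vec d\<rbrakk> \<Longrightarrow> f v \<in> carrier_vec e"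
  by (simp add: vec_linear_def)

lemma vec_linear_index: "\<lbrakk>vec_linear d e f; i < e\<rbrakk> \<Longrightarrow> linear_form d (\<lambda>v. f v $ i)"
  by (simp add: vec_linear_def)

lemma vec_linear_add:
  assumes f: "vec_linear d e f" and "u \<in> carrier_vec d" "v \<in> carrier_vec d"
  shows "f (u + v) = f u + f v"
proof (rule eq_vecI)
  have *: "f u \<in> carrier_vec e" "f v \<in> carrier_vec e" "f (u + v) \<in> carrier_vec e"
    using assms by (simp_all add: vec_linear_carrier)
  then show "dim_vec (f (u + v)) = dim_vec (f u + f v)" by simp
  fix i assume "i < dim_vec (f u + f v)"
  then have "i < e" using * by simp
  then have "linear_form d (\<lambda>v. f v $ i)" using f by (simp add: vec_linear_def)
  from linear_form_add[OF this assms(2,3)] show "f (u + v) $ i = (f u + f v) $ i"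
    using * \<open>i < e\<close> by simp
qed

lemma vec_linear_smult:
  assumes f: "vec_linear d e f" and "v \<in> carrier_vec d"
  shows "f (c \<cdot>\<^sub>v v) = c \<cdot>\<^sub>v f v"
proof (rule eq_vecI)
  have *: "f v \<in> carrier_vec e" "f (c \<cdot>\<^sub>v v) \<in> carrier_vec e"
    using assms by (simp_all add: vec_linear_carrier)
  then show "dim_vec (f (c \<cdot>\<^sub>v v)) = dim_vec (c \<cdot>\<^sub>v f v)" by simp
  fix i assume "i < dim_vec (c \<cdot>\<^sub>v f v)"
  then have "i < e" using * by simp
  then have "linear_form d (\<lambda>v. f v $ i)" using f by (simp add: vec_linear_def)
  from linear_form_smult[OF this assms(2)] show "f (c \<cdot>\<^sub>v v) $ i = (c \<cdot>\<^sub>v f v) $ i"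
    using * \<open>i < e\<close> by simp
qed

lemma vec_linearI:
  assumes "\<And>v. v \<in> carrier_vec d \<Longrightarrow> f v \<in> carrier_vec e"
    and "\<And>u v. u \<in> carrier_vec d \<Longrightarrow> v \<in> carrier_vec d \<Longrightarrow> f (u + v) = f u + f v"
    and "\<And>c v. v \<in> carrier_vec d \<Longrightarrow> f (c \<cdot>\<^sub>v v) = c \<cdot>\<^sub>v f v"
  shows "vec_linear d e f"
proof -
  have "linear_form d (\<lambda>v. f v $ i)" if "i < e" for i
  proof -
    have "dim_vec (f v) = e" if "v \<in> carrier_vec d" for v
      using assms(1)[OF that] by simp
    then show ?thesis using that by (simp add: linear_form_def assms(2,3))
  qed
  then show ?thesis using assms(1) by (simp add: vec_linear_def)
qed

lemma vec_linear_zero: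
  assumes "vec_linear d e f"
  shows "f (0\<^sub>v d) = 0\<^sub>v e"
proof -
  have "f (0\<^sub>v d) = 0 \<cdot>\<^sub>v f (0\<^sub>v d)" using vec_linear_smult[OF assms, of "0\<^sub>v d" 0] by simp
  also have "\<dots> = 0\<^sub>v e"
    using vec_linear_carrier[OF assms, of "0\<^sub>v d"] by (intro eq_vecI) auto
  finally show ?thesis .
qed

lemma linear_form_comp: "\<lbrakk>vec_linear d e f; linear_form e L\<rbrakk> \<Longrightarrow> linear_form d (\<lambda>v. L (f v))"
  unfolding linear_form_def
  by (auto simp: vec_linear_add vec_linear_smult vec_linear_carrier)

lemma vec_linear_id: "vec_linear d d (\<lambda>v. v)"
  by (rule vec_linearI) auto

lemma vec_linear_comp: "\<lbrakk>vec_linear d e f; vec_linear e k g\<rbrakk> \<Longrightarrow> vec_linear d k (\<lambda>v. g (f v))"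
  by (rule vec_linearI) (auto simp: vec_linear_add vec_linear_smult vec_linear_carrier)

lemma vec_linear_vec: "(\<And>i. i < e \<Longrightarrow> linear_form d (L i)) \<Longrightarrow> vec_linear d e (\<lambda>v. vec e (\<lambda>i. L i v))"
  by (rule vec_linearI) (auto simp: linear_form_def)

lemma vec_linear_plus:
  assumes "vec_linear d e f" "vec_linear d e g"
  shows "vec_linear d e (\<lambda>v. f v + g v)"
proof -
  have "linear_form d (\<lambda>v. (f v + g v) $ i)" if i: "i < e" for i
  proof -
    have "linear_form d (\<lambda>v. f v $ i + g v $ i)"
      using assms i by (intro linear_form_plus) (simp_all add: vec_linear_def)
    moreover have "(f v + g v) $ i = f v $ i + g v $ i" if "v \<in> carrier_vec d" for v
      using vec_linear_carrier[OF assms(2) that] i by simp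
    ultimately show ?thesis by (simp add: linear_form_def)
  qed
  then show ?thesis
    using assms by (simp add: vec_linear_def)
qed

lemma vec_linear_scale:
  "vec_linear d e f \<Longrightarrow> vec_linear d e (\<lambda>v. c \<cdot>\<^sub>v f v)"
  by (rule vec_linearI)
    (simp_all add: vec_linear_add vec_linear_smult smult_add_distrib_vec[where n = e]
      vec_linear_carrier smult_smult_assoc mult.commute)

lemma vec_linear_form_scale:
  "\<lbrakk>linear_form d L; w \<in> carrier_vec e\<rbrakk> \<Longrightarrow> vec_linear d e (\<lambda>v. L v \<cdot>\<^sub>v w)"
  by (rule vec_linearI)
    (simp_all add: linear_form_add linear_form_smult add_smult_distrib_vec smult_smult_assoc)

lemma vec_linear_const0: "vec_linear d e (\<lambda>v. 0\<^sub>v e)"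
  by (rule vec_linearI) auto

section \<open>Projections to direct summands and concatenation\<close>

lemma vec_linear_first: "vec_linear (d + e) d (\<lambda>v. vec_first v d)"
  unfolding vec_first_def by (rule vec_linear_vec) (auto intro: linear_form_index)

lemma vec_linear_last: "vec_linear (d + e) e (\<lambda>v. vec_last v e)"
  by (rule vec_linearI) (auto simp: vec_last_def)

lemma append_vec_smult: "c \<cdot>\<^sub>v (u @\<^sub>v v) = (c \<cdot>\<^sub>v u) @\<^sub>v (c \<cdot>\<^sub>v (v :: 'a::semiring_0 vec))"
  by (rule eq_vecI) auto

lemma vec_linear_append:
  "\<lbrakk>vec_linear k d f; vec_linear k e g\<rbrakk> \<Longrightarrow> vec_linear k (d + e) (\<lambda>v. f v @\<^sub>v g v)"
  by (rule vec_linearI)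
    (simp_all add: vec_linear_add vec_linear_smult vec_linear_carrier append_vec_smult
      append_vec_add[where n = d and m = e])

lemmas vec_linear_intros = vec_linear_id vec_linear_plus vec_linear_scale vec_linear_const0
  vec_linear_first vec_linear_last vec_linear_append

lemmas linear_form_intros = linear_form_index linear_form_0 linear_form_plus linear_form_mult
  linear_form_mult_right linear_form_divide linear_form_if

lemma vec_first_append[simp]: "u \<in> carrier_vec d \<Longrightarrow> vec_first (u @\<^sub>v v) d = u"
  by (auto simp: vec_first_def)

lemma vec_last_append[simp]: "v \<in> carrier_vec e \<Longrightarrow> vec_last (u @\<^sub>v v) e = v"
  by (auto simp: vec_last_def)

lemma carrier_vec_appendE:
  assumes "v \<in> carrier_vec (d + e)"
  obtains a b where "a \<in> carrier_vec d" "b \<in> carrier_vec e" "v = a @\<^sub>v b"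
  using assms vec_first_last_append[of v d e] by (metis vec_first_carrier vec_last_carrier)

text \<open>Since the dimension is kept, the truncations of \<open>v\<close> are the partial sums of
  its expansion in unit vectors. Expansions of linear and of quadratic forms thus become inductions
  on \<open>k\<close>.\<close>

definition vec_trunc :: "nat \<Rightarrow> 'a::zero vec \<Rightarrow> 'a vec" where
  "vec_trunc k v = vec (dim_vec v) (\<lambda>i. if i < k then v $ i else 0)"

lemma vec_trunc_carrier: "v \<in> carrier_vec d \<Longrightarrow> vec_trunc k v \<in> carrier_vec d"
  by (auto simp: vec_trunc_def)

lemma vec_trunc_0: "v \<in> carrier_vec d \<Longrightarrow> vec_trunc 0 v = 0\<^sub>v d"
  by (auto simp: vec_trunc_def)

lemma vec_trunc_Suc:
  "\<lbrakk>v \<in> carrier_vec d; k < d\<rbrakk> \<Longrightarrow> vec_trunc (Suc k) v = vec_trunc k v + v $ k \<cdot>\<^sub>v unit_vec d k"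
  for v :: "'a::field vec"
  by (rule eq_vecI) (auto simp: vec_trunc_def less_Suc_eq)

lemma vec_trunc_full: "v \<in> carrier_vec d \<Longrightarrow> vec_trunc d v = v"
  by (rule eq_vecI) (auto simp: vec_trunc_def)

lemma linear_form_trunc:
  assumes L: "linear_form d L" and v: "v \<in> carrier_vec d" and "k \<le> d"
  shows "L (vec_trunc k v) = (\<Sum>i<k. v $ i * L (unit_vec d i))"
  using \<open>k \<le> d\<close>
proof (induction k)
  case 0
  then show ?case using linear_form_zero[OF L] vec_trunc_0[OF v] by simp
next
  case (Suc k)
  then show ?case
    using linear_form_add[OF L vec_trunc_carrier[OF v], of "v $ k \<cdot>\<^sub>v unit_vec d k" k]
      linear_form_smult[OF L, of "unit_vec d k" "v $ k"]
    by (simp add: vec_trunc_Suc[OF v])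
qed

lemma linear_form_expand:
  assumes "linear_form d L" "v \<in> carrier_vec d"
  shows "L v = (\<Sum>i<d. v $ i * L (unit_vec d i))"
  using linear_form_trunc[OF assms order_refl] by (simp add: vec_trunc_full[OF assms(2)])

section \<open>Matrices of linear maps and invertibility\<close>

lemma vec_linear_matrix:
  assumes f: "vec_linear d e f"
  obtains A where "A \<in> carrier_mat e d" "\<And>v. v \<in> carrier_vec d \<Longrightarrow> f v = A *\<^sub>v v"
proof
  let ?A = "mat e d (\<lambda>(i, j). f (unit_vec d j) $ i)"
  show "?A \<in> carrier_mat e d" by simp
  fix v :: "'a vec" assume v: "v \<in> carrier_vec d"
  show "f v = ?A *\<^sub>v v"
  proof (rule eq_vecI)
    fix i assume "i < dim_vec (?A *\<^sub>v v)"
    then have i: "i < e" by simp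
    then have "linear_form d (\<lambda>v. f v $ i)" using f by (simp add: vec_linear_def)
    from linear_form_expand[OF this v] show "f v $ i = (?A *\<^sub>v v) $ i"
      using i v by (simp add: scalar_prod_def atLeast0LessThan mult.commute)
  qed (use vec_linear_carrier[OF f v] in auto)
qed

lemma mult_mat_vec_zero: "A \<in> carrier_mat e d \<Longrightarrow> A *\<^sub>v 0\<^sub>v d = (0\<^sub>v e :: 'a::semiring_0 vec)"
  by (rule eq_vecI) (auto simp: scalar_prod_def)

lemma vec_linear_mult_mat: "A \<in> carrier_mat e d \<Longrightarrow> vec_linear d e (\<lambda>v. A *\<^sub>v v)"
  by (rule vec_linearI) (auto simp: mult_add_distrib_mat_vec mult_mat_vec)

text \<open>Over a field a trivial kernel forces a nonzero determinant, which makes the matrix a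
  unit of the matrix ring.\<close>

lemma invertible_matI:
  fixes A :: "'a::field mat"
  assumes A: "A \<in> carrier_mat d d"
    and inj: "\<And>v. v \<in> carrier_vec d \<Longrightarrow> A *\<^sub>v v = 0\<^sub>v d \<Longrightarrow> v = 0\<^sub>v d"
  shows "invertible_mat A"
proof -
  have "det A \<noteq> 0" using det_0_iff_vec_prod_zero_field[OF A] inj by blast
  from det_non_zero_imp_unit[OF A this, of "()"]
  obtain B where "B \<in> carrier_mat d d" "B * A = 1\<^sub>m d" "A * B = 1\<^sub>m d"
    unfolding Units_def ring_mat_def by auto
  then show ?thesis using A unfolding invertible_mat_def inverts_mat_def by auto
qed

lemma invertible_matE:
  fixes A :: "'a::field mat"
  assumes "A \<in> carrier_mat d d" "invertible_mat A"
  obtains B where "B \<in> carrier_mat d d" "B * A = 1\<^sub>m d" "A * B = 1\<^sub>m d"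
proof -
  obtain B where *: "A * B = 1\<^sub>m (dim_row A)" "B * A = 1\<^sub>m (dim_row B)"
    using assms(2) unfolding invertible_mat_def inverts_mat_def by auto
  \<comment> \<open>\<open>inverts_mat\<close> does not fix the dimensions of \<open>B\<close>;
    comparing the numbers of columns in the two product equations recovers them.\<close>
  from arg_cong[OF *(1), of dim_col] have "dim_col B = d" using assms(1) by simp
  moreover from arg_cong[OF *(2), of dim_col] have "dim_row B = d" using assms(1) by simp
  ultimately show thesis using that[of B] * assms(1) by auto
qed

subsection \<open>Quadratic forms\<close>

text \<open>The polar form is symmetric because vector addition is commutative, so linearity in one
  argument already gives bilinearity.\<close>

lemma is_qformI:
  assumes "\<And>c v. v \<in> carrier_vec (qdim q) \<Longrightarrow> qval q (c \<cdot>\<^sub>v v) = c\<^sup>2 * qval q v"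
    and "\<And>w. w \<in> carrier_vec (qdim q) \<Longrightarrow> linear_form (qdim q) (\<lambda>u. polar q u w)"
  shows "is_qform q"
proof -
  have *: "polar q u v = polar q v u" if "u \<in> carrier_vec (qdim q)" "v \<in> carrier_vec (qdim q)" for u v
    by (simp add: polar_def comm_add_vec[OF that])
  show ?thesis
    unfolding is_qform_def is_bform_def qform.simps bform.simps
    using assms(2) unfolding linear_form_def by (auto intro: * simp: assms(1))
qed

lemma qval_smult: "\<lbrakk>is_qform q; v \<in> carrier_vec (qdim q)\<rbrakk> \<Longrightarrow> qval q (c \<cdot>\<^sub>v v) = c\<^sup>2 * qval q v"
  by (simp add: is_qform_def)

lemma qval_add: "qval q (u + v) = qval q u + qval q v + polar q u v"
  by (simp add: polar_def)

lemma qval_zero: "is_qform q \<Longrightarrow> qval q (0\<^sub>v (qdim q)) = 0"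
  using qval_smult[of q "0\<^sub>v (qdim q)" 0] by simp

lemma polar_commute:
  "\<lbrakk>u \<in> carrier_vec (qdim q); v \<in> carrier_vec (qdim q)\<rbrakk> \<Longrightarrow> polar q u v = polar q v u"
  by (simp add: polar_def comm_add_vec[of u "qdim q" v])

lemma polar_linear_left:
  "\<lbrakk>is_qform q; w \<in> carrier_vec (qdim q)\<rbrakk> \<Longrightarrow> linear_form (qdim q) (\<lambda>u. polar q u w)"
  by (auto simp: is_qform_def is_bform_def linear_form_def)

lemma polar_linear_right:
  "\<lbrakk>is_qform q; w \<in> carrier_vec (qdim q)\<rbrakk> \<Longrightarrow> linear_form (qdim q) (\<lambda>u. polar q w u)"
  using polar_linear_left[of q w] unfolding linear_form_def
  by (simp add: polar_commute[of w q])

section \<open>Building quadratic forms\<close>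

lemma is_qform_cong:
  assumes "is_qform p" "qdim q = qdim p" "\<And>v. v \<in> carrier_vec (qdim p) \<Longrightarrow> qval q v = qval p v"
  shows "is_qform q"
proof (rule is_qformI)
  fix w :: "'a vec" assume "w \<in> carrier_vec (qdim q)"
  then show "linear_form (qdim q) (\<lambda>u. polar q u w)"
    using polar_linear_left[OF assms(1), of w] by (simp add: linear_form_def polar_def assms(2,3))
qed (use assms in \<open>simp add: qval_smult\<close>)

text \<open>Products of two linear forms are the building blocks. With the closure under sums,
  scalars and linear substitution proved next, a form written as a polynomial in coordinates is
  recognised as quadratic without computing its polar form.\<close>

lemma is_qform_mult:
  assumes "linear_form d L" "linear_form d M"
  shows "is_qform \<lparr>qdim = d, qval = (\<lambda>v. L v * M v)\<rparr>"
proof (rule is_qformI)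
  fix w :: "'a vec" assume "w \<in> carrier_vec (qdim \<lparr>qdim = d, qval = \<lambda>v. L v * M v\<rparr>)"
  then have w: "w \<in> carrier_vec d" by simp
  have "linear_form d (\<lambda>u. L u * M w + M u * L w)"
    by (intro linear_form_intros assms)
  moreover have "polar \<lparr>qdim = d, qval = \<lambda>v. L v * M v\<rparr> u w = L u * M w + M u * L w"
    if "u \<in> carrier_vec d" for u
    using that w by (simp add: polar_def linear_form_add[OF assms(1)] linear_form_add[OF assms(2)]
        ring_distribs mult.commute)
  ultimately show "linear_form (qdim \<lparr>qdim = d, qval = \<lambda>v. L v * M v\<rparr>)
      (\<lambda>u. polar \<lparr>qdim = d, qval = \<lambda>v. L v * M v\<rparr> u w)"
    by (simp add: linear_form_def)
qed (use assms in \<open>simp add: linear_form_smult power2_eq_square\<close>)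

lemma is_qform_add:
  assumes "is_qform \<lparr>qdim = d, qval = f\<rparr>" "is_qform \<lparr>qdim = d, qval = g\<rparr>"
  shows "is_qform \<lparr>qdim = d, qval = (\<lambda>v. f v + g v)\<rparr>"
proof (rule is_qformI)
  fix w :: "'a vec" assume "w \<in> carrier_vec (qdim \<lparr>qdim = d, qval = \<lambda>v. f v + g v\<rparr>)"
  then have "linear_form d (\<lambda>u. polar \<lparr>qdim = d, qval = f\<rparr> u w + polar \<lparr>qdim = d, qval = g\<rparr> u w)"
    using polar_linear_left[OF assms(1)] polar_linear_left[OF assms(2)]
    by (intro linear_form_plus) auto
  moreover have "polar \<lparr>qdim = d, qval = \<lambda>v. f v + g v\<rparr> u w =
      polar \<lparr>qdim = d, qval = f\<rparr> u w + polar \<lparr>qdim = d, qval = g\<rparr> u w" for u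
    by (simp add: polar_def)
  ultimately show "linear_form (qdim \<lparr>qdim = d, qval = \<lambda>v. f v + g v\<rparr>)
      (\<lambda>u. polar \<lparr>qdim = d, qval = \<lambda>v. f v + g v\<rparr> u w)"
    by simp
qed (use qval_smult[OF assms(1)] qval_smult[OF assms(2)] in \<open>simp add: distrib_left\<close>)

lemma is_qform_scale:
  assumes "is_qform \<lparr>qdim = d, qval = f\<rparr>"
  shows "is_qform \<lparr>qdim = d, qval = (\<lambda>v. c * f v)\<rparr>"
proof (rule is_qformI)
  fix w :: "'a vec" assume "w \<in> carrier_vec (qdim \<lparr>qdim = d, qval = \<lambda>v. c * f v\<rparr>)"
  then have "linear_form d (\<lambda>u. c * polar \<lparr>qdim = d, qval = f\<rparr> u w)"
    using polar_linear_left[OF assms] by (intro linear_form_mult) auto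
  then show "linear_form (qdim \<lparr>qdim = d, qval = \<lambda>v. c * f v\<rparr>)
      (\<lambda>u. polar \<lparr>qdim = d, qval = \<lambda>v. c * f v\<rparr> u w)"
    by (simp add: polar_def right_diff_distrib)
qed (use qval_smult[OF assms] in simp)

lemma is_qform_comp:
  assumes "vec_linear e d h" "is_qform \<lparr>qdim = d, qval = f\<rparr>"
  shows "is_qform \<lparr>qdim = e, qval = (\<lambda>v. f (h v))\<rparr>"
proof (rule is_qformI)
  fix w :: "'a vec" assume w: "w \<in> carrier_vec (qdim \<lparr>qdim = e, qval = \<lambda>v. f (h v)\<rparr>)"
  then have "linear_form e (\<lambda>u. polar \<lparr>qdim = d, qval = f\<rparr> (h u) (h w))"
    using polar_linear_left[OF assms(2), of "h w"] vec_linear_carrier[OF assms(1)]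
    by (intro linear_form_comp[OF assms(1)]) auto
  moreover have "polar \<lparr>qdim = e, qval = \<lambda>v. f (h v)\<rparr> u w = polar \<lparr>qdim = d, qval = f\<rparr> (h u) (h w)"
    if "u \<in> carrier_vec e" for u
    using that w by (simp add: polar_def vec_linear_add[OF assms(1)])
  ultimately show "linear_form (qdim \<lparr>qdim = e, qval = \<lambda>v. f (h v)\<rparr>)
      (\<lambda>u. polar \<lparr>qdim = e, qval = \<lambda>v. f (h v)\<rparr> u w)"
    by (simp add: linear_form_def)
qed (use qval_smult[OF assms(2)] in
    \<open>simp add: vec_linear_smult[OF assms(1)] vec_linear_carrier[OF assms(1)]\<close>)

lemma is_qform_sum:
  assumes "finite I" "\<And>i. i \<in> I \<Longrightarrow> is_qform \<lparr>qdim = d, qval = f i\<rparr>"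
  shows "is_qform \<lparr>qdim = d, qval = (\<lambda>v. \<Sum>i\<in>I. f i v)\<rparr>"
  using assms
proof (induction I)
  case empty
  show ?case using is_qform_mult[OF linear_form_0 linear_form_0, of d] by simp
next
  case (insert i I)
  then show ?case using is_qform_add[of d "f i" "\<lambda>v. \<Sum>i\<in>I. f i v"] by simp
qed

section \<open>Nonsingular forms and isometries\<close>

definition regular :: "'a::field qform \<Rightarrow> bool" where
  "regular q \<longleftrightarrow> is_qform q \<and> nonsingular q"

lemma regularD: "regular q \<Longrightarrow> is_qform q" "regular q \<Longrightarrow> nonsingular q"
  by (auto simp: regular_def)

lemma nonsingularI:
  assumes "\<And>u. u \<in> carrier_vec (qdim q) \<Longrightarrow> (\<And>v. v \<in> carrier_vec (qdim q) \<Longrightarrow> polar q u v = 0) \<Longrightarrow> u = 0\<^sub>v (qdim q)"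
  shows "nonsingular q"
  using assms by (auto simp: nonsingular_def)

lemma nonsingularD:
  assumes "nonsingular q" "u \<in> carrier_vec (qdim q)" "u \<noteq> 0\<^sub>v (qdim q)"
  obtains v where "v \<in> carrier_vec (qdim q)" "polar q u v \<noteq> 0"
  using assms unfolding nonsingular_def by blast

lemma polar_vec_linear:
  assumes "vec_linear (qdim p) (qdim q) f"
    and "\<And>v. v \<in> carrier_vec (qdim p) \<Longrightarrow> qval p v = qval q (f v)"
    and "u \<in> carrier_vec (qdim p)" "v \<in> carrier_vec (qdim p)"
  shows "polar p u v = polar q (f u) (f v)"
  using assms(3,4) by (simp add: polar_def assms(2) vec_linear_add[OF assms(1)])

text \<open>A map that preserves values preserves polar values, so a vector in its kernel is
  orthogonal to the whole space and vanishes by nonsingularity of \<open>p\<close>. Equal dimensions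
  then make the map invertible. Every isometry constructed below is therefore given by a linear map
  in one direction, without an inverse.\<close>

lemma q_isometricI:
  assumes p: "regular p" and d: "qdim p = qdim q"
    and f: "vec_linear (qdim p) (qdim q) f"
    and eq: "\<And>v. v \<in> carrier_vec (qdim p) \<Longrightarrow> qval p v = qval q (f v)"
  shows "p \<cong>\<^sub>q q"
proof -
  from vec_linear_matrix[OF f] obtain A where A: "A \<in> carrier_mat (qdim q) (qdim p)"
    and fA: "\<And>v. v \<in> carrier_vec (qdim p) \<Longrightarrow> f v = A *\<^sub>v v" by blast
  have "v = 0\<^sub>v (qdim q)" if v: "v \<in> carrier_vec (qdim q)" "A *\<^sub>v v = 0\<^sub>v (qdim q)" for v
  proof (rule ccontr)
    assume "v \<noteq> 0\<^sub>v (qdim q)"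
    then obtain w where w: "w \<in> carrier_vec (qdim p)" "polar p v w \<noteq> 0"
      using v(1) nonsingularD[OF regularD(2)[OF p]] d by metis
    have "f v = 0\<^sub>v (qdim q)" using fA v d by simp
    moreover have "qval p (0\<^sub>v (qdim p)) = qval q (0\<^sub>v (qdim q))"
      using eq[of "0\<^sub>v (qdim p)"] vec_linear_zero[OF f] by simp
    ultimately have "polar p v w = 0"
      using polar_vec_linear[OF f eq, of v w] v w d vec_linear_carrier[OF f w(1)]
        qval_zero[OF regularD(1)[OF p]] by (simp add: polar_def[of q])
    with w show False by simp
  qed
  then have "invertible_mat A" using A d by (intro invertible_matI) auto
  then show ?thesis using A fA eq d by (auto simp: q_isometric_def)
qed

lemma q_isometricE:
  assumes "p \<cong>\<^sub>q q"
  obtains f where "qdim p = qdim q" "vec_linear (qdim p) (qdim q) f"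
    "\<And>v. v \<in> carrier_vec (qdim p) \<Longrightarrow> qval p v = qval q (f v)"
proof -
  from assms obtain A where "qdim p = qdim q" "A \<in> carrier_mat (qdim q) (qdim q)"
    "\<forall>v \<in> carrier_vec (qdim q). qval p v = qval q (A *\<^sub>v v)"
    by (auto simp: q_isometric_def)
  then show thesis using that[of "\<lambda>v. A *\<^sub>v v"] vec_linear_mult_mat by auto
qed

lemma q_isometric_sym:
  assumes "p \<cong>\<^sub>q q"
  shows "q \<cong>\<^sub>q p"
proof -
  from assms obtain A where d: "qdim p = qdim q" and A: "A \<in> carrier_mat (qdim q) (qdim q)" "invertible_mat A"
    and eq: "\<forall>v \<in> carrier_vec (qdim q). qval p v = qval q (A *\<^sub>v v)"
    by (auto simp: q_isometric_def)
  from invertible_matE[OF A] obtain B where B: "B \<in> carrier_mat (qdim q) (qdim q)"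
    "B * A = 1\<^sub>m (qdim q)" "A * B = 1\<^sub>m (qdim q)" .
  have "invertible_mat B" using A B by (auto simp: invertible_mat_def inverts_mat_def)
  moreover have "qval q v = qval p (B *\<^sub>v v)" if v: "v \<in> carrier_vec (qdim q)" for v
  proof -
    have "A *\<^sub>v (B *\<^sub>v v) = v" using A B v by (simp flip: assoc_mult_mat_vec)
    then show ?thesis using eq B v by auto
  qed
  ultimately show ?thesis using B d by (auto simp: q_isometric_def)
qed

lemma q_isometric_trans [trans]:
  assumes "p \<cong>\<^sub>q q" "q \<cong>\<^sub>q r"
  shows "p \<cong>\<^sub>q r"
proof -
  from assms(1) obtain A where d: "qdim p = qdim q" and A: "A \<in> carrier_mat (qdim q) (qdim q)" "invertible_mat A"
    and eq: "\<forall>v \<in> carrier_vec (qdim q). qval p v = qval q (A *\<^sub>v v)"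
    by (auto simp: q_isometric_def)
  from assms(2) obtain B where d': "qdim q = qdim r" and B: "B \<in> carrier_mat (qdim q) (qdim q)" "invertible_mat B"
    and eq': "\<forall>v \<in> carrier_vec (qdim q). qval q v = qval r (B *\<^sub>v v)"
    by (auto simp: q_isometric_def)
  have "invertible_mat (B * A)"
  proof (rule invertible_matI)
    fix v assume v: "v \<in> carrier_vec (qdim q)" and "(B * A) *\<^sub>v v = 0\<^sub>v (qdim q)"
    then have *: "B *\<^sub>v (A *\<^sub>v v) = 0\<^sub>v (qdim q)" using A B by simp
    obtain A' B' where "A' \<in> carrier_mat (qdim q) (qdim q)" "B' \<in> carrier_mat (qdim q) (qdim q)"
      "A' * A = 1\<^sub>m (qdim q)" "B' * B = 1\<^sub>m (qdim q)"
      using invertible_matE[OF A] invertible_matE[OF B] by metis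
    note AB = this A B v
    have "A *\<^sub>v v = (B' * B) *\<^sub>v (A *\<^sub>v v)" using AB by simp
    also have "\<dots> = B' *\<^sub>v (B *\<^sub>v (A *\<^sub>v v))" using AB(1,2,5-) by simp
    also have "\<dots> = 0\<^sub>v (qdim q)" using * AB by (simp add: mult_mat_vec_zero)
    finally have **: "A *\<^sub>v v = 0\<^sub>v (qdim q)" .
    have "v = (A' * A) *\<^sub>v v" using AB by simp
    also have "\<dots> = A' *\<^sub>v (A *\<^sub>v v)" using AB(1,2,5-) by simp
    also have "\<dots> = 0\<^sub>v (qdim q)" using ** AB by (simp add: mult_mat_vec_zero)
    finally show "v = 0\<^sub>v (qdim q)" .
  qed (use A B in auto)
  moreover have "qval p v = qval r ((B * A) *\<^sub>v v)" if "v \<in> carrier_vec (qdim q)" for v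
    using that A B eq eq' by simp
  ultimately show ?thesis using A B d d' by (auto simp: q_isometric_def intro!: bexI[of _ "B * A"])
qed

lemma q_isometric_refl: "q \<cong>\<^sub>q q"
  unfolding q_isometric_def
  by (auto intro!: bexI[of _ "1\<^sub>m (qdim q)"] invertible_matI)

lemma is_qform_isometric:
  assumes "p \<cong>\<^sub>q q" "is_qform q"
  shows "is_qform p"
proof -
  obtain f where d: "qdim p = qdim q" and f: "vec_linear (qdim p) (qdim q) f"
    and eq: "\<And>v. v \<in> carrier_vec (qdim p) \<Longrightarrow> qval p v = qval q (f v)"
    using q_isometricE[OF assms(1)] by metis
  have "is_qform \<lparr>qdim = qdim q, qval = qval q\<rparr>"
    by (rule is_qform_cong[OF assms(2)]) auto
  from is_qform_comp[OF f this] show ?thesis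
    by (rule is_qform_cong) (simp_all add: eq)
qed

lemma regular_isometric:
  assumes "p \<cong>\<^sub>q q" "regular q"
  shows "regular p"
proof -
  have d: "qdim p = qdim q" using assms(1) by (simp add: q_isometric_def)
  have "nonsingular p"
  proof (rule nonsingularI, rule ccontr)
    fix u assume u: "u \<in> carrier_vec (qdim p)" and 0: "\<And>v. v \<in> carrier_vec (qdim p) \<Longrightarrow> polar p u v = 0"
      and "u \<noteq> 0\<^sub>v (qdim p)"
    from assms(1) obtain A where A: "A \<in> carrier_mat (qdim q) (qdim q)" "invertible_mat A"
      and eqA: "\<forall>v \<in> carrier_vec (qdim q). qval p v = qval q (A *\<^sub>v v)"
      by (auto simp: q_isometric_def)
    from invertible_matE[OF A] obtain B where B: "B \<in> carrier_mat (qdim q) (qdim q)"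
      "B * A = 1\<^sub>m (qdim q)" "A * B = 1\<^sub>m (qdim q)" .
    have u': "B *\<^sub>v (A *\<^sub>v u) = u" using A B u d by (simp flip: assoc_mult_mat_vec)
    have Au: "A *\<^sub>v u \<in> carrier_vec (qdim q)" using A u d by simp
    have "A *\<^sub>v u \<noteq> 0\<^sub>v (qdim q)"
    proof
      assume "A *\<^sub>v u = 0\<^sub>v (qdim q)"
      with u' have "u = B *\<^sub>v 0\<^sub>v (qdim q)" by simp
      then show False using \<open>u \<noteq> _\<close> d mult_mat_vec_zero[OF B(1)] by simp
    qed
    \<comment> \<open>The vector that pairs nontrivially with the image of \<open>u\<close> is
      pulled back along the inverse \<open>B\<close>.\<close>
    then obtain w where w: "w \<in> carrier_vec (qdim q)" "polar q (A *\<^sub>v u) w \<noteq> 0"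
      using nonsingularD[OF regularD(2)[OF assms(2)] Au] by blast
    have Bw: "B *\<^sub>v w \<in> carrier_vec (qdim p)" using B w d by simp
    have "A *\<^sub>v (B *\<^sub>v w) = w" using A B w by (simp flip: assoc_mult_mat_vec)
    moreover have "polar p u (B *\<^sub>v w) = polar q (A *\<^sub>v u) (A *\<^sub>v (B *\<^sub>v w))"
    proof (rule polar_vec_linear[OF _ _ u Bw])
      show "vec_linear (qdim p) (qdim q) (\<lambda>v. A *\<^sub>v v)"
        using vec_linear_mult_mat[OF A(1)] d by simp
    qed (use eqA d in simp)
    ultimately show False using 0[OF Bw] w(2) by simp
  qed
  then show ?thesis using is_qform_isometric[OF assms(1)] assms(2) by (auto simp: regular_def)
qed

subsection \<open>Orthogonal sums\<close>

lemma qdim_orth [simp]: "qdim (p \<bottom>\<^sub>q q) = qdim p + qdim q"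
  by (simp add: q_orth_def)

lemma qdim_scale [simp]: "qdim (q_scale c q) = qdim q"
  and qval_scale [simp]: "qval (q_scale c q) v = c * qval q v"
  and qdim_zero [simp]: "qdim q_zero = 0"
  and qval_zero_form [simp]: "qval q_zero v = 0"
  and qdim_binary [simp]: "qdim (binary_qform a b) = 2"
  by (simp_all add: q_scale_def q_zero_def binary_qform_def)

lemma orth_carrierE:
  assumes "w \<in> carrier_vec (qdim (p \<bottom>\<^sub>q q))"
  obtains u v where "u \<in> carrier_vec (qdim p)" "v \<in> carrier_vec (qdim q)" "w = u @\<^sub>v v"
  using assms unfolding qdim_orth by (rule carrier_vec_appendE)

lemma qval_orth:
  "\<lbrakk>u \<in> carrier_vec (qdim p); v \<in> carrier_vec (qdim q)\<rbrakk> \<Longrightarrow> qval (p \<bottom>\<^sub>q q) (u @\<^sub>v v) = qval p u + qval q v"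
  by (simp add: q_orth_def)

lemma polar_orth:
  assumes "u \<in> carrier_vec (qdim p)" "v \<in> carrier_vec (qdim q)"
    "u' \<in> carrier_vec (qdim p)" "v' \<in> carrier_vec (qdim q)"
  shows "polar (p \<bottom>\<^sub>q q) (u @\<^sub>v v) (u' @\<^sub>v v') = polar p u u' + polar q v v'"
  using assms by (simp add: polar_def append_vec_add[where n = "qdim p" and m = "qdim q"] qval_orth)

lemma polar_scale: "polar (q_scale c q) u v = c * polar q u v"
  by (simp add: polar_def right_diff_distrib)

lemma is_qform_orth:
  assumes "is_qform p" "is_qform q"
  shows "is_qform (p \<bottom>\<^sub>q q)"
proof -
  let ?d = "qdim p + qdim q"
  have "is_qform \<lparr>qdim = qdim p, qval = qval p\<rparr>" "is_qform \<lparr>qdim = qdim q, qval = qval q\<rparr>"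
    using is_qform_cong[OF assms(1)] is_qform_cong[OF assms(2)] by auto
  from is_qform_add[OF is_qform_comp[OF vec_linear_first this(1)] is_qform_comp[OF vec_linear_last this(2)]]
  show ?thesis by (rule is_qform_cong) (simp_all add: q_orth_def)
qed

lemma nonsingular_orth:
  assumes "regular p" "regular q"
  shows "nonsingular (p \<bottom>\<^sub>q q)"
proof (rule nonsingularI)
  fix u assume uc: "u \<in> carrier_vec (qdim (p \<bottom>\<^sub>q q))"
    and 0: "\<And>v. v \<in> carrier_vec (qdim (p \<bottom>\<^sub>q q)) \<Longrightarrow> polar (p \<bottom>\<^sub>q q) u v = 0"
  obtain a b where u: "a \<in> carrier_vec (qdim p)" "b \<in> carrier_vec (qdim q)" "u = a @\<^sub>v b"
    using uc by (rule orth_carrierE)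
  \<comment> \<open>Testing against vectors supported in one summand separates the two components of
    \<open>u\<close>.\<close>
  have *: "polar p a x + polar q b y = 0" if "x \<in> carrier_vec (qdim p)" "y \<in> carrier_vec (qdim q)" for x y
    using 0[of "x @\<^sub>v y"] that u by (simp add: polar_orth)
  have "polar p a x = 0" if "x \<in> carrier_vec (qdim p)" for x
    using *[OF that zero_carrier_vec] linear_form_zero[OF polar_linear_right[OF regularD(1)[OF assms(2)] u(2)]]
    by simp
  then have a: "a = 0\<^sub>v (qdim p)"
    using regularD(2)[OF assms(1)] u unfolding nonsingular_def by blast
  have "polar q b y = 0" if "y \<in> carrier_vec (qdim q)" for y
    using *[OF zero_carrier_vec that] linear_form_zero[OF polar_linear_right[OF regularD(1)[OF assms(1)] u(1)]]
    by simp
  then have "b = 0\<^sub>v (qdim q)"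
    using regularD(2)[OF assms(2)] u unfolding nonsingular_def by blast
  with a u show "u = 0\<^sub>v (qdim (p \<bottom>\<^sub>q q))" by auto
qed

lemma regular_orth: "\<lbrakk>regular p; regular q\<rbrakk> \<Longrightarrow> regular (p \<bottom>\<^sub>q q)"
  using is_qform_orth nonsingular_orth by (auto simp: regular_def)

lemma regular_scale:
  assumes "regular q" "c \<noteq> 0"
  shows "regular (q_scale c q)"
proof -
  have "is_qform \<lparr>qdim = qdim q, qval = qval q\<rparr>"
    using is_qform_cong[OF regularD(1)[OF assms(1)]] by auto
  then have "is_qform (q_scale c q)"
    using is_qform_scale by (simp add: q_scale_def)
  moreover have "nonsingular (q_scale c q)"
    using assms by (auto simp: regular_def nonsingular_def polar_scale)
  ultimately show ?thesis by (simp add: regular_def)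
qed

lemma vec_linear_pair:
  assumes "vec_linear d d' f" "vec_linear e e' g"
  shows "vec_linear (d + e) (d' + e') (\<lambda>w. f (vec_first w d) @\<^sub>v g (vec_last w e))"
  by (intro vec_linear_append vec_linear_comp[OF vec_linear_first assms(1)]
      vec_linear_comp[OF vec_linear_last assms(2)])

text \<open>The form of \<open>q_isometricI\<close> adapted to sums: values are compared on split
  vectors \<open>u @\<^sub>v v\<close> only, where both sides have explicit formulas.\<close>

lemma orth_isometricI:
  fixes p q r :: "'a::field qform"
  assumes "regular p" "regular q" "qdim r = qdim p + qdim q"
    "vec_linear (qdim p + qdim q) (qdim r) f"
    "\<And>u v. u \<in> carrier_vec (qdim p) \<Longrightarrow> v \<in> carrier_vec (qdim q) \<Longrightarrow>
       qval p u + qval q v = qval r (f (u @\<^sub>v v))"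
  shows "p \<bottom>\<^sub>q q \<cong>\<^sub>q r"
proof (rule q_isometricI)
  fix w :: "'a vec" assume "w \<in> carrier_vec (qdim (p \<bottom>\<^sub>q q))"
  then obtain u v where "u \<in> carrier_vec (qdim p)" "v \<in> carrier_vec (qdim q)" "w = u @\<^sub>v v"
    by (rule orth_carrierE)
  then show "qval (p \<bottom>\<^sub>q q) w = qval r (f w)" using assms(5) by (simp add: qval_orth)
qed (use assms in \<open>simp_all add: regular_orth\<close>)

lemma orth_cong:
  assumes "regular p" "regular q" "p \<cong>\<^sub>q p'" "q \<cong>\<^sub>q q'"
  shows "p \<bottom>\<^sub>q q \<cong>\<^sub>q p' \<bottom>\<^sub>q q'"
proof -
  obtain f where f: "qdim p = qdim p'" "vec_linear (qdim p) (qdim p') f"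
    "\<And>v. v \<in> carrier_vec (qdim p) \<Longrightarrow> qval p v = qval p' (f v)"
    using q_isometricE[OF assms(3)] by metis
  obtain g where g: "qdim q = qdim q'" "vec_linear (qdim q) (qdim q') g"
    "\<And>v. v \<in> carrier_vec (qdim q) \<Longrightarrow> qval q v = qval q' (g v)"
    using q_isometricE[OF assms(4)] by metis
  show ?thesis
  proof (rule orth_isometricI[OF assms(1,2)])
    show "vec_linear (qdim p + qdim q) (qdim (p' \<bottom>\<^sub>q q')) (\<lambda>w. f (vec_first w (qdim p)) @\<^sub>v g (vec_last w (qdim q)))"
      using vec_linear_pair[OF f(2) g(2)] by simp
  qed (use f g vec_linear_carrier[OF f(2)] vec_linear_carrier[OF g(2)] in \<open>simp_all add: qval_orth\<close>)
qed

lemma scale_cong: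
  assumes "regular p" "c \<noteq> 0" "p \<cong>\<^sub>q p'"
  shows "q_scale c p \<cong>\<^sub>q q_scale c p'"
proof -
  obtain f where "qdim p = qdim p'" "vec_linear (qdim p) (qdim p') f"
    "\<And>v. v \<in> carrier_vec (qdim p) \<Longrightarrow> qval p v = qval p' (f v)"
    using q_isometricE[OF assms(3)] by metis
  then show ?thesis using assms by (intro q_isometricI[where f = f] regular_scale) auto
qed

lemma orth_commute:
  assumes "regular p" "regular q"
  shows "p \<bottom>\<^sub>q q \<cong>\<^sub>q q \<bottom>\<^sub>q p"
proof (rule orth_isometricI[OF assms])
  show "vec_linear (qdim p + qdim q) (qdim (q \<bottom>\<^sub>q p)) (\<lambda>w. vec_last w (qdim q) @\<^sub>v vec_first w (qdim p))"
    by (simp add: vec_linear_append vec_linear_first vec_linear_last)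
qed (simp_all add: qval_orth)

lemma append_vec_assoc: "(u @\<^sub>v v) @\<^sub>v w = u @\<^sub>v (v @\<^sub>v w)"
  by (rule eq_vecI) (auto simp: not_less)

lemma orth_assoc:
  assumes "regular p" "regular q" "regular r"
  shows "(p \<bottom>\<^sub>q q) \<bottom>\<^sub>q r \<cong>\<^sub>q p \<bottom>\<^sub>q (q \<bottom>\<^sub>q r)"
proof (rule orth_isometricI)
  \<comment> \<open>Both bracketings list the same coordinates in the same order, so the identity
    map is the isometry.\<close>
  show "vec_linear (qdim (p \<bottom>\<^sub>q q) + qdim r) (qdim (p \<bottom>\<^sub>q (q \<bottom>\<^sub>q r))) (\<lambda>v. v)"
    using vec_linear_id[of "qdim p + qdim q + qdim r"] by (simp add: add.assoc)
  fix u v :: "'a vec" assume u: "u \<in> carrier_vec (qdim (p \<bottom>\<^sub>q q))" and v: "v \<in> carrier_vec (qdim r)"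
  obtain a b where "a \<in> carrier_vec (qdim p)" "b \<in> carrier_vec (qdim q)" "u = a @\<^sub>v b"
    using u by (rule orth_carrierE)
  then show "qval (p \<bottom>\<^sub>q q) u + qval r v = qval (p \<bottom>\<^sub>q (q \<bottom>\<^sub>q r)) (u @\<^sub>v v)"
    using v by (simp add: append_vec_assoc qval_orth)
qed (use assms in \<open>simp_all add: regular_orth\<close>)

lemma regular_zero: "regular q_zero"
  unfolding regular_def
proof
  show "is_qform q_zero"
    using is_qform_mult[OF linear_form_0 linear_form_0, of 0] by (simp add: q_zero_def)
qed (auto simp: nonsingular_def)

lemma orth_zero:
  assumes "regular p"
  shows "p \<bottom>\<^sub>q q_zero \<cong>\<^sub>q p"
proof (rule orth_isometricI[OF assms regular_zero])
  show "vec_linear (qdim p + qdim q_zero) (qdim p) (\<lambda>w. vec_first w (qdim p))"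
    by (rule vec_linear_first)
qed simp_all

subsection \<open>Hyperbolic forms\<close>

lemma hyperbolic_0 [simp]: "hyperbolic 0 = q_zero"
  and hyperbolic_Suc: "hyperbolic (Suc k) = hyperbolic_plane \<bottom>\<^sub>q hyperbolic k"
  by (simp_all add: hyperbolic_def)

lemma qdim_hyperbolic [simp]: "qdim (hyperbolic k) = 2 * k"
  by (induction k) (simp_all add: hyperbolic_Suc)

lemma qval_hyperbolic_plane [simp]: "qval hyperbolic_plane v = v $ 0 * v $ 1"
  by (simp add: binary_qform_def)

lemma qval_hyperbolic:
  "v \<in> carrier_vec (2 * k) \<Longrightarrow> qval (hyperbolic k) v = (\<Sum>i<k. v $ (2 * i) * v $ (2 * i + 1))"
proof (induction k arbitrary: v)
  case (Suc k)
  then have "v \<in> carrier_vec (2 + 2 * k)" by simp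
  then obtain a b where ab: "a \<in> carrier_vec 2" "b \<in> carrier_vec (2 * k)" "v = a @\<^sub>v b"
    by (rule carrier_vec_appendE)
  have "(\<Sum>i<Suc k. v $ (2 * i) * v $ (2 * i + 1)) = a $ 0 * a $ 1 + (\<Sum>i<k. b $ (2 * i) * b $ (2 * i + 1))"
    unfolding sum.lessThan_Suc_shift using ab by simp
  then show ?case using ab Suc.IH[of b] by (simp add: hyperbolic_Suc qval_orth)
qed simp

lemma regular_hyperbolic_plane: "regular (hyperbolic_plane :: 'a::field qform)"
  unfolding regular_def
proof
  have "is_qform \<lparr>qdim = 2, qval = \<lambda>v::'a vec. v $ 0 * v $ 1\<rparr>"
    by (intro is_qform_mult linear_form_index) auto
  then show "is_qform (hyperbolic_plane :: 'a qform)" by (rule is_qform_cong) auto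
  show "nonsingular (hyperbolic_plane :: 'a qform)"
  proof (rule nonsingularI)
    fix u :: "'a vec" assume u: "u \<in> carrier_vec (qdim (hyperbolic_plane :: 'a qform))"
      and 0: "\<And>v. v \<in> carrier_vec (qdim (hyperbolic_plane :: 'a qform)) \<Longrightarrow> polar hyperbolic_plane u v = 0"
    have "u $ 1 = 0" "u $ 0 = 0"
      using 0[of "unit_vec 2 0"] 0[of "unit_vec 2 1"] by (simp_all add: polar_def algebra_simps)
    then show "u = 0\<^sub>v (qdim (hyperbolic_plane :: 'a qform))"
      using u by (intro eq_vecI) (auto simp: less_2_cases_iff)
  qed
qed

lemma regular_hyperbolic: "regular (hyperbolic k)"
  by (induction k) (simp_all add: hyperbolic_Suc regular_zero regular_orth regular_hyperbolic_plane)

text \<open>The map that lists the values \<open>L 0 v\<close>, \<open>M 0 v\<close>,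
  \<open>L 1 v\<close>, \<open>M 1 v\<close> and so on turns \<open>q\<close> into the standard
  hyperbolic form. The independence of these linear forms comes for free from nonsingularity,
  through \<open>q_isometricI\<close>.\<close>

lemma isometric_hyperbolicI:
  assumes "regular q" "qdim q = 2 * k"
    and L: "\<And>i. i < k \<Longrightarrow> linear_form (qdim q) (L i)" and M: "\<And>i. i < k \<Longrightarrow> linear_form (qdim q) (M i)"
    and eq: "\<And>v. v \<in> carrier_vec (qdim q) \<Longrightarrow> qval q v = (\<Sum>i<k. L i v * M i v)"
  shows "q \<cong>\<^sub>q hyperbolic k"
proof (rule q_isometricI[where f = "\<lambda>v. vec (2 * k) (\<lambda>j. if even j then L (j div 2) v else M (j div 2) v)"])
  show "vec_linear (qdim q) (qdim (hyperbolic k))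
      (\<lambda>v. vec (2 * k) (\<lambda>j. if even j then L (j div 2) v else M (j div 2) v))"
    unfolding qdim_hyperbolic
    by (rule vec_linear_vec, rule linear_form_if) (auto intro: L M)
qed (use assms in \<open>simp_all add: qval_hyperbolic\<close>)

lemma hyperbolic_add: "hyperbolic (i + j) \<cong>\<^sub>q hyperbolic i \<bottom>\<^sub>q hyperbolic j"
proof (rule q_isometric_sym, rule isometric_hyperbolicI)
  let ?L = "\<lambda>k v. v $ (2 * k)" and ?M = "\<lambda>k v. v $ (2 * k + 1)"
  show "linear_form (qdim (hyperbolic i \<bottom>\<^sub>q hyperbolic j)) (?L k)" "linear_form (qdim (hyperbolic i \<bottom>\<^sub>q hyperbolic j)) (?M k)"
    if "k < i + j" for k using that by (auto intro!: linear_form_index)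
  fix v :: "'a vec" assume "v \<in> carrier_vec (qdim (hyperbolic i \<bottom>\<^sub>q hyperbolic j :: 'a qform))"
  then obtain a b where ab: "a \<in> carrier_vec (2 * i)" "b \<in> carrier_vec (2 * j)" "v = a @\<^sub>v b"
    unfolding qdim_orth qdim_hyperbolic by (rule carrier_vec_appendE)
  have "(\<Sum>k<i + j. ?L k v * ?M k v) = (\<Sum>k<i. ?L k v * ?M k v) + (\<Sum>k<j. ?L (i + k) v * ?M (i + k) v)"
    by (induction j) (simp_all add: add.assoc)
  also have "\<dots> = (\<Sum>k<i. ?L k a * ?M k a) + (\<Sum>k<j. ?L k b * ?M k b)"
    using ab by (intro arg_cong2[of _ _ _ _ "(+)"] sum.cong) (auto simp: algebra_simps)
  finally show "qval (hyperbolic i \<bottom>\<^sub>q hyperbolic j) v = (\<Sum>k<i + j. ?L k v * ?M k v)"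
    using ab by (simp add: qval_orth qval_hyperbolic)
qed (simp_all add: regular_orth regular_hyperbolic)

text \<open>Adding one coordinate at a time contributes its square term and its polar value with the
  earlier coordinates. Each contribution has the factor \<open>v $ i\<close>, so \<open>q\<close>
  becomes a sum of products of two linear forms, the shape that \<open>isometric_hyperbolicI\<close>
  asks for.\<close>

lemma qval_trunc:
  assumes q: "is_qform q" and v: "v \<in> carrier_vec (qdim q)" and "k \<le> qdim q"
  shows "qval q (vec_trunc k v) = (\<Sum>i<k. v $ i *
    (v $ i * qval q (unit_vec (qdim q) i) + polar q (vec_trunc i v) (unit_vec (qdim q) i)))"
  using \<open>k \<le> qdim q\<close>
proof (induction k)
  case 0
  then show ?case using qval_zero[OF q] vec_trunc_0[OF v] by simp
next
  case (Suc k)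
  then show ?case
    using linear_form_smult[OF polar_linear_right[OF q vec_trunc_carrier[OF v, of k]], of "unit_vec (qdim q) k" "v $ k"]
      qval_smult[OF q, of "unit_vec (qdim q) k" "v $ k"]
    by (simp add: vec_trunc_Suc[OF v] qval_add power2_eq_square distrib_left mult.assoc add.assoc)
qed

lemma qval_expand:
  assumes "is_qform q" "v \<in> carrier_vec (qdim q)"
  shows "qval q v = (\<Sum>i<qdim q. v $ i *
    (v $ i * qval q (unit_vec (qdim q) i) + polar q (vec_trunc i v) (unit_vec (qdim q) i)))"
  using qval_trunc[OF assms order_refl] by (simp add: vec_trunc_full[OF assms(2)])

lemma vec_linear_trunc: "vec_linear d d (vec_trunc k)"
  by (rule vec_linearI) (auto simp: vec_trunc_def)

section \<open>Characteristic two\<close>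

locale char_two =
  fixes ty :: "'a::field itself"
  assumes char_two: "CHAR('a) = 2"
begin

lemma double [simp]: "x + x = (0::'a)"
  using uminus_CHAR_2[OF char_two, of x] by (metis add.right_inverse)

lemma double_left [simp]: "x + (x + y) = (y::'a)"
  by (simp flip: add.assoc)

lemma minus_eq [simp]: "x - y = (x + y::'a)"
  by (rule minus_CHAR_2[OF char_two])

lemmas char_two_simps = algebra_simps power2_eq_square

lemma polar_self:
  fixes q :: "'a qform"
  assumes "is_qform q" "v \<in> carrier_vec (qdim q)"
  shows "polar q v v = 0"
proof -
  have "v + v = 0\<^sub>v (qdim q)" using assms(2) by (intro eq_vecI) auto
  then show ?thesis using qval_zero[OF assms(1)] by (simp add: polar_def)
qed

text \<open>With \<open>s = u + v\<close> the value is \<open>qval p s + polar p u v\<close>, and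
  the second term equals \<open>polar p s v\<close> because \<open>polar p v v = 0\<close>.
  Expanding both terms along the coordinates of \<open>s\<close> gives a sum of products
  \<open>s $ i\<close> times a linear form, one for each coordinate.\<close>

lemma orth_self_hyperbolic:
  fixes p :: "'a qform"
  assumes p: "regular p"
  shows "p \<bottom>\<^sub>q p \<cong>\<^sub>q hyperbolic (qdim p)"
proof (rule isometric_hyperbolicI)
  note q = regularD(1)[OF p]
  let ?d = "qdim p" and ?e = "unit_vec (qdim p)"
  let ?s = "\<lambda>w. vec_first w ?d + vec_last w ?d"
  let ?M = "\<lambda>i w. ?s w $ i * qval p (?e i) + polar p (vec_trunc i (?s w)) (?e i) + polar p (?e i) (vec_last w ?d)"
  have s: "vec_linear (?d + ?d) ?d ?s" by (intro vec_linear_intros)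
  fix i assume i: "i < ?d"
  show L: "linear_form (qdim (p \<bottom>\<^sub>q p)) (\<lambda>w. ?s w $ i)"
    using vec_linear_index[OF s i] by simp
  show "linear_form (qdim (p \<bottom>\<^sub>q p)) (?M i)"
    using linear_form_comp[OF vec_linear_comp[OF s vec_linear_trunc] polar_linear_left[OF q], of "?e i" i]
      linear_form_comp[OF vec_linear_last polar_linear_right[OF q], of "?e i" ?d]
    by (intro linear_form_plus linear_form_mult_right L) simp_all
next
  note q = regularD(1)[OF p]
  let ?d = "qdim p" and ?e = "unit_vec (qdim p)"
  fix w :: "'a vec" assume "w \<in> carrier_vec (qdim (p \<bottom>\<^sub>q p))"
  then obtain u v where uv: "u \<in> carrier_vec ?d" "v \<in> carrier_vec ?d" and w: "w = u @\<^sub>v v"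
    by (rule orth_carrierE)
  define s where "s = u + v"
  have sc: "s \<in> carrier_vec ?d" using uv by (simp add: s_def)
  have "qval p u + qval p v = qval p s + polar p u v"
    by (simp add: s_def qval_add add.assoc)
  also have "polar p u v = polar p s v"
    using linear_form_add[OF polar_linear_left[OF q uv(2)] uv] polar_self[OF q uv(2)] by (simp add: s_def)
  also have "\<dots> = (\<Sum>i<?d. s $ i * polar p (?e i) v)"
    using linear_form_expand[OF polar_linear_left[OF q uv(2)] sc] .
  also note qval_expand[OF q sc]
  finally have "qval p u + qval p v = (\<Sum>i<?d. s $ i *
      (s $ i * qval p (?e i) + polar p (vec_trunc i s) (?e i) + polar p (?e i) v))"
    by (simp add: sum.distrib distrib_left)
  then show "qval (p \<bottom>\<^sub>q p) w = (\<Sum>i<?d. (vec_first w ?d + vec_last w ?d) $ i *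
      ((vec_first w ?d + vec_last w ?d) $ i * qval p (?e i) +
       polar p (vec_trunc i (vec_first w ?d + vec_last w ?d)) (?e i) + polar p (?e i) (vec_last w ?d)))"
    using uv by (simp add: w qval_orth s_def)
qed (use p in \<open>simp_all add: regular_orth\<close>)

end

(* keeps the splitting of carrier_vec (2 + d) visible to the lemmas on @\<^sub>v *)
declare add_2_eq_Suc [simp del] add_2_eq_Suc' [simp del]

section \<open>Rearranging orthogonal sums and Witt cancellation\<close>

lemma orth_left_commute:
  assumes "regular p" "regular q" "regular r"
  shows "p \<bottom>\<^sub>q (q \<bottom>\<^sub>q r) \<cong>\<^sub>q q \<bottom>\<^sub>q (p \<bottom>\<^sub>q r)"
proof -
  note assms [simp] regular_orth [simp]
  have "p \<bottom>\<^sub>q (q \<bottom>\<^sub>q r) \<cong>\<^sub>q (p \<bottom>\<^sub>q q) \<bottom>\<^sub>q r"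
    by (rule q_isometric_sym) (simp add: orth_assoc)
  also have "\<dots> \<cong>\<^sub>q (q \<bottom>\<^sub>q p) \<bottom>\<^sub>q r"
    by (simp add: orth_cong orth_commute q_isometric_refl)
  also have "\<dots> \<cong>\<^sub>q q \<bottom>\<^sub>q (p \<bottom>\<^sub>q r)"
    by (simp add: orth_assoc)
  finally show ?thesis .
qed

lemma orth_interchange:
  assumes "regular p" "regular q" "regular r" "regular s"
  shows "(p \<bottom>\<^sub>q q) \<bottom>\<^sub>q (r \<bottom>\<^sub>q s) \<cong>\<^sub>q (p \<bottom>\<^sub>q r) \<bottom>\<^sub>q (q \<bottom>\<^sub>q s)"
proof -
  note assms [simp] regular_orth [simp]
  have "(p \<bottom>\<^sub>q q) \<bottom>\<^sub>q (r \<bottom>\<^sub>q s) \<cong>\<^sub>q p \<bottom>\<^sub>q (q \<bottom>\<^sub>q (r \<bottom>\<^sub>q s))"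
    by (simp add: orth_assoc)
  also have "\<dots> \<cong>\<^sub>q p \<bottom>\<^sub>q (r \<bottom>\<^sub>q (q \<bottom>\<^sub>q s))"
    by (simp add: orth_cong orth_left_commute q_isometric_refl)
  also have "\<dots> \<cong>\<^sub>q (p \<bottom>\<^sub>q r) \<bottom>\<^sub>q (q \<bottom>\<^sub>q s)"
    by (rule q_isometric_sym) (simp add: orth_assoc)
  finally show ?thesis .
qed

lemma qval_hyperbolic_plane_orth:
  "v \<in> carrier_vec (2 + qdim q) \<Longrightarrow>
   qval (hyperbolic_plane \<bottom>\<^sub>q q) v = v $ 0 * v $ 1 + qval q (vec_last v (qdim q))"
  by (simp add: q_orth_def vec_first_def)

lemma polar_hyperbolic_plane_orth:
  assumes "u \<in> carrier_vec (2 + qdim q)" "v \<in> carrier_vec (2 + qdim q)"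
  shows "polar (hyperbolic_plane \<bottom>\<^sub>q q) u v =
    u $ 0 * v $ 1 + u $ 1 * v $ 0 + polar q (vec_last u (qdim q)) (vec_last v (qdim q))"
proof -
  have "vec_last (u + v) (qdim q) = vec_last u (qdim q) + vec_last v (qdim q)"
    using vec_linear_add[OF vec_linear_last assms] .
  then show ?thesis using assms by (simp add: polar_def qval_hyperbolic_plane_orth distrib_left distrib_right)
qed

context char_two
begin

lemma qval_add_isotropic:
  fixes q :: "'a qform"
  assumes "is_qform q" "y \<in> carrier_vec (qdim q)" "z \<in> carrier_vec (qdim q)" "qval q z = 0" "polar q y z = 0"
  shows "qval q (y + c \<cdot>\<^sub>v z) = qval q y"
  using linear_form_smult[OF polar_linear_right[OF assms(1,2)] assms(3)]
  by (simp add: qval_add qval_smult assms)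

text \<open>The first unit vector \<open>e\<close> of the plane is isotropic, and \<open>p\<close>
  is its orthogonal complement modulo \<open>e\<close>. The isometry sends \<open>e\<close> to an
  isotropic vector \<open>z\<close>, so it suffices to map the vectors orthogonal to
  \<open>z\<close> linearly to the space of \<open>q\<close> while preserving values. Dropping the
  two plane coordinates does this as soon as one of them has been made zero.\<close>

lemma hyperbolic_plane_cancel:
  fixes p q :: "'a qform"
  assumes p: "regular p" and q: "regular q"
    and iso: "hyperbolic_plane \<bottom>\<^sub>q p \<cong>\<^sub>q hyperbolic_plane \<bottom>\<^sub>q q"
  shows "p \<cong>\<^sub>q q"
proof -
  let ?P = "hyperbolic_plane \<bottom>\<^sub>q p" and ?Q = "hyperbolic_plane \<bottom>\<^sub>q q"
  define d where "d = qdim q"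
  obtain f where d': "qdim ?P = qdim ?Q" and f: "vec_linear (qdim ?P) (qdim ?Q) f"
    and eq: "\<And>v. v \<in> carrier_vec (qdim ?P) \<Longrightarrow> qval ?P v = qval ?Q (f v)"
    using q_isometricE[OF iso] by metis
  have dp: "qdim p = d" and dq: "qdim q = d" using d' by (simp_all add: d_def)
  have f: "vec_linear (2 + d) (2 + d) f" using f by (simp add: dp dq)
  have eq: "qval ?P v = qval ?Q (f v)" if "v \<in> carrier_vec (2 + d)" for v
    using eq[of v] that by (simp add: dp)
  have polar_f: "polar ?P u v = polar ?Q (f u) (f v)"
    if "u \<in> carrier_vec (2 + d)" "v \<in> carrier_vec (2 + d)" for u v
    using polar_vec_linear[of ?P ?Q f u v] f eq that by (simp add: dp dq)
  have Q: "is_qform ?Q" using regular_orth[OF regular_hyperbolic_plane q] by (rule regularD)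
  \<comment> \<open>The inclusion of the space of \<open>p\<close> as the summand orthogonal to the
    plane; its image is orthogonal to \<open>e\<close>.\<close>
  define \<iota> where "\<iota> x = 0\<^sub>v 2 @\<^sub>v x" for x :: "'a vec"
  have \<iota>: "vec_linear d (2 + d) \<iota>"
    unfolding \<iota>_def by (intro vec_linear_append vec_linear_const0 vec_linear_id)
  have \<iota>c: "\<iota> x \<in> carrier_vec (2 + d)" if "x \<in> carrier_vec d" for x
    using vec_linear_carrier[OF \<iota> that] .
  define e where "e = (unit_vec (2 + d) 0 :: 'a vec)"
  define z where "z = f e"
  have ec: "e \<in> carrier_vec (2 + d)" by (simp add: e_def)
  have zc: "z \<in> carrier_vec (2 + d)" using vec_linear_carrier[OF f ec] by (simp add: z_def)
  have e_last: "vec_last e d = 0\<^sub>v d" by (rule eq_vecI) (auto simp: e_def vec_last_def)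
  have "qval ?P e = 0"
    using ec e_last qval_zero[OF regularD(1)[OF p]] qval_hyperbolic_plane_orth[of e p] dp by (simp add: e_def)
  then have Qz: "qval ?Q z = 0" using eq[OF ec] by (simp add: z_def)
  have perp: "polar ?Q (f (\<iota> x)) z = 0" if x: "x \<in> carrier_vec d" for x
  proof -
    have "polar ?P (\<iota> x) e = 0"
      using linear_form_zero[OF polar_linear_right[OF regularD(1)[OF p]], of x] x
      by (simp add: polar_hyperbolic_plane_orth dp \<iota>c[OF x] ec e_last)
        (simp add: \<iota>_def e_def)
    then show ?thesis using polar_f[OF \<iota>c[OF x] ec] by (simp add: z_def)
  qed
  \<comment> \<open>What remains is a linear map \<open>\<tau>\<close> which on the complement of
    \<open>z\<close> keeps the values and kills a plane coordinate. The plane then contributes the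
    product 0, and the value is that of \<open>q\<close> on the last \<open>d\<close>
    coordinates.\<close>
  have transfer: ?thesis
    if \<tau>: "vec_linear (2 + d) (2 + d) \<tau>"
      and Q\<tau>: "\<And>y. y \<in> carrier_vec (2 + d) \<Longrightarrow> polar ?Q y z = 0 \<Longrightarrow> qval ?Q (\<tau> y) = qval ?Q y"
      and split: "\<And>y. y \<in> carrier_vec (2 + d) \<Longrightarrow> polar ?Q y z = 0 \<Longrightarrow> \<tau> y $ 0 = 0 \<or> \<tau> y $ 1 = 0" for \<tau>
  proof (rule q_isometricI[OF p])
    show "vec_linear (qdim p) (qdim q) (\<lambda>x. vec_last (\<tau> (f (\<iota> x))) d)"
      unfolding dp dq by (intro vec_linear_comp[OF \<iota>] vec_linear_comp[OF f] vec_linear_comp[OF \<tau>] vec_linear_last)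
    fix x :: "'a vec" assume "x \<in> carrier_vec (qdim p)"
    then have x: "x \<in> carrier_vec d" by (simp add: dp)
    have fx: "f (\<iota> x) \<in> carrier_vec (2 + d)" using vec_linear_carrier[OF f \<iota>c[OF x]] .
    have "qval p x = qval ?P (\<iota> x)"
      using x by (simp add: \<iota>_def qval_orth dp)
    also have "\<dots> = qval ?Q (\<tau> (f (\<iota> x)))"
      using eq[OF \<iota>c[OF x]] Q\<tau>[OF fx perp[OF x]] by simp
    also have "\<dots> = qval q (vec_last (\<tau> (f (\<iota> x))) d)"
      using split[OF fx perp[OF x]] qval_hyperbolic_plane_orth[of "\<tau> (f (\<iota> x))" q]
        vec_linear_carrier[OF \<tau> fx] by (auto simp: dq)
    finally show "qval p x = qval q (vec_last (\<tau> (f (\<iota> x))) d)" .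
  qed (simp add: dp dq)
  consider "z $ 1 \<noteq> 0" | "z $ 0 \<noteq> 0" | "z $ 0 = 0" "z $ 1 = 0" by blast
  then show ?thesis
  proof cases
    \<comment> \<open>Multiples of \<open>z\<close> may be added freely to vectors orthogonal to it,
      and here \<open>z\<close> has a nonzero plane coordinate with which to clear the same
      coordinate of \<open>y\<close>.\<close>
    case 1
    show ?thesis
    proof (rule transfer[of "\<lambda>y. y + (y $ 1 / z $ 1) \<cdot>\<^sub>v z"])
      show "vec_linear (2 + d) (2 + d) (\<lambda>y. y + (y $ 1 / z $ 1) \<cdot>\<^sub>v z)"
        by (intro vec_linear_plus vec_linear_id vec_linear_form_scale linear_form_divide linear_form_index zc) simp
    qed (use 1 zc qval_add_isotropic[OF Q] Qz in \<open>simp_all add: dq\<close>)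
  next
    case 2
    show ?thesis
    proof (rule transfer[of "\<lambda>y. y + (y $ 0 / z $ 0) \<cdot>\<^sub>v z"])
      show "vec_linear (2 + d) (2 + d) (\<lambda>y. y + (y $ 0 / z $ 0) \<cdot>\<^sub>v z)"
        by (intro vec_linear_plus vec_linear_id vec_linear_form_scale linear_form_divide linear_form_index zc) simp
    qed (use 2 zc qval_add_isotropic[OF Q] Qz in \<open>simp_all add: dq\<close>)
  next
    case 3
    \<comment> \<open>Now \<open>z\<close> lies entirely in the space of \<open>q\<close>, so its
      multiples do not affect the plane coordinates, and a second isotropic vector \<open>g\<close>
      has to be found.\<close>
    define x where "x = vec_last z d"
    have xc: "x \<in> carrier_vec d" by (simp add: x_def)
    have "x \<noteq> 0\<^sub>v d"
    proof
      \<comment> \<open>Otherwise \<open>z\<close> would be zero, whereas \<open>e\<close> has polar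
        value 1 with the second unit vector of the plane.\<close>
      assume x0: "x = 0\<^sub>v d"
      let ?e1 = "unit_vec (2 + d) 1 :: 'a vec"
      have "polar ?Q z (f ?e1) = 0"
        using 3 x0 linear_form_zero[OF polar_linear_left[OF regularD(1)[OF q]]]
          vec_linear_carrier[OF f, of ?e1]
        by (simp add: polar_hyperbolic_plane_orth dq zc flip: x_def)
      moreover have "polar ?P e ?e1 = 1"
        using linear_form_zero[OF polar_linear_left[OF regularD(1)[OF p]]]
        by (simp add: polar_hyperbolic_plane_orth dp ec e_last) (simp add: e_def)
      ultimately show False using polar_f[OF ec, of ?e1] by (simp add: z_def)
    qed
    then obtain w' where w': "w' \<in> carrier_vec d" "polar q x w' \<noteq> 0"
      using nonsingularD[OF regularD(2)[OF q]] xc unfolding dq by blast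
    define w where "w = (1 / polar q x w') \<cdot>\<^sub>v w'"
    have wc: "w \<in> carrier_vec d" and xw: "polar q x w = 1"
      using w' linear_form_smult[OF polar_linear_right[OF regularD(1)[OF q]], of x w'] xc
      by (simp_all add: w_def dq)
    \<comment> \<open>The plane coordinates \<open>qval q w\<close> and 1 contribute
      \<open>qval q w\<close>, which cancels the value of \<open>w\<close>, so \<open>g\<close> is
      isotropic. They do not interact with \<open>z\<close>, so the polar value of \<open>z\<close>
      and \<open>g\<close> is \<open>polar q x w = 1\<close>.\<close>
    define g where "g = vec 2 (\<lambda>i. if i = 0 then qval q w else 1) @\<^sub>v w"
    have gc: "g \<in> carrier_vec (2 + d)"
      unfolding g_def using wc by (intro append_carrier_vec) auto
    have g: "g $ 0 = qval q w" "g $ 1 = 1" "vec_last g d = w"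
      using wc by (simp_all add: g_def)
    have Qg: "qval ?Q g = 0"
      using qval_hyperbolic_plane_orth[of g q] gc unfolding dq g by simp
    have zg: "polar ?Q z g = 1"
      using polar_hyperbolic_plane_orth[of z q g] gc zc xw unfolding dq g 3 x_def by simp
    \<comment> \<open>Because \<open>polar ?Q z g = 1\<close>, adding this multiple of
      \<open>z\<close> makes \<open>y\<close> orthogonal to \<open>g\<close>. Multiples of
      \<open>g\<close> can then be added without changing the value, and they clear the coordinate
      with index 1, where \<open>g\<close> has the entry 1.\<close>
    let ?\<sigma> = "\<lambda>y. y + polar ?Q y g \<cdot>\<^sub>v z"
    have \<sigma>: "vec_linear (2 + d) (2 + d) ?\<sigma>"
      using polar_linear_left[OF Q, of g] gc
      by (intro vec_linear_plus vec_linear_id vec_linear_form_scale zc) (simp add: dq)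
    have \<sigma>g: "polar ?Q (?\<sigma> y) g = 0" if y: "y \<in> carrier_vec (2 + d)" for y
      using linear_form_add[OF polar_linear_left[OF Q, of g], of y "polar ?Q y g \<cdot>\<^sub>v z"]
        linear_form_smult[OF polar_linear_left[OF Q, of g], of z "polar ?Q y g"] y gc zc zg
      by (simp add: dq)
    show ?thesis
    proof (rule transfer[of "\<lambda>y. ?\<sigma> y + (?\<sigma> y $ 1) \<cdot>\<^sub>v g"])
      show "vec_linear (2 + d) (2 + d) (\<lambda>y. ?\<sigma> y + (?\<sigma> y $ 1) \<cdot>\<^sub>v g)"
        using vec_linear_index[OF \<sigma>, of 1]
        by (intro vec_linear_plus[OF \<sigma>] vec_linear_form_scale gc) simp
      fix y :: "'a vec" assume y: "y \<in> carrier_vec (2 + d)" "polar ?Q y z = 0"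
      have yc: "?\<sigma> y \<in> carrier_vec (2 + d)" using vec_linear_carrier[OF \<sigma> y(1)] .
      have "qval ?Q (?\<sigma> y + (?\<sigma> y $ 1) \<cdot>\<^sub>v g) = qval ?Q (?\<sigma> y)"
        using qval_add_isotropic[OF Q, of "?\<sigma> y" g] yc gc Qg \<sigma>g[OF y(1)] by (simp add: dq)
      also have "\<dots> = qval ?Q y"
        using qval_add_isotropic[OF Q, of y z] y zc Qz by (simp add: dq)
      finally show "qval ?Q (?\<sigma> y + (?\<sigma> y $ 1) \<cdot>\<^sub>v g) = qval ?Q y" .
      show "(?\<sigma> y + (?\<sigma> y $ 1) \<cdot>\<^sub>v g) $ 0 = 0 \<or> (?\<sigma> y + (?\<sigma> y $ 1) \<cdot>\<^sub>v g) $ 1 = 0"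
        using gc g by simp
    qed
  qed
qed

lemma hyperbolic_cancel:
  fixes p q :: "'a qform"
  assumes "regular p" "regular q" "p \<bottom>\<^sub>q hyperbolic k \<cong>\<^sub>q q \<bottom>\<^sub>q hyperbolic k"
  shows "p \<cong>\<^sub>q q"
  using assms(3)
proof (induction k)
  case 0
  have "p \<cong>\<^sub>q p \<bottom>\<^sub>q q_zero" using orth_zero[OF assms(1)] by (rule q_isometric_sym)
  also have "\<dots> \<cong>\<^sub>q q \<bottom>\<^sub>q q_zero" using 0 by simp
  also have "\<dots> \<cong>\<^sub>q q" using orth_zero[OF assms(2)] .
  finally show ?case .
next
  case (Suc k)
  have *: "hyperbolic_plane \<bottom>\<^sub>q (r \<bottom>\<^sub>q hyperbolic k) \<cong>\<^sub>q r \<bottom>\<^sub>q hyperbolic (Suc k)"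
    if "regular r" for r :: "'a qform"
    unfolding hyperbolic_Suc
    by (rule orth_left_commute[OF regular_hyperbolic_plane that regular_hyperbolic])
  have "hyperbolic_plane \<bottom>\<^sub>q (p \<bottom>\<^sub>q hyperbolic k) \<cong>\<^sub>q p \<bottom>\<^sub>q hyperbolic (Suc k)"
    by (rule *[OF assms(1)])
  also note Suc.prems
  also have "q \<bottom>\<^sub>q hyperbolic (Suc k) \<cong>\<^sub>q hyperbolic_plane \<bottom>\<^sub>q (q \<bottom>\<^sub>q hyperbolic k)"
    by (rule q_isometric_sym[OF *[OF assms(2)]])
  finally have "p \<bottom>\<^sub>q hyperbolic k \<cong>\<^sub>q q \<bottom>\<^sub>q hyperbolic k"
    by (rule hyperbolic_plane_cancel[OF regular_orth[OF assms(1) regular_hyperbolic]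
          regular_orth[OF assms(2) regular_hyperbolic]])
  then show ?case by (rule Suc.IH)
qed

end

subsection \<open>The Witt group\<close>

lemma even_nonsingular_iff: "q \<in> even_nonsingular \<longleftrightarrow> regular q \<and> even (qdim q)"
  by (auto simp: even_nonsingular_def regular_def)

lemma orth_hyperbolic_add:
  assumes "regular p"
  shows "p \<bottom>\<^sub>q hyperbolic (i + j) \<cong>\<^sub>q (p \<bottom>\<^sub>q hyperbolic i) \<bottom>\<^sub>q hyperbolic j"
proof -
  note assms [simp] regular_orth [simp] regular_hyperbolic [simp]
  have "p \<bottom>\<^sub>q hyperbolic (i + j) \<cong>\<^sub>q p \<bottom>\<^sub>q (hyperbolic i \<bottom>\<^sub>q hyperbolic j)"
    by (simp add: orth_cong q_isometric_refl hyperbolic_add)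
  also have "\<dots> \<cong>\<^sub>q (p \<bottom>\<^sub>q hyperbolic i) \<bottom>\<^sub>q hyperbolic j"
    by (rule q_isometric_sym) (simp add: orth_assoc)
  finally show ?thesis .
qed

lemma witt_equivI:
  "\<lbrakk>p \<in> even_nonsingular; q \<in> even_nonsingular; p \<bottom>\<^sub>q hyperbolic i \<cong>\<^sub>q q \<bottom>\<^sub>q hyperbolic j\<rbrakk> \<Longrightarrow> (p, q) \<in> witt_equiv"
  by (auto simp: witt_equiv_def)

lemma witt_equivE:
  assumes "(p, q) \<in> witt_equiv"
  obtains i j where "p \<in> even_nonsingular" "q \<in> even_nonsingular" "p \<bottom>\<^sub>q hyperbolic i \<cong>\<^sub>q q \<bottom>\<^sub>q hyperbolic j"
  using assms by (auto simp: witt_equiv_def)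

lemma isometric_witt_equiv:
  assumes "p \<in> even_nonsingular" "q \<in> even_nonsingular" "p \<cong>\<^sub>q q"
  shows "(p, q) \<in> witt_equiv"
proof (rule witt_equivI[where i = 0 and j = 0])
  show "p \<bottom>\<^sub>q hyperbolic 0 \<cong>\<^sub>q q \<bottom>\<^sub>q hyperbolic 0"
    using assms by (intro orth_cong q_isometric_refl regular_hyperbolic) (simp_all add: even_nonsingular_iff)
qed (use assms in simp_all)

lemma equiv_witt_equiv: "equiv even_nonsingular witt_equiv"
proof (rule equivI)
  show "refl_on even_nonsingular witt_equiv"
    by (auto simp: refl_on_def intro: isometric_witt_equiv q_isometric_refl)
  show "witt_equiv \<subseteq> even_nonsingular \<times> even_nonsingular"
    by (auto simp: witt_equiv_def)
  show "sym witt_equiv"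
    by (auto simp: sym_def elim!: witt_equivE intro: witt_equivI q_isometric_sym)
  show "trans witt_equiv"
  proof (rule transI)
    fix p q r assume pq: "(p, q) \<in> witt_equiv" and qr: "(q, r) \<in> witt_equiv"
    from pq obtain i j where p: "p \<in> even_nonsingular" and q: "q \<in> even_nonsingular"
      and ij: "p \<bottom>\<^sub>q hyperbolic i \<cong>\<^sub>q q \<bottom>\<^sub>q hyperbolic j" by (rule witt_equivE)
    from qr obtain k l where r: "r \<in> even_nonsingular"
      and kl: "q \<bottom>\<^sub>q hyperbolic k \<cong>\<^sub>q r \<bottom>\<^sub>q hyperbolic l" by (rule witt_equivE)
    have [simp]: "regular p" "regular q" "regular r" using p q r by (auto simp: even_nonsingular_iff)
    note [simp] = regular_orth regular_hyperbolic
    \<comment> \<open>The two given isometries meet after adding \<open>hyperbolic k\<close> to the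
      first and \<open>hyperbolic j\<close> to the second.\<close>
    have "p \<bottom>\<^sub>q hyperbolic (i + k) \<cong>\<^sub>q (p \<bottom>\<^sub>q hyperbolic i) \<bottom>\<^sub>q hyperbolic k"
      by (simp add: orth_hyperbolic_add)
    also have "\<dots> \<cong>\<^sub>q (q \<bottom>\<^sub>q hyperbolic j) \<bottom>\<^sub>q hyperbolic k"
      by (simp add: orth_cong ij q_isometric_refl)
    also have "\<dots> \<cong>\<^sub>q q \<bottom>\<^sub>q hyperbolic (j + k)"
      by (rule q_isometric_sym) (simp add: orth_hyperbolic_add)
    also have "\<dots> = q \<bottom>\<^sub>q hyperbolic (k + j)" by (simp add: add.commute)
    also have "\<dots> \<cong>\<^sub>q (q \<bottom>\<^sub>q hyperbolic k) \<bottom>\<^sub>q hyperbolic j"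
      by (simp add: orth_hyperbolic_add)
    also have "\<dots> \<cong>\<^sub>q (r \<bottom>\<^sub>q hyperbolic l) \<bottom>\<^sub>q hyperbolic j"
      by (simp add: orth_cong kl q_isometric_refl)
    also have "\<dots> \<cong>\<^sub>q r \<bottom>\<^sub>q hyperbolic (l + j)"
      by (rule q_isometric_sym) (simp add: orth_hyperbolic_add)
    finally show "(p, r) \<in> witt_equiv" using p r by (intro witt_equivI)
  qed
qed

lemma witt_class_eq_iff:
  "\<lbrakk>p \<in> even_nonsingular; q \<in> even_nonsingular\<rbrakk> \<Longrightarrow> witt_class p = witt_class q \<longleftrightarrow> (p, q) \<in> witt_equiv"
  unfolding witt_class_def by (rule eq_equiv_class_iff[OF equiv_witt_equiv])

lemma even_nonsingular_orth:
  "\<lbrakk>p \<in> even_nonsingular; q \<in> even_nonsingular\<rbrakk> \<Longrightarrow> p \<bottom>\<^sub>q q \<in> even_nonsingular"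
  by (auto simp: even_nonsingular_iff regular_orth)

lemma even_nonsingular_isometric: "\<lbrakk>p \<cong>\<^sub>q q; q \<in> even_nonsingular\<rbrakk> \<Longrightarrow> p \<in> even_nonsingular"
  using regular_isometric[of p q] by (auto simp: even_nonsingular_iff q_isometric_def)

lemma even_nonsingular_hyperbolic: "hyperbolic k \<in> even_nonsingular"
  by (simp add: even_nonsingular_iff regular_hyperbolic)

lemma even_nonsingular_zero: "q_zero \<in> even_nonsingular"
  using even_nonsingular_hyperbolic[of 0] by simp

lemma witt_class_isometric:
  assumes "p \<cong>\<^sub>q q" "q \<in> even_nonsingular"
  shows "witt_class p = witt_class q"
  using isometric_witt_equiv[OF even_nonsingular_isometric[OF assms] assms(2,1)]
    witt_class_eq_iff[OF even_nonsingular_isometric[OF assms] assms(2)] by simp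

lemma witt_equiv_orth:
  assumes "(p, p') \<in> witt_equiv" "(q, q') \<in> witt_equiv"
  shows "(p \<bottom>\<^sub>q q, p' \<bottom>\<^sub>q q') \<in> witt_equiv"
proof -
  from assms(1) obtain i j where p: "p \<in> even_nonsingular" "p' \<in> even_nonsingular"
    and ij: "p \<bottom>\<^sub>q hyperbolic i \<cong>\<^sub>q p' \<bottom>\<^sub>q hyperbolic j" by (rule witt_equivE)
  from assms(2) obtain k l where q: "q \<in> even_nonsingular" "q' \<in> even_nonsingular"
    and kl: "q \<bottom>\<^sub>q hyperbolic k \<cong>\<^sub>q q' \<bottom>\<^sub>q hyperbolic l" by (rule witt_equivE)
  have [simp]: "regular p" "regular p'" "regular q" "regular q'"
    using p q by (auto simp: even_nonsingular_iff)
  note [simp] = regular_orth regular_hyperbolic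
  have *: "(r \<bottom>\<^sub>q s) \<bottom>\<^sub>q hyperbolic (a + b) \<cong>\<^sub>q (r \<bottom>\<^sub>q hyperbolic a) \<bottom>\<^sub>q (s \<bottom>\<^sub>q hyperbolic b)"
    if "regular r" "regular s" for r s :: "'a qform" and a b
  proof -
    have "(r \<bottom>\<^sub>q s) \<bottom>\<^sub>q hyperbolic (a + b) \<cong>\<^sub>q (r \<bottom>\<^sub>q s) \<bottom>\<^sub>q (hyperbolic a \<bottom>\<^sub>q hyperbolic b)"
      using that by (simp add: orth_cong q_isometric_refl hyperbolic_add)
    also have "\<dots> \<cong>\<^sub>q (r \<bottom>\<^sub>q hyperbolic a) \<bottom>\<^sub>q (s \<bottom>\<^sub>q hyperbolic b)"
      using that by (simp add: orth_interchange)
    finally show ?thesis .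
  qed
  have "(p \<bottom>\<^sub>q q) \<bottom>\<^sub>q hyperbolic (i + k) \<cong>\<^sub>q (p \<bottom>\<^sub>q hyperbolic i) \<bottom>\<^sub>q (q \<bottom>\<^sub>q hyperbolic k)"
    by (simp add: *)
  also have "\<dots> \<cong>\<^sub>q (p' \<bottom>\<^sub>q hyperbolic j) \<bottom>\<^sub>q (q' \<bottom>\<^sub>q hyperbolic l)"
    by (simp add: orth_cong ij kl)
  also have "\<dots> \<cong>\<^sub>q (p' \<bottom>\<^sub>q q') \<bottom>\<^sub>q hyperbolic (j + l)"
    by (rule q_isometric_sym) (simp add: *)
  finally show ?thesis using p q by (intro witt_equivI even_nonsingular_orth)
qed

lemma Iq1_carrierI: "q \<in> even_nonsingular \<Longrightarrow> witt_class q \<in> carrier Iq1"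
  by (auto simp: Iq1_def witt_class_def intro: quotientI)

lemma Iq1_carrierE:
  assumes "X \<in> carrier Iq1"
  obtains q where "q \<in> even_nonsingular" "X = witt_class q"
  using assms by (auto simp: Iq1_def witt_class_def elim: quotientE)

text \<open>The product is defined as a union over all representatives. Since orthogonal sums
  respect \<open>witt_equiv\<close>, every member of that union is the same class.\<close>

lemma Iq1_mult:
  assumes "p \<in> even_nonsingular" "q \<in> even_nonsingular"
  shows "witt_class p \<otimes>\<^bsub>Iq1\<^esub> witt_class q = witt_class (p \<bottom>\<^sub>q q)"
proof -
  have "congruent2 witt_equiv witt_equiv (\<lambda>p q :: 'a qform. witt_class (p \<bottom>\<^sub>q q))"
  proof (rule congruent2I')
    fix p p' q q' :: "'a qform" assume *: "(p, p') \<in> witt_equiv" "(q, q') \<in> witt_equiv"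
    have "p \<bottom>\<^sub>q q \<in> even_nonsingular" "p' \<bottom>\<^sub>q q' \<in> even_nonsingular"
      using * by (auto simp: witt_equiv_def even_nonsingular_orth)
    then show "witt_class (p \<bottom>\<^sub>q q) = witt_class (p' \<bottom>\<^sub>q q')"
      using witt_equiv_orth[OF *] by (simp add: witt_class_eq_iff)
  qed
  from UN_equiv_class2[OF equiv_witt_equiv equiv_witt_equiv this assms]
  show ?thesis by (simp add: Iq1_def witt_class_def)
qed

lemma Iq1_one: "\<one>\<^bsub>Iq1\<^esub> = witt_class q_zero"
  by (simp add: Iq1_def)

lemma witt_class_hyperbolic: "witt_class (hyperbolic k) = \<one>\<^bsub>Iq1\<^esub>"
proof -
  have "hyperbolic k \<bottom>\<^sub>q hyperbolic 0 \<cong>\<^sub>q q_zero \<bottom>\<^sub>q hyperbolic k"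
    using orth_commute[OF regular_hyperbolic regular_hyperbolic, of k 0] by simp
  then have "(hyperbolic k, q_zero) \<in> witt_equiv"
    by (intro witt_equivI[of _ _ 0 k] even_nonsingular_hyperbolic even_nonsingular_zero) simp
  then show ?thesis
    by (simp add: Iq1_one witt_class_eq_iff even_nonsingular_hyperbolic even_nonsingular_zero)
qed

context char_two
begin

text \<open>In characteristic 2 a form is its own negative. This provides the inverses of the Witt
  group and later disposes of inverses in the generated subgroup.\<close>

lemma Iq1_mult_self:
  fixes q :: "'a qform"
  assumes "q \<in> even_nonsingular"
  shows "witt_class q \<otimes>\<^bsub>Iq1\<^esub> witt_class q = \<one>\<^bsub>Iq1\<^esub>"
proof -
  have "q \<bottom>\<^sub>q q \<cong>\<^sub>q hyperbolic (qdim q)"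
    using assms by (intro orth_self_hyperbolic) (simp add: even_nonsingular_iff)
  from witt_class_isometric[OF this even_nonsingular_hyperbolic]
  show ?thesis using assms by (simp add: Iq1_mult witt_class_hyperbolic)
qed

lemma comm_group_Iq1: "comm_group (Iq1 :: 'a qform set monoid)"
proof (rule comm_groupI)
  fix X Y Z :: "'a qform set"
  assume "X \<in> carrier Iq1" "Y \<in> carrier Iq1" "Z \<in> carrier Iq1"
  then obtain p q r where *: "p \<in> even_nonsingular" "q \<in> even_nonsingular" "r \<in> even_nonsingular"
    and XYZ: "X = witt_class p" "Y = witt_class q" "Z = witt_class r"
    by (elim Iq1_carrierE) blast
  then show "X \<otimes>\<^bsub>Iq1\<^esub> Y \<otimes>\<^bsub>Iq1\<^esub> Z = X \<otimes>\<^bsub>Iq1\<^esub> (Y \<otimes>\<^bsub>Iq1\<^esub> Z)"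
    by (simp add: Iq1_mult even_nonsingular_orth)
      (intro witt_class_isometric orth_assoc even_nonsingular_orth, simp_all add: even_nonsingular_iff)
next
  fix X Y :: "'a qform set"
  assume "X \<in> carrier Iq1" "Y \<in> carrier Iq1"
  then obtain p q where *: "p \<in> even_nonsingular" "q \<in> even_nonsingular"
    and XY: "X = witt_class p" "Y = witt_class q"
    by (elim Iq1_carrierE) blast
  then show "X \<otimes>\<^bsub>Iq1\<^esub> Y \<in> carrier Iq1"
    by (simp add: Iq1_mult even_nonsingular_orth Iq1_carrierI)
  show "X \<otimes>\<^bsub>Iq1\<^esub> Y = Y \<otimes>\<^bsub>Iq1\<^esub> X"
    using * XY by (simp add: Iq1_mult)
      (intro witt_class_isometric orth_commute even_nonsingular_orth, simp_all add: even_nonsingular_iff)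
next
  fix X :: "'a qform set"
  assume X: "X \<in> carrier Iq1"
  then obtain p where p: "p \<in> even_nonsingular" and Xp: "X = witt_class p"
    by (rule Iq1_carrierE)
  have rp: "regular p" using p by (simp add: even_nonsingular_iff)
  have "q_zero \<bottom>\<^sub>q p \<cong>\<^sub>q p \<bottom>\<^sub>q q_zero" by (rule orth_commute[OF regular_zero rp])
  also have "\<dots> \<cong>\<^sub>q p" by (rule orth_zero[OF rp])
  finally show "\<one>\<^bsub>Iq1\<^esub> \<otimes>\<^bsub>Iq1\<^esub> X = X"
    using witt_class_isometric p by (simp add: Xp Iq1_one Iq1_mult even_nonsingular_zero)
  show "\<exists>Y \<in> carrier Iq1. Y \<otimes>\<^bsub>Iq1\<^esub> X = \<one>\<^bsub>Iq1\<^esub>"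
    using X Xp Iq1_mult_self[OF p] by auto
qed (simp add: Iq1_one Iq1_carrierI even_nonsingular_zero)

end

subsection \<open>Value sets\<close>

definition represents :: "'a::field qform \<Rightarrow> 'a \<Rightarrow> bool" where
  "represents q c \<longleftrightarrow> (\<exists>v \<in> carrier_vec (qdim q). qval q v = c)"

text \<open>The nonzero values are required to be similarity factors. Only a linear map is asked
  for; when \<open>q\<close> is regular, \<open>q_isometricI\<close> turns it into an isometry, as
  in \<open>scale_isometric\<close>.\<close>

definition round_form :: "'a::field qform \<Rightarrow> bool" where
  "round_form q \<longleftrightarrow> (\<forall>c. c \<noteq> 0 \<and> represents q c \<longrightarrow>
     (\<exists>f. vec_linear (qdim q) (qdim q) f \<and> (\<forall>v \<in> carrier_vec (qdim q). qval q (f v) = c * qval q v)))"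

lemma representsI: "v \<in> carrier_vec (qdim q) \<Longrightarrow> represents q (qval q v)"
  by (auto simp: represents_def)

lemma represents_0: "is_qform q \<Longrightarrow> represents q 0"
  using representsI[of "0\<^sub>v (qdim q)" q] by (simp add: qval_zero)

lemma represents_square:
  assumes "is_qform q" "represents q c"
  shows "represents q (t\<^sup>2 * c)"
proof -
  from assms(2) obtain v where "v \<in> carrier_vec (qdim q)" "qval q v = c" by (auto simp: represents_def)
  then show ?thesis using representsI[of "t \<cdot>\<^sub>v v" q] qval_smult[OF assms(1)] by simp
qed

lemma represents_orth: "represents (p \<bottom>\<^sub>q q) c \<longleftrightarrow> (\<exists>x y. represents p x \<and> represents q y \<and> c = x + y)"
proof
  assume "represents (p \<bottom>\<^sub>q q) c"
  then obtain w where w: "w \<in> carrier_vec (qdim (p \<bottom>\<^sub>q q))" and c: "qval (p \<bottom>\<^sub>q q) w = c"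
    by (auto simp: represents_def)
  from w obtain u v where "u \<in> carrier_vec (qdim p)" "v \<in> carrier_vec (qdim q)" "w = u @\<^sub>v v"
    by (rule orth_carrierE)
  then show "\<exists>x y. represents p x \<and> represents q y \<and> c = x + y"
    using c by (auto simp: qval_orth intro: representsI)
next
  assume "\<exists>x y. represents p x \<and> represents q y \<and> c = x + y"
  then obtain u v where "u \<in> carrier_vec (qdim p)" "v \<in> carrier_vec (qdim q)" "c = qval p u + qval q v"
    by (auto simp: represents_def)
  then show "represents (p \<bottom>\<^sub>q q) c"
    using representsI[of "u @\<^sub>v v" "p \<bottom>\<^sub>q q"] by (simp add: qval_orth)
qed

lemma represents_scale: "represents (q_scale b q) c \<longleftrightarrow> (\<exists>x. represents q x \<and> c = b * x)"
  by (auto simp: represents_def)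

lemma represents_isometric:
  assumes "p \<cong>\<^sub>q q" "represents p c"
  shows "represents q c"
proof -
  obtain f where "vec_linear (qdim p) (qdim q) f"
    "\<And>v. v \<in> carrier_vec (qdim p) \<Longrightarrow> qval p v = qval q (f v)"
    using q_isometricE[OF assms(1)] by metis
  then show ?thesis
    using assms(2) vec_linear_carrier[of "qdim p" "qdim q" f] unfolding represents_def by metis
qed

lemma round_formE:
  assumes "round_form q" "c \<noteq> 0" "represents q c"
  obtains f where "vec_linear (qdim q) (qdim q) f"
    "\<And>v. v \<in> carrier_vec (qdim q) \<Longrightarrow> qval q (f v) = c * qval q v"
  using assms unfolding round_form_def by blast

text \<open>A similarity with factor \<open>c\<close>, applied to a vector of value
  \<open>c'\<close>, gives a vector of value \<open>c * c'\<close>.\<close>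

lemma represents_mult:
  assumes "round_form q" "is_qform q" "represents q c" "represents q c'"
  shows "represents q (c * c')"
proof (cases "c = 0")
  case True
  then show ?thesis using represents_0[OF assms(2)] by simp
next
  case False
  obtain f where f: "vec_linear (qdim q) (qdim q) f"
    "\<And>v. v \<in> carrier_vec (qdim q) \<Longrightarrow> qval q (f v) = c * qval q v"
    using round_formE[OF assms(1) False assms(3)] by metis
  from assms(4) obtain v where v: "v \<in> carrier_vec (qdim q)" "qval q v = c'"
    by (auto simp: represents_def)
  show ?thesis
    using representsI[OF vec_linear_carrier[OF f(1) v(1)]] f(2)[OF v(1)] v(2) by simp
qed

lemma represents_divide:
  assumes "round_form q" "is_qform q" "represents q c" "represents q c'"
  shows "represents q (c / c')"
proof -
  \<comment> \<open>A quotient differs from a product by a square. The equation also holds for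
    \<open>c' = 0\<close>, where division by zero makes both sides 0.\<close>
  have "(1 / c')\<^sup>2 * (c * c') = c / c'" by (simp add: power2_eq_square)
  then show ?thesis
    using represents_square[OF assms(2) represents_mult[OF assms], of "1 / c'"] by simp
qed

lemma represents_inverse:
  assumes "is_qform q" "represents q c"
  shows "represents q (1 / c)"
  using represents_square[OF assms, of "1 / c"] by (simp add: power2_eq_square split: if_splits)

lemma scale_isometric:
  assumes "round_form q" "regular q" "c \<noteq> 0" "represents q c"
  shows "q_scale c q \<cong>\<^sub>q q"
proof -
  obtain f where f: "vec_linear (qdim q) (qdim q) f"
    "\<And>v. v \<in> carrier_vec (qdim q) \<Longrightarrow> qval q (f v) = c * qval q v"
    using round_formE[OF assms(1,3,4)] by metis
  then show ?thesis
    by (intro q_isometricI[where f = f] regular_scale assms) simp_all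
qed

lemma scale_scale: "q_scale a (q_scale b q) = q_scale (a * b) q"
  by (simp add: q_scale_def mult.assoc)

lemma round_form_isometric:
  assumes "p \<cong>\<^sub>q q" "round_form q"
  shows "round_form p"
  unfolding round_form_def
proof (intro allI impI, elim conjE)
  fix c assume c: "c \<noteq> 0" "represents p c"
  obtain g where g: "vec_linear (qdim q) (qdim q) g"
    "\<And>v. v \<in> carrier_vec (qdim q) \<Longrightarrow> qval q (g v) = c * qval q v"
    using round_formE[OF assms(2) c(1) represents_isometric[OF assms(1) c(2)]] by metis
  obtain f where f: "vec_linear (qdim p) (qdim q) f"
    "\<And>v. v \<in> carrier_vec (qdim p) \<Longrightarrow> qval p v = qval q (f v)"
    using q_isometricE[OF assms(1)] by metis
  obtain h where h: "vec_linear (qdim q) (qdim p) h"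
    "\<And>v. v \<in> carrier_vec (qdim q) \<Longrightarrow> qval q v = qval p (h v)"
    using q_isometricE[OF q_isometric_sym[OF assms(1)]] by metis
  show "\<exists>f. vec_linear (qdim p) (qdim p) f \<and> (\<forall>v \<in> carrier_vec (qdim p). qval p (f v) = c * qval p v)"
  proof (intro exI conjI ballI)
    show "vec_linear (qdim p) (qdim p) (\<lambda>v. h (g (f v)))"
      by (intro vec_linear_comp[OF f(1)] vec_linear_comp[OF g(1)] h(1))
    fix v :: "'a vec" assume v: "v \<in> carrier_vec (qdim p)"
    have fv: "f v \<in> carrier_vec (qdim q)" using vec_linear_carrier[OF f(1) v] .
    show "qval p (h (g (f v))) = c * qval p v"
      using h(2)[OF vec_linear_carrier[OF g(1) fv]] g(2)[OF fv] f(2)[OF v] by simp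
  qed
qed

section \<open>Values of round forms in characteristic two\<close>

context char_two
begin

text \<open>This is the universality of the hyperbolic form \<open>q \<bottom>\<^sub>q q\<close>.
  Concretely, the values at \<open>w + t u\<close> and at \<open>t u\<close> add up to
  \<open>qval q w + t * polar q w u\<close>, which takes every value as \<open>t\<close> varies once
  the polar value is nonzero.\<close>

lemma represents_orth_self:
  fixes q :: "'a qform"
  assumes q: "regular q" and "qdim q > 0"
  obtains x y where "represents q x" "represents q y" "c = x + y"
proof -
  let ?w = "unit_vec (qdim q) 0"
  have w: "?w \<in> carrier_vec (qdim q)" "?w \<noteq> 0\<^sub>v (qdim q)" using assms(2) by simp_all
  obtain u where u: "u \<in> carrier_vec (qdim q)" "polar q ?w u \<noteq> 0"
    using nonsingularD[OF regularD(2)[OF q] w] by blast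
  define t where "t = (c + qval q ?w) / polar q ?w u"
  have "polar q ?w (t \<cdot>\<^sub>v u) = c + qval q ?w"
    using linear_form_smult[OF polar_linear_right[OF regularD(1)[OF q] w(1)] u(1)] u(2) by (simp add: t_def)
  then have "c = qval q (?w + t \<cdot>\<^sub>v u) + qval q (t \<cdot>\<^sub>v u)"
    by (simp add: qval_add add.assoc add.commute add.left_commute)
  then show thesis
    using u(1) w(1) by (intro that[of "qval q (?w + t \<cdot>\<^sub>v u)" "qval q (t \<cdot>\<^sub>v u)"] representsI) simp_all
qed

lemma polar_similarity:
  assumes "vec_linear (qdim q) (qdim q) f"
    "\<And>v. v \<in> carrier_vec (qdim q) \<Longrightarrow> qval q (f v) = c * qval q v"
    "u \<in> carrier_vec (qdim q)" "v \<in> carrier_vec (qdim q)"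
  shows "polar q (f u) (f v) = c * polar q u v"
proof -
  have "polar q (f u) (f v) = qval q (f (u + v)) - qval q (f u) - qval q (f v)"
    by (simp add: polar_def vec_linear_add[OF assms(1,3,4)])
  then show ?thesis using assms(3,4) by (simp add: assms(2) polar_def right_diff_distrib)
qed

text \<open>The inductive step for the roundness of Pfister forms. For \<open>c = x + b * y\<close>,
  similarities of \<open>q\<close> with factors \<open>x\<close> and \<open>y\<close> are combined
  into one of the doubled form with factor \<open>c\<close>.\<close>

lemma round_form_orth_scale:
  fixes q :: "'a qform"
  assumes round: "round_form q" and q: "is_qform q" and b: "b \<noteq> 0"
  shows "round_form (q \<bottom>\<^sub>q q_scale b q)"
  unfolding round_form_def
proof (intro allI impI, elim conjE)
  let ?d = "qdim q" and ?r = "q \<bottom>\<^sub>q q_scale b q"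
  fix c assume c: "c \<noteq> 0" "represents ?r c"
  then obtain x y where x: "represents q x" and y: "represents q y" and c_def: "c = x + b * y"
    unfolding represents_orth represents_scale by blast
  have u: "vec_linear (?d + ?d) ?d (\<lambda>w. vec_first w ?d)" and v: "vec_linear (?d + ?d) ?d (\<lambda>w. vec_last w ?d)"
    by (rule vec_linear_first vec_linear_last)+
  have "\<exists>g h. vec_linear (?d + ?d) ?d g \<and> vec_linear (?d + ?d) ?d h \<and>
    (\<forall>w \<in> carrier_vec (?d + ?d). qval q (g w) + b * qval q (h w) =
       c * (qval q (vec_first w ?d) + b * qval q (vec_last w ?d)))"
  proof -
    \<comment> \<open>Roundness supplies a similarity for a nonzero value only. If one of
      \<open>x\<close>, \<open>y\<close> is 0, a similarity for the other suffices, with the two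
      components interchanged when \<open>x = 0\<close>.\<close>
    consider "x = 0" | "y = 0" | "x \<noteq> 0" "y \<noteq> 0" by blast
    then show ?thesis
    proof cases
      case 1
      with c c_def have "y \<noteq> 0" by auto
      obtain f where f: "vec_linear ?d ?d f" "\<And>v. v \<in> carrier_vec ?d \<Longrightarrow> qval q (f v) = y * qval q v"
        using round_formE[OF round \<open>y \<noteq> 0\<close> y] by metis
      show ?thesis
      proof (intro exI conjI ballI)
        show "vec_linear (?d + ?d) ?d (\<lambda>w. b \<cdot>\<^sub>v f (vec_last w ?d))"
          by (intro vec_linear_scale vec_linear_comp[OF v f(1)])
        show "vec_linear (?d + ?d) ?d (\<lambda>w. f (vec_first w ?d))"
          by (rule vec_linear_comp[OF u f(1)])
      qed (use 1 in \<open>simp add: c_def qval_smult[OF q] vec_linear_carrier[OF f(1)] f(2) char_two_simps\<close>)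
    next
      case 2
      with c c_def have "x \<noteq> 0" by auto
      obtain f where f: "vec_linear ?d ?d f" "\<And>v. v \<in> carrier_vec ?d \<Longrightarrow> qval q (f v) = x * qval q v"
        using round_formE[OF round \<open>x \<noteq> 0\<close> x] by metis
      show ?thesis
      proof (intro exI conjI ballI)
        show "vec_linear (?d + ?d) ?d (\<lambda>w. f (vec_first w ?d))"
          by (rule vec_linear_comp[OF u f(1)])
        show "vec_linear (?d + ?d) ?d (\<lambda>w. f (vec_last w ?d))"
          by (rule vec_linear_comp[OF v f(1)])
      qed (use 2 in \<open>simp add: c_def f(2) char_two_simps\<close>)
    next
      case 3
      obtain f where f: "vec_linear ?d ?d f" "\<And>v. v \<in> carrier_vec ?d \<Longrightarrow> qval q (f v) = x * qval q v"
        using round_formE[OF round 3(1) x] by metis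
      obtain g where g: "vec_linear ?d ?d g" "\<And>v. v \<in> carrier_vec ?d \<Longrightarrow> qval q (g v) = y * qval q v"
        using round_formE[OF round 3(2) y] by metis
      have k: "vec_linear ?d ?d (\<lambda>v. g (f v))" by (rule vec_linear_comp[OF f(1) g(1)])
      show ?thesis
      proof (intro exI conjI ballI)
        \<comment> \<open>With \<open>s\<close>, \<open>t\<close> the components of
          \<open>w\<close>, the vector \<open>r = g (f t)\<close> has \<open>x * y\<close> times the
          value of \<open>t\<close>. The coefficients \<open>b / x\<close> and \<open>1 / y\<close>
          are chosen so that each component, the second weighted by \<open>b\<close>, produces the
          polar term \<open>b * polar q s r\<close>. The two copies cancel and
          \<open>x + b * y\<close> factors out.\<close>
        show "vec_linear (?d + ?d) ?d (\<lambda>w. f (vec_first w ?d) + (b / x) \<cdot>\<^sub>v f (g (f (vec_last w ?d))))"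
          by (intro vec_linear_plus vec_linear_scale vec_linear_comp[OF u f(1)]
              vec_linear_comp[OF vec_linear_comp[OF v k] f(1)])
        show "vec_linear (?d + ?d) ?d (\<lambda>w. g (vec_first w ?d) + (1 / y) \<cdot>\<^sub>v g (g (f (vec_last w ?d))))"
          by (intro vec_linear_plus vec_linear_scale vec_linear_comp[OF u g(1)]
              vec_linear_comp[OF vec_linear_comp[OF v k] g(1)])
        fix w :: "'a vec"
        define s where "s = vec_first w ?d"
        define t where "t = vec_last w ?d"
        define r where "r = g (f t)"
        have sc: "s \<in> carrier_vec ?d" and tc: "t \<in> carrier_vec ?d" by (simp_all add: s_def t_def)
        have rc: "r \<in> carrier_vec ?d" using vec_linear_carrier[OF k tc] by (simp add: r_def)
        have r: "qval q r = x * y * qval q t"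
          using vec_linear_carrier[OF f(1) tc] tc by (simp add: r_def f(2) g(2))
        have "polar q (f s) ((b / x) \<cdot>\<^sub>v f r) = b * polar q s r"
          using linear_form_smult[OF polar_linear_right[OF q vec_linear_carrier[OF f(1) sc]]
              vec_linear_carrier[OF f(1) rc], of "b / x"] polar_similarity[OF f sc rc] 3 by simp
        then have 1: "qval q (f s + (b / x) \<cdot>\<^sub>v f r) = x * qval q s + b\<^sup>2 * y * qval q t + b * polar q s r"
          using 3 sc rc vec_linear_carrier[OF f(1) rc]
          by (simp add: qval_add qval_smult[OF q] f(2) r power2_eq_square)
        have "polar q (g s) ((1 / y) \<cdot>\<^sub>v g r) = polar q s r"
          using linear_form_smult[OF polar_linear_right[OF q vec_linear_carrier[OF g(1) sc]]
              vec_linear_carrier[OF g(1) rc], of "1 / y"] polar_similarity[OF g sc rc] 3 by simp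
        then have 2: "qval q (g s + (1 / y) \<cdot>\<^sub>v g r) = y * qval q s + x * qval q t + polar q s r"
          using 3 sc rc vec_linear_carrier[OF g(1) rc]
          by (simp add: qval_add qval_smult[OF q] g(2) r power2_eq_square)
        have "qval q (f s + (b / x) \<cdot>\<^sub>v f r) + b * qval q (g s + (1 / y) \<cdot>\<^sub>v g r) =
            c * (qval q s + b * qval q t)"
          unfolding 1 2 c_def by (simp add: char_two_simps)
        then show "qval q (f (vec_first w ?d) + (b / x) \<cdot>\<^sub>v f (g (f (vec_last w ?d)))) +
            b * qval q (g (vec_first w ?d) + (1 / y) \<cdot>\<^sub>v g (g (f (vec_last w ?d)))) =
            c * (qval q (vec_first w ?d) + b * qval q (vec_last w ?d))"
          by (simp add: s_def t_def r_def)
      qed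
    qed
  qed
  then obtain g h where g: "vec_linear (?d + ?d) ?d g" and h: "vec_linear (?d + ?d) ?d h"
    and gh: "\<forall>w \<in> carrier_vec (?d + ?d). qval q (g w) + b * qval q (h w) =
       c * (qval q (vec_first w ?d) + b * qval q (vec_last w ?d))" by blast
  show "\<exists>f. vec_linear (qdim ?r) (qdim ?r) f \<and> (\<forall>v \<in> carrier_vec (qdim ?r). qval ?r (f v) = c * qval ?r v)"
  proof (intro exI conjI ballI)
    show "vec_linear (qdim ?r) (qdim ?r) (\<lambda>w. g w @\<^sub>v h w)"
      using vec_linear_append[OF g h] by simp
    fix w :: "'a vec" assume "w \<in> carrier_vec (qdim ?r)"
    then have w: "w \<in> carrier_vec (?d + ?d)" by simp
    show "qval ?r (g w @\<^sub>v h w) = c * qval ?r w"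
      using gh w vec_linear_carrier[OF g w] vec_linear_carrier[OF h w]
      by (simp add: qval_orth) (simp add: q_orth_def)
  qed
qed

end

lemma represents_binary_sum:
  "represents (q_scale a q \<bottom>\<^sub>q q_scale b q) c \<longleftrightarrow> (\<exists>x y. represents q x \<and> represents q y \<and> c = a * x + b * y)"
  unfolding represents_orth represents_scale by blast

lemma represents_pfister_sum:
  "represents (q \<bottom>\<^sub>q q_scale b q) c \<longleftrightarrow> (\<exists>x y. represents q x \<and> represents q y \<and> c = x + b * y)"
  unfolding represents_orth represents_scale by blast

context char_two
begin

text \<open>If the value attached to the coefficient that is solved for is nonzero, divide by it;
  values of a round form are closed under quotients. If it vanishes, the remaining summand relates
  \<open>a\<close> and \<open>b\<close> through a value of \<open>q\<close>, and
  \<open>represents_orth_self\<close> writes the desired scalar as a sum of two values.\<close>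

lemma represents_one_iff:
  fixes q :: "'a qform"
  assumes round: "round_form q" and q: "regular q" "qdim q > 0" and a: "a \<noteq> 0" and b: "b \<noteq> 0"
  shows "represents (q_scale a q \<bottom>\<^sub>q q_scale b q) 1 \<longleftrightarrow> represents (q \<bottom>\<^sub>q q_scale b q) a"
proof
  note Q = regularD(1)[OF q(1)]
  assume "represents (q_scale a q \<bottom>\<^sub>q q_scale b q) 1"
  then obtain x y where x: "represents q x" and y: "represents q y" and xy: "1 = a * x + b * y"
    unfolding represents_binary_sum by blast
  show "represents (q \<bottom>\<^sub>q q_scale b q) a"
  proof (cases "x = 0")
    case True
    then have by1: "b * y = 1" using xy by simp
    \<comment> \<open>As \<open>b * y = 1\<close>, the summand \<open>t\<close> can be rewritten as
      \<open>b * (y * t)\<close>.\<close>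
    obtain s t where s: "represents q s" and t: "represents q t" and a_st: "a = s + t"
      by (rule represents_orth_self[OF q])
    have "a = s + b * (y * t)" using a_st by1 by (simp flip: mult.assoc)
    then show ?thesis
      unfolding represents_pfister_sum using s represents_mult[OF round Q y t] by blast
  next
    case False
    have "1 + b * y = (a * x + b * y) + b * y" by (simp only: xy[symmetric])
    also have "\<dots> = a * x" by (simp add: add.assoc)
    finally have "1 + b * y = a * x" .
    then have "a = 1 / x + b * (y / x)" using False by (simp add: field_simps)
    then show ?thesis
      unfolding represents_pfister_sum
      using represents_inverse[OF Q x] represents_divide[OF round Q y x] by blast
  qed
next
  note Q = regularD(1)[OF q(1)]
  assume "represents (q \<bottom>\<^sub>q q_scale b q) a"
  then obtain x y where x: "represents q x" and y: "represents q y" and xy: "a = x + b * y"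
    unfolding represents_pfister_sum by blast
  show "represents (q_scale a q \<bottom>\<^sub>q q_scale b q) 1"
  proof (cases "x = 0")
    case True
    with xy a have a_by: "a = b * y" and "y \<noteq> 0" by auto
    \<comment> \<open>Decomposing \<open>1 / b\<close> gives \<open>1 = b * s + b * t\<close>, and
      \<open>a = b * y\<close> turns \<open>b * s\<close> into \<open>a * (s / y)\<close>.\<close>
    obtain s t where s: "represents q s" and t: "represents q t" and st: "1 / b = s + t"
      by (rule represents_orth_self[OF q])
    have "1 = b * (s + t)" using b by (simp flip: st)
    then have "1 = a * (s / y) + b * t" using a_by \<open>y \<noteq> 0\<close> by (simp add: distrib_left)
    then show ?thesis
      unfolding represents_binary_sum using t represents_divide[OF round Q s y] by blast
  next
    case False
    have "a + b * y = x" using xy by (simp add: add.assoc)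
    then have "1 = (a + b * y) / x" using False by simp
    then have "1 = a * (1 / x) + b * (y / x)" by (simp add: add_divide_distrib)
    then show ?thesis
      unfolding represents_binary_sum
      using represents_inverse[OF Q x] represents_divide[OF round Q y x] by blast
  qed
qed

text \<open>By \<open>represents_one_iff\<close> both sides say that the sum of
  \<open>q_scale a q\<close> and \<open>q_scale b q\<close> represents 1, a condition symmetric in
  \<open>a\<close> and \<open>b\<close>.\<close>

lemma represents_pfister_sum_commute:
  fixes q :: "'a qform"
  assumes "round_form q" "regular q" "qdim q > 0" "a \<noteq> 0" "b \<noteq> 0"
  shows "represents (q \<bottom>\<^sub>q q_scale b q) a \<longleftrightarrow> represents (q \<bottom>\<^sub>q q_scale a q) b"
proof -
  have "represents (q_scale a q \<bottom>\<^sub>q q_scale b q) 1 \<longleftrightarrow> represents (q_scale b q \<bottom>\<^sub>q q_scale a q) 1"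
    unfolding represents_binary_sum by (metis add.commute)
  then show ?thesis using assms by (simp add: represents_one_iff)
qed

text \<open>Up to a square in the second component, the left side is the right side scaled by
  \<open>a\<close>. Multiplying \<open>1 = a * x + b * y\<close> by \<open>a\<close> shows that the
  right side represents \<open>a\<close>, so roundness removes the scaling.\<close>

lemma binary_sum_isometric:
  fixes q :: "'a qform"
  assumes round: "round_form q" and q: "regular q" "qdim q > 0" and a: "a \<noteq> 0" and b: "b \<noteq> 0"
    and rep: "represents (q \<bottom>\<^sub>q q_scale b q) a"
  shows "q_scale a q \<bottom>\<^sub>q q_scale b q \<cong>\<^sub>q q \<bottom>\<^sub>q q_scale (a * b) q"
proof -
  note Q = regularD(1)[OF q(1)]
  let ?r = "q \<bottom>\<^sub>q q_scale (a * b) q"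
  have r: "regular ?r" "round_form ?r"
    using a b round_form_orth_scale[OF round Q] regular_orth[OF q(1) regular_scale[OF q(1)]] by simp_all
  from rep have "represents (q_scale a q \<bottom>\<^sub>q q_scale b q) 1"
    using represents_one_iff[OF round q a b] by simp
  then obtain x y where x: "represents q x" and y: "represents q y" and xy: "1 = a * x + b * y"
    unfolding represents_binary_sum by blast
  have "a * 1 = a\<^sup>2 * x + (a * b) * y" unfolding xy by (simp add: char_two_simps)
  then have "represents ?r a"
    unfolding represents_pfister_sum using represents_square[OF Q x, of a] y by auto
  then have *: "q_scale a ?r \<cong>\<^sub>q ?r" by (rule scale_isometric[OF r(2,1) a])
  have "q_scale a q \<bottom>\<^sub>q q_scale b q \<cong>\<^sub>q q_scale a ?r"
  proof (rule orth_isometricI)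
    \<comment> \<open>Dividing the second component by \<open>a\<close> absorbs the factor
      \<open>a\<^sup>2\<close> between \<open>b\<close> and \<open>a * (a * b)\<close>.\<close>
    show "vec_linear (qdim (q_scale a q) + qdim (q_scale b q)) (qdim (q_scale a ?r))
        (\<lambda>w. vec_first w (qdim q) @\<^sub>v (1 / a) \<cdot>\<^sub>v vec_last w (qdim q))"
      by (simp add: vec_linear_intros)
  qed (use q a b in \<open>simp_all add: regular_scale qval_orth qval_smult[OF Q] power2_eq_square distrib_left\<close>)
  from q_isometric_trans[OF this *] show ?thesis .
qed

end

subsection \<open>Pfister forms\<close>

text \<open>These are the diagonal entries of \<open>pfister_bform \<beta>s\<close>, in the order in
  which the tensor product lists its blocks.\<close>

primrec pfister_coeffs :: "'a::field list \<Rightarrow> 'a list" where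
  "pfister_coeffs [] = [1]"
| "pfister_coeffs (\<beta> # \<beta>s) = pfister_coeffs \<beta>s @ map ((*) \<beta>) (pfister_coeffs \<beta>s)"

lemma length_pfister_coeffs [simp]: "length (pfister_coeffs \<beta>s) = 2 ^ length \<beta>s"
  by (induction \<beta>s) simp_all

lemma pfister_coeffs_nonzero: "0 \<notin> set \<beta>s \<Longrightarrow> 0 \<notin> set (pfister_coeffs \<beta>s)"
  by (induction \<beta>s) auto

lemma sum_lessThan_double: "(\<Sum>i<2 * n. f i) = (\<Sum>i<n. f i) + (\<Sum>i<n. f (n + i))" for n :: nat
proof -
  have "(\<Sum>i<n + m. f i) = (\<Sum>i<n. f i) + (\<Sum>i<m. f (n + i))" for m
    by (induction m) (simp_all add: add.assoc)
  from this[of n] show ?thesis by (simp add: mult_2)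
qed

lemma sum_pfister_coeffs_Cons:
  "(\<Sum>i<2 ^ length (\<beta> # \<beta>s). pfister_coeffs (\<beta> # \<beta>s) ! i * f i) =
    (\<Sum>i<2 ^ length \<beta>s. pfister_coeffs \<beta>s ! i * f i) +
    \<beta> * (\<Sum>i<2 ^ length \<beta>s. pfister_coeffs \<beta>s ! i * f (2 ^ length \<beta>s + i))"
proof -
  have "(\<Sum>i<2 ^ length (\<beta> # \<beta>s). pfister_coeffs (\<beta> # \<beta>s) ! i * f i) =
    (\<Sum>i<2 ^ length \<beta>s. pfister_coeffs (\<beta> # \<beta>s) ! i * f i) +
    (\<Sum>i<2 ^ length \<beta>s. pfister_coeffs (\<beta> # \<beta>s) ! (2 ^ length \<beta>s + i) * f (2 ^ length \<beta>s + i))"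
    using sum_lessThan_double[of _ "2 ^ length \<beta>s"] by simp
  then show ?thesis by (simp add: nth_append sum_distrib_left mult.assoc)
qed

lemma bdim_diag [simp]: "bdim (diag_bform as) = length as"
  and bdim_tensor [simp]: "bdim (b \<otimes>\<^sub>b c) = bdim b * bdim c"
  and qdim_tensor [simp]: "qdim (b \<otimes>\<^sub>q q) = bdim b * qdim q"
  by (simp_all add: diag_bform_def bb_tensor_def bq_tensor_def)

lemma bdim_pfister [simp]: "bdim (pfister_bform \<beta>s) = 2 ^ length \<beta>s"
  by (induction \<beta>s) simp_all

lemma bval_diag_tensor:
  "bval (diag_bform [1, \<beta>] \<otimes>\<^sub>b c) u v =
    bval c (block (bdim c) u 0) (block (bdim c) v 0) + \<beta> * bval c (block (bdim c) u 1) (block (bdim c) v 1)"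
  by (simp add: bb_tensor_def diag_bform_def numeral_2_eq_2)

lemma bval_pfister:
  "bval (pfister_bform \<beta>s) u v = (\<Sum>i<2 ^ length \<beta>s. pfister_coeffs \<beta>s ! i * (u $ i * v $ i))"
proof (induction \<beta>s arbitrary: u v)
  case Nil
  then show ?case by (simp add: diag_bform_def)
next
  case (Cons \<beta> \<beta>s)
  show ?case
    unfolding sum_pfister_coeffs_Cons pfister_bform.simps bval_diag_tensor Cons.IH
    by (simp add: block_def)
qed

lemma is_bform_pfister: "is_bform (pfister_bform \<beta>s)"
  unfolding is_bform_def bval_pfister
  by (simp add: mult.commute distrib_left distrib_right sum.distrib sum_distrib_left mult.left_commute)

lemma qval_pfister_tensor:
  "qval (pfister_bform \<beta>s \<otimes>\<^sub>q q) w =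
    (\<Sum>i<2 ^ length \<beta>s. pfister_coeffs \<beta>s ! i * qval q (block (qdim q) w i))"
proof -
  let ?e = "unit_vec (2 ^ length \<beta>s)"
  have "bval (pfister_bform \<beta>s) (?e i) (?e j) = (if i = j then pfister_coeffs \<beta>s ! i else 0)"
    if "i < 2 ^ length \<beta>s" "j < 2 ^ length \<beta>s" for i j
  proof -
    have "bval (pfister_bform \<beta>s) (?e i) (?e j) =
        (\<Sum>k<2 ^ length \<beta>s. if k = i then (if i = j then pfister_coeffs \<beta>s ! i else 0) else 0)"
      unfolding bval_pfister using that by (intro sum.cong) auto
    then show ?thesis using that by simp
  qed
  then show ?thesis by (simp add: bq_tensor_def)
qed

lemma qdim_pfister [simp]: "qdim (pfister_qform \<beta>s \<alpha>) = 2 * 2 ^ length \<beta>s"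
  by (simp add: pfister_qform_def)

lemma qval_pfister:
  "qval (pfister_qform \<beta>s \<alpha>) w = (\<Sum>i<2 ^ length \<beta>s. pfister_coeffs \<beta>s ! i *
    ((w $ (2 * i))\<^sup>2 + w $ (2 * i) * w $ (2 * i + 1) + \<alpha> * (w $ (2 * i + 1))\<^sup>2))"
  unfolding pfister_qform_def qval_pfister_tensor
  by (simp add: block_def binary_qform_def mult.commute)

lemma is_qform_pfister: "is_qform (pfister_qform \<beta>s \<alpha>)"
proof -
  let ?d = "2 * 2 ^ length \<beta>s"
  have L: "linear_form ?d (\<lambda>w :: 'a vec. w $ (2 * i))" "linear_form ?d (\<lambda>w :: 'a vec. w $ (2 * i + 1))"
    if "i < 2 ^ length \<beta>s" for i
    using that by (auto intro!: linear_form_index)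
  have "is_qform \<lparr>qdim = ?d, qval = (\<lambda>w :: 'a vec. \<Sum>i<2 ^ length \<beta>s. pfister_coeffs \<beta>s ! i *
    (w $ (2 * i) * w $ (2 * i) + w $ (2 * i) * w $ (2 * i + 1) + \<alpha> * (w $ (2 * i + 1) * w $ (2 * i + 1))))\<rparr>"
    by (intro is_qform_sum is_qform_scale is_qform_add is_qform_mult L) simp_all
  then show ?thesis
    by (rule is_qform_cong) (simp_all add: qval_pfister power2_eq_square)
qed

lemma pfister_represents_1: "represents (pfister_qform \<beta>s \<alpha>) 1"
proof -
  have c: "pfister_coeffs \<beta>s ! 0 = 1" by (induction \<beta>s) (simp_all add: nth_append)
  let ?e = "unit_vec (2 * 2 ^ length \<beta>s) 0"
  have "qval (pfister_qform \<beta>s \<alpha>) ?e = (\<Sum>i<2 ^ length \<beta>s :: nat. if i = 0 then 1 else 0)"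
    unfolding qval_pfister by (intro sum.cong) (auto simp: c)
  then show ?thesis using representsI[of ?e "pfister_qform \<beta>s \<alpha>"] by simp
qed

section \<open>Regularity and roundness of Pfister forms\<close>

context char_two
begin

lemma polar_pfister:
  fixes \<alpha> :: 'a
  assumes "u \<in> carrier_vec (2 * 2 ^ length \<beta>s)" "v \<in> carrier_vec (2 * 2 ^ length \<beta>s)"
  shows "polar (pfister_qform \<beta>s \<alpha>) u v = (\<Sum>i<2 ^ length \<beta>s. pfister_coeffs \<beta>s ! i *
    (u $ (2 * i) * v $ (2 * i + 1) + u $ (2 * i + 1) * v $ (2 * i)))"
  unfolding polar_def qval_pfister minus_eq sum.distrib[symmetric]
  using assms by (intro sum.cong) (simp_all add: char_two_simps)

lemma regular_pfister:
  fixes \<alpha> :: 'a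
  assumes "0 \<notin> set \<beta>s"
  shows "regular (pfister_qform \<beta>s \<alpha>)"
proof -
  let ?n = "2 ^ length \<beta>s :: nat"
  have c: "pfister_coeffs \<beta>s ! i \<noteq> 0" if "i < ?n" for i
    using pfister_coeffs_nonzero[OF assms] that by (metis nth_mem length_pfister_coeffs)
  have "nonsingular (pfister_qform \<beta>s \<alpha>)"
  proof (rule nonsingularI)
    fix u assume u: "u \<in> carrier_vec (qdim (pfister_qform \<beta>s \<alpha>))"
      and 0: "\<And>v. v \<in> carrier_vec (qdim (pfister_qform \<beta>s \<alpha>)) \<Longrightarrow> polar (pfister_qform \<beta>s \<alpha>) u v = 0"
    have uc: "u \<in> carrier_vec (2 * ?n)" using u by simp
    \<comment> \<open>The polar form pairs the two coordinates of a binary block, so the odd unit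
      vector detects the even coordinate of \<open>u\<close> and conversely.\<close>
    have *: "u $ (2 * i) = 0 \<and> u $ (2 * i + 1) = 0" if i: "i < ?n" for i
    proof -
      let ?e = "unit_vec (2 * ?n) :: nat \<Rightarrow> 'a vec"
      have "polar (pfister_qform \<beta>s \<alpha>) u (?e (2 * i + 1)) =
          (\<Sum>k<?n. if k = i then pfister_coeffs \<beta>s ! i * u $ (2 * i) else 0)"
        unfolding polar_pfister[OF uc unit_vec_carrier] using i
        by (intro sum.cong) (auto simp: double_not_eq_Suc_double Suc_double_not_eq_double)
      moreover have "polar (pfister_qform \<beta>s \<alpha>) u (?e (2 * i)) =
          (\<Sum>k<?n. if k = i then pfister_coeffs \<beta>s ! i * u $ (2 * i + 1) else 0)"
        unfolding polar_pfister[OF uc unit_vec_carrier] using i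
        by (intro sum.cong) (auto simp: double_not_eq_Suc_double Suc_double_not_eq_double)
      ultimately show ?thesis using 0[of "?e (2 * i + 1)"] 0[of "?e (2 * i)"] c[OF i] i by simp
    qed
    show "u = 0\<^sub>v (qdim (pfister_qform \<beta>s \<alpha>))"
    proof (rule eq_vecI)
      fix j assume "j < dim_vec (0\<^sub>v (qdim (pfister_qform \<beta>s \<alpha>)) :: 'a vec)"
      then have j: "j < 2 * ?n" by simp
      then have "j div 2 < ?n" by simp
      from *[OF this] have "u $ j = 0" by (cases "even j") (auto elim!: evenE oddE)
      then show "u $ j = 0\<^sub>v (qdim (pfister_qform \<beta>s \<alpha>)) $ j" using j by simp
    qed (use uc in simp)
  qed
  then show ?thesis using is_qform_pfister by (simp add: regular_def)
qed

text \<open>The coefficients involving \<open>\<beta>\<close> form the second half of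
  \<open>pfister_coeffs\<close>, so the identity on coordinates is the isometry.\<close>

lemma pfister_Cons:
  fixes \<alpha> :: 'a
  assumes "0 \<notin> set (\<beta> # \<beta>s)"
  shows "pfister_qform (\<beta> # \<beta>s) \<alpha> \<cong>\<^sub>q pfister_qform \<beta>s \<alpha> \<bottom>\<^sub>q q_scale \<beta> (pfister_qform \<beta>s \<alpha>)"
proof (rule q_isometric_sym, rule orth_isometricI)
  show "vec_linear (qdim (pfister_qform \<beta>s \<alpha>) + qdim (q_scale \<beta> (pfister_qform \<beta>s \<alpha>)))
      (qdim (pfister_qform (\<beta> # \<beta>s) \<alpha>)) (\<lambda>v. v)"
    by (simp add: vec_linear_id mult_2)
  fix u v :: "'a vec"
  assume "u \<in> carrier_vec (qdim (pfister_qform \<beta>s \<alpha>))"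
    "v \<in> carrier_vec (qdim (q_scale \<beta> (pfister_qform \<beta>s \<alpha>)))"
  then have uv: "u \<in> carrier_vec (2 * 2 ^ length \<beta>s)" "v \<in> carrier_vec (2 * 2 ^ length \<beta>s)" by simp_all
  show "qval (pfister_qform \<beta>s \<alpha>) u + qval (q_scale \<beta> (pfister_qform \<beta>s \<alpha>)) v =
      qval (pfister_qform (\<beta> # \<beta>s) \<alpha>) (u @\<^sub>v v)"
    unfolding qval_scale qval_pfister sum_pfister_coeffs_Cons using uv
    by (intro arg_cong2[of _ _ _ _ "(+)"] arg_cong2[of _ _ _ _ "(*)"] sum.cong refl)
      (auto simp: distrib_left)
qed (use assms in \<open>simp_all add: regular_pfister regular_scale\<close>)

lemma round_form_pfister:
  fixes \<alpha> :: 'a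
  assumes "0 \<notin> set \<beta>s"
  shows "round_form (pfister_qform \<beta>s \<alpha>)"
  using assms
proof (induction \<beta>s)
  case Nil
  show ?case
    unfolding round_form_def
  proof (intro allI impI, elim conjE)
    fix c assume "represents (pfister_qform [] \<alpha>) c"
    then obtain w where c: "qval (pfister_qform [] \<alpha>) w = c" by (auto simp: represents_def)
    show "\<exists>f. vec_linear (qdim (pfister_qform [] \<alpha>)) (qdim (pfister_qform [] \<alpha>)) f \<and>
      (\<forall>v \<in> carrier_vec (qdim (pfister_qform [] \<alpha>)).
         qval (pfister_qform [] \<alpha>) (f v) = c * qval (pfister_qform [] \<alpha>) v)"
    proof (intro exI conjI ballI)
      \<comment> \<open>The form is the norm form of the quadratic algebra generated by an element
        with square itself plus \<open>\<alpha>\<close>. The map is multiplication by the element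
        with coordinates \<open>w $ 0\<close> and \<open>w $ 1\<close>, whose norm is
        \<open>c\<close>.\<close>
      show "vec_linear (qdim (pfister_qform [] \<alpha>)) (qdim (pfister_qform [] \<alpha>))
        (\<lambda>v. vec 2 (\<lambda>i. if i = 0 then w $ 0 * v $ 0 + \<alpha> * w $ 1 * v $ 1
           else w $ 1 * v $ 0 + (w $ 0 + w $ 1) * v $ 1))"
        by simp (intro vec_linear_vec linear_form_intros; simp)
    qed (simp add: qval_pfister flip: c, simp add: char_two_simps)
  qed
next
  case (Cons \<beta> \<beta>s)
  then have "round_form (pfister_qform \<beta>s \<alpha> \<bottom>\<^sub>q q_scale \<beta> (pfister_qform \<beta>s \<alpha>))"
    by (intro round_form_orth_scale is_qform_pfister) auto
  with pfister_Cons[OF Cons.prems] show ?case by (rule round_form_isometric)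
qed

end

section \<open>Tensor products and isometries of their factors\<close>

lemma pfister_tensor_single:
  assumes "regular \<rho>" "\<beta> \<noteq> 0"
  shows "pfister_bform [\<beta>] \<otimes>\<^sub>q \<rho> \<cong>\<^sub>q \<rho> \<bottom>\<^sub>q q_scale \<beta> \<rho>"
proof (rule q_isometric_sym, rule orth_isometricI)
  show "vec_linear (qdim \<rho> + qdim (q_scale \<beta> \<rho>)) (qdim (pfister_bform [\<beta>] \<otimes>\<^sub>q \<rho>)) (\<lambda>v. v)"
    using vec_linear_id[of "qdim \<rho> + qdim \<rho>"] by (simp add: mult_2 del: pfister_bform.simps)
  fix u v :: "'a vec"
  assume uv: "u \<in> carrier_vec (qdim \<rho>)" "v \<in> carrier_vec (qdim (q_scale \<beta> \<rho>))"
  have "block (qdim \<rho>) (u @\<^sub>v v) 0 = u" "block (qdim \<rho>) (u @\<^sub>v v) 1 = v"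
    using uv by (auto simp: block_def)
  then show "qval \<rho> u + qval (q_scale \<beta> \<rho>) v = qval (pfister_bform [\<beta>] \<otimes>\<^sub>q \<rho>) (u @\<^sub>v v)"
    unfolding qval_pfister_tensor by (simp add: numeral_2_eq_2 del: pfister_bform.simps)
qed (use assms in \<open>simp_all add: regular_scale del: pfister_bform.simps\<close>)

lemma sum_square_split:
  "(\<Sum>i<m. \<Sum>j<m. g i j) = (\<Sum>i<m. g i i) + (\<Sum>j<m. \<Sum>i<j. g i j + g j i)"
  for g :: "nat \<Rightarrow> nat \<Rightarrow> 'b::comm_monoid_add"
  by (induction m) (simp_all add: sum.distrib ac_simps)

lemma bval_expand:
  assumes b: "is_bform b" and u: "u \<in> carrier_vec (bdim b)" and v: "v \<in> carrier_vec (bdim b)"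
  shows "bval b u v = (\<Sum>i<bdim b. \<Sum>j<bdim b.
    u $ i * v $ j * bval b (unit_vec (bdim b) i) (unit_vec (bdim b) j))"
proof -
  have left: "linear_form (bdim b) (\<lambda>u. bval b u w)" if "w \<in> carrier_vec (bdim b)" for w
    using b that unfolding is_bform_def linear_form_def by blast
  have right: "linear_form (bdim b) (\<lambda>u. bval b w u)" if "w \<in> carrier_vec (bdim b)" for w
    using b left[OF that] that unfolding is_bform_def linear_form_def by simp
  have "bval b u v = (\<Sum>i<bdim b. u $ i * bval b (unit_vec (bdim b) i) v)"
    by (rule linear_form_expand[OF left[OF v] u])
  also have "\<dots> = (\<Sum>i<bdim b. u $ i * (\<Sum>j<bdim b. v $ j * bval b (unit_vec (bdim b) i) (unit_vec (bdim b) j)))"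
    by (simp add: linear_form_expand[OF right v])
  finally show ?thesis by (simp add: sum_distrib_left mult.assoc)
qed

context char_two
begin

text \<open>The vectors \<open>x\<close> and \<open>y\<close> collect the first and second
  coordinates of the binary blocks. The formula sees \<open>b\<close> only through its values, not
  through its matrix on unit vectors, so isometries of \<open>b\<close> can be applied to
  it.\<close>

lemma qval_bform_tensor:
  fixes \<alpha> :: 'a and w :: "'a vec"
  assumes b: "is_bform b"
  defines "x \<equiv> vec (bdim b) (\<lambda>i. w $ (2 * i))" and "y \<equiv> vec (bdim b) (\<lambda>i. w $ (2 * i + 1))"
  shows "qval (b \<otimes>\<^sub>q binary_qform 1 \<alpha>) w = bval b x x + bval b x y + \<alpha> * bval b y y"
proof -
  define m where "m = bdim b"
  define B where "B i j = bval b (unit_vec m i) (unit_vec m j)" for i j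
  have xc: "x \<in> carrier_vec (bdim b)" "y \<in> carrier_vec (bdim b)" by (simp_all add: x_def y_def)
  have sym: "B i j = B j i" for i j
    using b unfolding is_bform_def B_def m_def by simp
  have ex: "bval b u v = (\<Sum>i<m. u $ i * v $ i * B i i) +
      (\<Sum>j<m. \<Sum>i<j. u $ i * v $ j * B i j + u $ j * v $ i * B i j)"
    if "u \<in> carrier_vec (bdim b)" "v \<in> carrier_vec (bdim b)" for u v
    unfolding bval_expand[OF b that] m_def[symmetric] B_def[symmetric] sum_square_split
    by (simp add: sym)
  have diag: "bval b u u = (\<Sum>i<m. u $ i * u $ i * B i i)" if "u \<in> carrier_vec (bdim b)" for u
    unfolding ex[OF that that] by (simp add: mult.commute)
  have polar: "polar (binary_qform 1 \<alpha>) (block 2 w i) (block 2 w j) = x $ i * y $ j + x $ j * y $ i"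
    if "i < m" "j < m" for i j
    using that by (simp add: polar_def binary_qform_def block_def x_def y_def m_def char_two_simps)
  have "qval (b \<otimes>\<^sub>q binary_qform 1 \<alpha>) w =
      (\<Sum>i<m. B i i * qval (binary_qform 1 \<alpha>) (block 2 w i)) +
      (\<Sum>j<m. \<Sum>i<j. B i j * polar (binary_qform 1 \<alpha>) (block 2 w i) (block 2 w j))"
    by (simp add: bq_tensor_def B_def m_def)
  also have "(\<Sum>i<m. B i i * qval (binary_qform 1 \<alpha>) (block 2 w i)) =
      (\<Sum>i<m. x $ i * x $ i * B i i) + (\<Sum>i<m. x $ i * y $ i * B i i) + \<alpha> * (\<Sum>i<m. y $ i * y $ i * B i i)"
    unfolding sum_distrib_left sum.distrib[symmetric]
    by (intro sum.cong) (simp_all add: binary_qform_def block_def x_def y_def m_def char_two_simps)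
  also have "(\<Sum>j<m. \<Sum>i<j. B i j * polar (binary_qform 1 \<alpha>) (block 2 w i) (block 2 w j)) =
      (\<Sum>j<m. \<Sum>i<j. x $ i * y $ j * B i j + x $ j * y $ i * B i j)"
    by (intro sum.cong refl) (simp add: polar char_two_simps)
  finally show ?thesis
    unfolding diag[OF xc(1)] diag[OF xc(2)] ex[OF xc] by (simp only: add.assoc add.commute add.left_commute)
qed

lemma isometric_bform_tensor:
  fixes p :: "'a qform"
  assumes p: "regular p" and b: "is_bpfister m b" and iso: "p \<cong>\<^sub>q b \<otimes>\<^sub>q binary_qform 1 \<alpha>"
    and bc: "b \<cong>\<^sub>b pfister_bform \<gamma>s"
  shows "p \<cong>\<^sub>q pfister_qform \<gamma>s \<alpha>"
proof -
  let ?c = "pfister_bform \<gamma>s" and ?k = "2 ^ length \<gamma>s :: nat"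
  have bb: "is_bform b" using b by (simp add: is_bpfister_def)
  from bc obtain A where db: "bdim b = ?k" and A: "A \<in> carrier_mat ?k ?k"
    and eq: "\<And>u v. u \<in> carrier_vec ?k \<Longrightarrow> v \<in> carrier_vec ?k \<Longrightarrow> bval b u v = bval ?c (A *\<^sub>v u) (A *\<^sub>v v)"
    by (auto simp: b_isometric_def)
  define X where "X w = vec ?k (\<lambda>i. w $ (2 * i))" for w :: "'a vec"
  define Y where "Y w = vec ?k (\<lambda>i. w $ (2 * i + 1))" for w :: "'a vec"
  have X: "vec_linear (2 * ?k) ?k X" and Y: "vec_linear (2 * ?k) ?k Y"
    unfolding X_def Y_def by (auto intro!: vec_linear_vec linear_form_index)
  have XY: "X w \<in> carrier_vec ?k" "Y w \<in> carrier_vec ?k" for w by (simp_all add: X_def Y_def)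
  \<comment> \<open>This is the tensor product of \<open>A\<close> with the identity, written in
    interleaved coordinates.\<close>
  define h where "h w = vec (2 * ?k) (\<lambda>j. if even j then (A *\<^sub>v X w) $ (j div 2) else (A *\<^sub>v Y w) $ (j div 2))" for w
  have h: "vec_linear (2 * ?k) (2 * ?k) h"
    unfolding h_def
    by (intro vec_linear_vec linear_form_if vec_linear_index[OF vec_linear_comp[OF X vec_linear_mult_mat[OF A]]]
        vec_linear_index[OF vec_linear_comp[OF Y vec_linear_mult_mat[OF A]]]) auto
  have Xh: "X (h w) = A *\<^sub>v X w" "Y (h w) = A *\<^sub>v Y w" for w
    using A by (auto intro!: eq_vecI simp: X_def Y_def h_def)
  have hval: "qval (b \<otimes>\<^sub>q binary_qform 1 \<alpha>) w = qval (pfister_qform \<gamma>s \<alpha>) (h w)" for w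
    unfolding pfister_qform_def qval_bform_tensor[OF bb] qval_bform_tensor[OF is_bform_pfister]
      db bdim_pfister X_def[symmetric] Y_def[symmetric] Xh
    by (simp add: eq XY)
  obtain f where d: "qdim p = qdim (b \<otimes>\<^sub>q binary_qform 1 \<alpha>)"
    and f: "vec_linear (qdim p) (qdim (b \<otimes>\<^sub>q binary_qform 1 \<alpha>)) f"
    and feq: "\<And>v. v \<in> carrier_vec (qdim p) \<Longrightarrow> qval p v = qval (b \<otimes>\<^sub>q binary_qform 1 \<alpha>) (f v)"
    using q_isometricE[OF iso] by metis
  have dp: "qdim p = 2 * ?k" using d by (simp add: db)
  show ?thesis
  proof (rule q_isometricI[OF p])
    have "vec_linear (2 * ?k) (2 * ?k) f" using f unfolding d[symmetric] dp .
    from vec_linear_comp[OF this h]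
    show "vec_linear (qdim p) (qdim (pfister_qform \<gamma>s \<alpha>)) (\<lambda>v. h (f v))" by (simp add: dp)
  qed (simp_all add: dp feq hval)
qed

section \<open>Identities in the last slot and change of slots\<close>

lemma even_nonsingular_pfister:
  fixes \<alpha> :: 'a
  shows "0 \<notin> set \<beta>s \<Longrightarrow> pfister_qform \<beta>s \<alpha> \<in> even_nonsingular"
  by (simp add: even_nonsingular_iff regular_pfister)

text \<open>With last slot 0 each block, with coordinates \<open>x\<close> and \<open>y\<close> and
  coefficient \<open>c\<close>, factors as \<open>(c * x) * (x + y)\<close>.\<close>

lemma pfister_0_hyperbolic:
  assumes "0 \<notin> set (\<beta>s :: 'a list)"
  shows "pfister_qform \<beta>s 0 \<cong>\<^sub>q hyperbolic (2 ^ length \<beta>s)"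
proof (rule isometric_hyperbolicI[OF regular_pfister[OF assms]])
  fix i assume i: "i < (2 ^ length \<beta>s :: nat)"
  show "linear_form (qdim (pfister_qform \<beta>s (0::'a))) (\<lambda>w. pfister_coeffs \<beta>s ! i * w $ (2 * i))"
    using i by (intro linear_form_intros) simp
  show "linear_form (qdim (pfister_qform \<beta>s (0::'a))) (\<lambda>w. w $ (2 * i) + w $ (2 * i + 1))"
    using i by (intro linear_form_intros) simp_all
qed (auto simp: qval_pfister char_two_simps intro!: sum.cong)

text \<open>In each pair of blocks the two vectors of equal value add up to an isotropic vector,
  which splits off a hyperbolic plane. What is left has the last slots added.\<close>

lemma pfister_add_isometric:
  fixes \<alpha> \<gamma> :: 'a
  assumes "0 \<notin> set \<beta>s"
  shows "pfister_qform \<beta>s \<alpha> \<bottom>\<^sub>q pfister_qform \<beta>s \<gamma> \<cong>\<^sub>q pfister_qform \<beta>s (\<alpha> + \<gamma>) \<bottom>\<^sub>q pfister_qform \<beta>s 0"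
proof (rule orth_isometricI)
  let ?d = "2 * 2 ^ length \<beta>s :: nat"
  \<comment> \<open>On blocks with coordinates \<open>x\<close>, \<open>y\<close> and
    \<open>x'\<close>, \<open>y'\<close>, the first component has coordinates \<open>x + x'\<close>
    and \<open>y\<close>, the second \<open>y + y'\<close> and
    \<open>x' + (\<gamma> + 1) * (y + y')\<close>. For odd \<open>j\<close> the index
    \<open>?d + j - 1\<close> is the even partner in the second summand.\<close>
  let ?g = "\<lambda>w. vec ?d (\<lambda>j. if even j then w $ j + w $ (?d + j) else w $ j)"
  let ?h = "\<lambda>w. vec ?d (\<lambda>j. if even j then w $ (j + 1) + w $ (?d + j + 1)
    else w $ (?d + j - 1) + (\<gamma> + 1) * (w $ j + w $ (?d + j)))"
  have "vec_linear (?d + ?d) ?d ?g" "vec_linear (?d + ?d) ?d ?h"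
    by (intro vec_linear_vec linear_form_intros; auto elim!: evenE oddE)+
  from vec_linear_append[OF this]
  show "vec_linear (qdim (pfister_qform \<beta>s \<alpha>) + qdim (pfister_qform \<beta>s \<gamma>))
      (qdim (pfister_qform \<beta>s (\<alpha> + \<gamma>) \<bottom>\<^sub>q pfister_qform \<beta>s 0)) (\<lambda>w. ?g w @\<^sub>v ?h w)"
    by simp
  fix u v :: "'a vec"
  assume "u \<in> carrier_vec (qdim (pfister_qform \<beta>s \<alpha>))" "v \<in> carrier_vec (qdim (pfister_qform \<beta>s \<gamma>))"
  then have uv: "u \<in> carrier_vec ?d" "v \<in> carrier_vec ?d" by simp_all
  have "qval (pfister_qform \<beta>s (\<alpha> + \<gamma>) \<bottom>\<^sub>q pfister_qform \<beta>s 0) (?g (u @\<^sub>v v) @\<^sub>v ?h (u @\<^sub>v v)) =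
      qval (pfister_qform \<beta>s (\<alpha> + \<gamma>)) (?g (u @\<^sub>v v)) + qval (pfister_qform \<beta>s 0) (?h (u @\<^sub>v v))"
    by (rule qval_orth) simp_all
  also have "\<dots> = qval (pfister_qform \<beta>s \<alpha>) u + qval (pfister_qform \<beta>s \<gamma>) v"
    unfolding qval_pfister sum.distrib[symmetric] using uv
    by (intro sum.cong refl) (auto simp: char_two_simps)
  finally show "qval (pfister_qform \<beta>s \<alpha>) u + qval (pfister_qform \<beta>s \<gamma>) v =
      qval (pfister_qform \<beta>s (\<alpha> + \<gamma>) \<bottom>\<^sub>q pfister_qform \<beta>s 0) (?g (u @\<^sub>v v) @\<^sub>v ?h (u @\<^sub>v v))" ..
qed (use assms in \<open>simp_all add: regular_pfister\<close>)

text \<open>For a fixed bilinear factor the class is additive in the last slot. This is why two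
  left-linked forms have a Pfister form as their sum.\<close>

lemma witt_class_pfister_add:
  fixes \<alpha> \<gamma> :: 'a
  assumes "0 \<notin> set \<beta>s"
  shows "witt_class (pfister_qform \<beta>s \<alpha>) \<otimes>\<^bsub>Iq1\<^esub> witt_class (pfister_qform \<beta>s \<gamma>) =
    witt_class (pfister_qform \<beta>s (\<alpha> + \<gamma>))"
proof -
  interpret comm_group "Iq1 :: 'a qform set monoid" by (rule comm_group_Iq1)
  note E = even_nonsingular_pfister[OF assms]
  have 0: "witt_class (pfister_qform \<beta>s 0) = \<one>\<^bsub>Iq1\<^esub>"
    using witt_class_isometric[OF pfister_0_hyperbolic[OF assms] even_nonsingular_hyperbolic]
    by (simp add: witt_class_hyperbolic)
  have "witt_class (pfister_qform \<beta>s \<alpha>) \<otimes>\<^bsub>Iq1\<^esub> witt_class (pfister_qform \<beta>s \<gamma>) =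
      witt_class (pfister_qform \<beta>s (\<alpha> + \<gamma>) \<bottom>\<^sub>q pfister_qform \<beta>s 0)"
    unfolding Iq1_mult[OF E E]
    by (rule witt_class_isometric[OF pfister_add_isometric[OF assms] even_nonsingular_orth[OF E E]])
  then show ?thesis
    by (simp add: Iq1_mult[OF E E, symmetric] 0 Iq1_carrierI[OF E])
qed

text \<open>
  In a quaternion algebra with generators \<open>i\<^sup>2 + i = \<alpha>\<close>, \<open>j\<^sup>2 = a\<close>, the elements
  \<open>i + a\<^sup>-\<^sup>1 j i\<close> and \<open>1 + j\<close> generate the same algebra with \<open>(1 + j)\<^sup>2 = 1 + a\<close>. The matrix
  below expresses the basis that they define in terms of the basis \<open>1, i, j, i j\<close>.
\<close>

lemma pfister_change_slot:
  fixes a \<alpha> :: 'a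
  assumes "0 \<notin> set \<beta>s" and a: "a \<noteq> 0" "1 + a \<noteq> 0"
  shows "pfister_qform \<beta>s \<alpha> \<bottom>\<^sub>q q_scale a (pfister_qform \<beta>s \<alpha>) \<cong>\<^sub>q
    pfister_qform \<beta>s (\<alpha> * (1 + a) / a) \<bottom>\<^sub>q q_scale (1 + a) (pfister_qform \<beta>s (\<alpha> * (1 + a) / a))"
proof (rule q_isometric_sym, rule orth_isometricI)
  let ?d = "2 * 2 ^ length \<beta>s :: nat"
  \<comment> \<open>Naming the inverse of \<open>a\<close> turns the verification below into a
    polynomial identity modulo \<open>a * c = 1\<close>.\<close>
  define c where "c = 1 / a"
  have c: "a * c = 1" "a * (c * x) = x" for x using a by (simp_all add: c_def)
  have ac: "\<alpha> * (1 + a) / a = \<alpha> * c + \<alpha>" using a by (simp add: c_def field_simps)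
  let ?g = "\<lambda>w. vec ?d (\<lambda>j. if even j then w $ j + w $ (?d + j) + w $ (?d + j + 1) else w $ j)"
  let ?h = "\<lambda>w. vec ?d (\<lambda>j. if even j then w $ (?d + j) + c * (w $ (j + 1) + w $ (?d + j + 1))
    else w $ (?d + j) + c * (w $ j + w $ (?d + j)))"
  have "vec_linear (?d + ?d) ?d ?g" "vec_linear (?d + ?d) ?d ?h"
    by (intro vec_linear_vec linear_form_intros; auto elim!: evenE oddE)+
  from vec_linear_append[OF this]
  show "vec_linear (qdim (pfister_qform \<beta>s (\<alpha> * (1 + a) / a)) + qdim (q_scale (1 + a) (pfister_qform \<beta>s (\<alpha> * (1 + a) / a))))
      (qdim (pfister_qform \<beta>s \<alpha> \<bottom>\<^sub>q q_scale a (pfister_qform \<beta>s \<alpha>))) (\<lambda>w. ?g w @\<^sub>v ?h w)"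
    by simp
  fix u v :: "'a vec"
  assume "u \<in> carrier_vec (qdim (pfister_qform \<beta>s (\<alpha> * (1 + a) / a)))"
    "v \<in> carrier_vec (qdim (q_scale (1 + a) (pfister_qform \<beta>s (\<alpha> * (1 + a) / a))))"
  then have uv: "u \<in> carrier_vec ?d" "v \<in> carrier_vec ?d" by simp_all
  have "qval (pfister_qform \<beta>s \<alpha> \<bottom>\<^sub>q q_scale a (pfister_qform \<beta>s \<alpha>)) (?g (u @\<^sub>v v) @\<^sub>v ?h (u @\<^sub>v v)) =
      qval (pfister_qform \<beta>s \<alpha>) (?g (u @\<^sub>v v)) + qval (q_scale a (pfister_qform \<beta>s \<alpha>)) (?h (u @\<^sub>v v))"
    by (rule qval_orth) simp_all
  also have "\<dots> = qval (pfister_qform \<beta>s (\<alpha> * (1 + a) / a)) u +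
      qval (q_scale (1 + a) (pfister_qform \<beta>s (\<alpha> * (1 + a) / a))) v"
    unfolding qval_scale qval_pfister sum_distrib_left sum.distrib[symmetric] ac using uv
    by (intro sum.cong refl) (auto simp: char_two_simps c)
  finally show "qval (pfister_qform \<beta>s (\<alpha> * (1 + a) / a)) u +
      qval (q_scale (1 + a) (pfister_qform \<beta>s (\<alpha> * (1 + a) / a))) v =
      qval (pfister_qform \<beta>s \<alpha> \<bottom>\<^sub>q q_scale a (pfister_qform \<beta>s \<alpha>)) (?g (u @\<^sub>v v) @\<^sub>v ?h (u @\<^sub>v v))" ..
qed (use assms in \<open>simp_all add: regular_pfister regular_scale\<close>)

end

subsection \<open>Linkage and tightness\<close>

lemma q_scale_1 [simp]: "q_scale 1 q = q"
  by (simp add: q_scale_def)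

lemma b_isometric_refl: "b \<cong>\<^sub>b b"
  unfolding b_isometric_def
  by (auto intro!: bexI[of _ "1\<^sub>m (bdim b)"] invertible_matI)

section \<open>Linkage of forms with a common right factor\<close>

context char_two
begin

lemma scale_slot_isometric:
  fixes q :: "'a qform"
  assumes "round_form q" "regular q" "a \<noteq> 0" "y \<noteq> 0" "represents q y"
  shows "q \<bottom>\<^sub>q q_scale a q \<cong>\<^sub>q q \<bottom>\<^sub>q q_scale (a * y) q"
proof -
  have "q_scale a (q_scale y q) \<cong>\<^sub>q q_scale a q"
    using assms by (intro scale_cong scale_isometric regular_scale)
  then have "q_scale a q \<cong>\<^sub>q q_scale (a * y) q"
    unfolding scale_scale by (rule q_isometric_sym)
  then show ?thesis using assms by (intro orth_cong q_isometric_refl regular_scale)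
qed

text \<open>Roundness identifies the scaled copy with the form itself, and the sum of two equal
  forms is hyperbolic. Writing the result as a Pfister form with last slot 0 and a free slot
  \<open>b\<close> lets it share its bilinear factor with any prescribed partner.\<close>

lemma represented_slot_hyperbolic:
  fixes \<alpha> :: 'a
  assumes "0 \<notin> set \<beta>s" "a \<noteq> 0" "b \<noteq> 0" and rep: "represents (pfister_qform \<beta>s \<alpha>) a"
  shows "pfister_qform \<beta>s \<alpha> \<bottom>\<^sub>q q_scale a (pfister_qform \<beta>s \<alpha>) \<cong>\<^sub>q pfister_qform (b # \<beta>s) 0"
proof -
  let ?\<rho> = "pfister_qform \<beta>s \<alpha>"
  note \<rho> = regular_pfister[OF assms(1), of \<alpha>] round_form_pfister[OF assms(1), of \<alpha>]
  have "?\<rho> \<bottom>\<^sub>q q_scale a ?\<rho> \<cong>\<^sub>q ?\<rho> \<bottom>\<^sub>q ?\<rho>"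
    using assms \<rho> by (intro orth_cong q_isometric_refl regular_scale scale_isometric)
  also have "\<dots> \<cong>\<^sub>q hyperbolic (2 ^ length (b # \<beta>s))"
    using orth_self_hyperbolic[OF \<rho>(1)] by simp
  also have "\<dots> \<cong>\<^sub>q pfister_qform (b # \<beta>s) 0"
    using assms by (intro q_isometric_sym[OF pfister_0_hyperbolic]) auto
  finally show ?thesis .
qed

lemma left_linked_of_represents:
  fixes \<alpha> :: 'a and \<beta>s :: "'a list"
  defines "\<rho> \<equiv> pfister_qform \<beta>s \<alpha>"
  assumes \<beta>s: "0 \<notin> set \<beta>s" and a: "a \<noteq> 0" and b: "b \<noteq> 0"
    and rep: "represents (q_scale a \<rho> \<bottom>\<^sub>q q_scale b \<rho>) 1"
  obtains \<gamma>s \<delta> \<epsilon> where "length \<gamma>s = Suc (length \<beta>s)" "0 \<notin> set \<gamma>s"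
    "\<rho> \<bottom>\<^sub>q q_scale a \<rho> \<cong>\<^sub>q pfister_qform \<gamma>s \<delta>"
    "\<rho> \<bottom>\<^sub>q q_scale b \<rho> \<cong>\<^sub>q pfister_qform \<gamma>s \<epsilon>"
proof -
  note reg = regular_pfister[OF \<beta>s, of \<alpha>, folded \<rho>_def]
  note round = round_form_pfister[OF \<beta>s, of \<alpha>, folded \<rho>_def]
  have Cons: "\<rho> \<bottom>\<^sub>q q_scale c \<rho> \<cong>\<^sub>q pfister_qform (c # \<beta>s) \<alpha>" if "c \<noteq> 0" for c
    unfolding \<rho>_def using that \<beta>s by (intro q_isometric_sym[OF pfister_Cons]) auto
  from rep obtain x y where x: "represents \<rho> x" and y: "represents \<rho> y" and xy: "1 = a * x + b * y"
    unfolding represents_binary_sum by blast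
  consider "x = 0" | "y = 0" | "x \<noteq> 0" "y \<noteq> 0" by blast
  then show thesis
  proof cases
    case 1
    \<comment> \<open>Here \<open>b\<close> is a value of \<open>\<rho>\<close>, so its form is
      hyperbolic and takes over the bilinear factor of the form with slot \<open>a\<close>.\<close>
    with xy have "b * y = 1" by simp
    then have "b = 1 / y" by (cases "y = 0") (simp_all add: nonzero_eq_divide_eq)
    then have "represents \<rho> b"
      using represents_inverse[OF regularD(1)[OF reg] y] by simp
    from represented_slot_hyperbolic[OF \<beta>s b a this[unfolded \<rho>_def]] Cons[OF a]
    show thesis using \<beta>s a by (intro that[of "a # \<beta>s"]) (auto simp: \<rho>_def)
  next
    case 2
    with xy have "a * x = 1" by simp
    then have "a = 1 / x" by (cases "x = 0") (simp_all add: nonzero_eq_divide_eq)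
    then have "represents \<rho> a"
      using represents_inverse[OF regularD(1)[OF reg] x] by simp
    from represented_slot_hyperbolic[OF \<beta>s a b this[unfolded \<rho>_def]] Cons[OF b]
    show thesis using \<beta>s b by (intro that[of "b # \<beta>s"]) (auto simp: \<rho>_def)
  next
    case 3
    \<comment> \<open>After rescaling, the slots are \<open>a * x\<close> and
      \<open>1 + a * x\<close>. The change of slot gives both forms the slot
      \<open>1 + a * x\<close>, at the price of a new last slot for the first.\<close>
    have "1 + a * x = (a * x + b * y) + a * x" by (simp only: xy[symmetric])
    also have "\<dots> = b * y" by (simp add: add.commute add.left_commute)
    finally have by_eq: "b * y = 1 + a * x" by simp
    have nz: "a * x \<noteq> 0" "1 + a * x \<noteq> 0" using 3 a b by (auto simp flip: by_eq)
    let ?\<delta> = "\<alpha> * (1 + a * x) / (a * x)"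
    have "\<rho> \<bottom>\<^sub>q q_scale a \<rho> \<cong>\<^sub>q \<rho> \<bottom>\<^sub>q q_scale (a * x) \<rho>"
      by (rule scale_slot_isometric[OF round reg a 3(1) x])
    also have "\<dots> \<cong>\<^sub>q pfister_qform \<beta>s ?\<delta> \<bottom>\<^sub>q q_scale (1 + a * x) (pfister_qform \<beta>s ?\<delta>)"
      unfolding \<rho>_def by (rule pfister_change_slot[OF \<beta>s nz])
    also have "\<dots> \<cong>\<^sub>q pfister_qform ((1 + a * x) # \<beta>s) ?\<delta>"
      using nz \<beta>s by (intro q_isometric_sym[OF pfister_Cons]) auto
    finally have 1: "\<rho> \<bottom>\<^sub>q q_scale a \<rho> \<cong>\<^sub>q pfister_qform ((1 + a * x) # \<beta>s) ?\<delta>" .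
    have "\<rho> \<bottom>\<^sub>q q_scale b \<rho> \<cong>\<^sub>q \<rho> \<bottom>\<^sub>q q_scale (b * y) \<rho>"
      by (rule scale_slot_isometric[OF round reg b 3(2) y])
    also have "\<dots> \<cong>\<^sub>q pfister_qform ((1 + a * x) # \<beta>s) \<alpha>"
      unfolding by_eq by (rule Cons[OF nz(2)])
    finally show thesis using nz \<beta>s by (intro that[OF _ _ 1]) auto
  qed
qed

text \<open>Equal dimensions force the same number of hyperbolic planes on both sides, and these
  cancel.\<close>

lemma isometric_of_witt_class:
  fixes p q :: "'a qform"
  assumes p: "p \<in> even_nonsingular" and q: "q \<in> even_nonsingular"
    and "qdim p = qdim q" "witt_class p = witt_class q"
  shows "p \<cong>\<^sub>q q"
proof -
  have "(p, q) \<in> witt_equiv" using assms by (simp add: witt_class_eq_iff)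
  then obtain i j where ij: "p \<bottom>\<^sub>q hyperbolic i \<cong>\<^sub>q q \<bottom>\<^sub>q hyperbolic j"
    by (auto simp: witt_equiv_def)
  then have "qdim (p \<bottom>\<^sub>q hyperbolic i) = qdim (q \<bottom>\<^sub>q hyperbolic j)" by (simp only: q_isometric_def)
  then have "i = j" using assms(3) by simp
  then show ?thesis
    using hyperbolic_cancel[of p q i] ij p q by (simp add: even_nonsingular_iff)
qed

text \<open>The two copies of \<open>\<rho>\<close> cancel, every class being its own
  inverse.\<close>

lemma witt_class_pfister_sum:
  fixes \<rho> :: "'a qform"
  assumes \<rho>: "\<rho> \<in> even_nonsingular" and "a \<noteq> 0" "b \<noteq> 0"
  shows "witt_class (\<rho> \<bottom>\<^sub>q q_scale a \<rho>) \<otimes>\<^bsub>Iq1\<^esub> witt_class (\<rho> \<bottom>\<^sub>q q_scale b \<rho>) =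
    witt_class (q_scale a \<rho> \<bottom>\<^sub>q q_scale b \<rho>)"
proof -
  interpret comm_group "Iq1 :: 'a qform set monoid" by (rule comm_group_Iq1)
  have E: "q_scale a \<rho> \<in> even_nonsingular" "q_scale b \<rho> \<in> even_nonsingular"
    using assms by (simp_all add: even_nonsingular_iff regular_scale)
  let ?W = witt_class
  note C = Iq1_carrierI[OF \<rho>] Iq1_carrierI[OF E(1)] Iq1_carrierI[OF E(2)]
  have "(?W \<rho> \<otimes>\<^bsub>Iq1\<^esub> ?W (q_scale a \<rho>)) \<otimes>\<^bsub>Iq1\<^esub> (?W \<rho> \<otimes>\<^bsub>Iq1\<^esub> ?W (q_scale b \<rho>)) =
      (?W \<rho> \<otimes>\<^bsub>Iq1\<^esub> ?W \<rho>) \<otimes>\<^bsub>Iq1\<^esub> (?W (q_scale a \<rho>) \<otimes>\<^bsub>Iq1\<^esub> ?W (q_scale b \<rho>))"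
    using C by (simp add: m_ac)
  also have "\<dots> = ?W (q_scale a \<rho>) \<otimes>\<^bsub>Iq1\<^esub> ?W (q_scale b \<rho>)"
    using C by (simp add: Iq1_mult_self[OF \<rho>])
  finally show ?thesis using \<rho> E by (simp add: Iq1_mult)
qed

lemma group_Iq: "group (Iq n :: 'a qform set monoid)"
proof -
  interpret comm_group "Iq1 :: 'a qform set monoid" by (rule comm_group_Iq1)
  have "witt_class (q_scale c q) \<in> carrier Iq1" if "c \<noteq> 0" "is_qpfister n q" for c and q :: "'a qform"
  proof -
    from that(2) obtain \<beta>s \<alpha> where "0 \<notin> set \<beta>s" "q \<cong>\<^sub>q pfister_qform \<beta>s \<alpha>"
      by (auto simp: is_qpfister_def)
    then have "q \<in> even_nonsingular"
      using even_nonsingular_isometric even_nonsingular_pfister by blast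
    then show ?thesis
      using that(1) by (intro Iq1_carrierI) (simp add: even_nonsingular_iff regular_scale)
  qed
  then show ?thesis
    unfolding Iq_def by (intro subgroup_imp_group generate_is_subgroup) auto
qed

section \<open>The equivalence for right-linked sets\<close>

lemma strongly_tight_iff_pairwise_left_linked:
  fixes S :: "'a qform set"
  assumes n: "n \<ge> 2" and S: "\<forall>q \<in> S. is_qpfister n q" and right: "right_linked n S"
  shows "(\<forall>p \<in> S. \<forall>q \<in> S. left_linked n {p, q}) \<longleftrightarrow> strongly_tight n S"
proof -
  interpret I: comm_group "Iq1 :: 'a qform set monoid" by (rule comm_group_Iq1)
  interpret In: group "Iq n :: 'a qform set monoid" by (rule group_Iq)
  have mult_Iq: "X \<otimes>\<^bsub>Iq n\<^esub> Y = X \<otimes>\<^bsub>Iq1\<^esub> Y" and one_Iq: "\<one>\<^bsub>Iq n\<^esub> = \<one>\<^bsub>Iq1\<^esub>"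
    for X Y :: "'a qform set" by (simp_all add: Iq_def)
  from right obtain \<rho>0 where "is_qpfister (n - 1) \<rho>0"
    and slot0: "\<forall>q \<in> S. \<exists>\<beta>. \<beta> \<noteq> 0 \<and> q \<cong>\<^sub>q pfister_bform [\<beta>] \<otimes>\<^sub>q \<rho>0"
    unfolding right_linked_def by blast
  then obtain \<beta>s \<alpha> where len: "Suc (length \<beta>s) = n - 1" and \<beta>s: "0 \<notin> set \<beta>s"
    and iso0: "\<rho>0 \<cong>\<^sub>q pfister_qform \<beta>s \<alpha>"
    unfolding is_qpfister_def by blast
  \<comment> \<open>The given right factor is only isometric to a Pfister form. From here on slots
    refer to the explicit form \<open>\<rho>\<close>, which is known to be round and to represent
    1.\<close>
  define \<rho> where "\<rho> = pfister_qform \<beta>s \<alpha>"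
  have iso0: "\<rho>0 \<cong>\<^sub>q \<rho>" using iso0 by (simp add: \<rho>_def)
  have reg: "regular \<rho>" and round: "round_form \<rho>" and ev: "\<rho> \<in> even_nonsingular"
    and pos: "qdim \<rho> > 0" and dim: "qdim \<rho> = 2 * 2 ^ (n - 2)"
    using len by (simp_all add: \<rho>_def regular_pfister round_form_pfister even_nonsingular_pfister \<beta>s
        flip: len)
  have slot: "\<exists>\<beta>. \<beta> \<noteq> 0 \<and> q \<cong>\<^sub>q \<rho> \<bottom>\<^sub>q q_scale \<beta> \<rho>" if "q \<in> S" for q
  proof -
    from slot0 that obtain \<beta> where \<beta>: "\<beta> \<noteq> 0" and "q \<cong>\<^sub>q pfister_bform [\<beta>] \<otimes>\<^sub>q \<rho>0" by blast
    note this(2)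
    also have "pfister_bform [\<beta>] \<otimes>\<^sub>q \<rho>0 \<cong>\<^sub>q \<rho>0 \<bottom>\<^sub>q q_scale \<beta> \<rho>0"
      by (rule pfister_tensor_single[OF regular_isometric[OF iso0 reg] \<beta>])
    also have "\<dots> \<cong>\<^sub>q \<rho> \<bottom>\<^sub>q q_scale \<beta> \<rho>"
      by (intro orth_cong regular_scale scale_cong iso0 regular_isometric[OF iso0 reg] \<beta>)
    finally show ?thesis using \<beta> by blast
  qed
  have ev_slot: "\<rho> \<bottom>\<^sub>q q_scale c \<rho> \<in> even_nonsingular" "q_scale a \<rho> \<in> even_nonsingular"
    "q_scale a \<rho> \<bottom>\<^sub>q q_scale c \<rho> \<in> even_nonsingular" if "a \<noteq> 0" "c \<noteq> 0" for a c
    using that ev by (auto simp: even_nonsingular_iff regular_scale regular_orth)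
  have ev_S: "q \<in> even_nonsingular" if "q \<in> S" for q
    using slot[OF that] even_nonsingular_isometric ev_slot(1)[OF one_neq_zero] by blast
  \<comment> \<open>Used in both directions. The sum of the classes is that of
    \<open>q_scale a \<rho> \<bottom>\<^sub>q q_scale b \<rho>\<close>, which has the dimension of
    an \<open>n\<close>-fold Pfister form. Equality of classes is therefore an isometry, and Pfister
    forms represent 1.\<close>
  have rep_of_pfister: "represents (q_scale a \<rho> \<bottom>\<^sub>q q_scale b \<rho>) 1"
    if ab: "a \<noteq> 0" "b \<noteq> 0" and p: "p \<cong>\<^sub>q \<rho> \<bottom>\<^sub>q q_scale a \<rho>" and q: "q \<cong>\<^sub>q \<rho> \<bottom>\<^sub>q q_scale b \<rho>"
      and \<gamma>s: "Suc (length \<gamma>s) = n" "0 \<notin> set \<gamma>s"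
      and eq: "witt_class p \<otimes>\<^bsub>Iq1\<^esub> witt_class q = witt_class (pfister_qform \<gamma>s \<delta>)" for a b p q \<gamma>s \<delta>
  proof -
    have "witt_class (q_scale a \<rho> \<bottom>\<^sub>q q_scale b \<rho>) = witt_class (pfister_qform \<gamma>s \<delta>)"
      using eq witt_class_isometric[OF p ev_slot(1)] witt_class_isometric[OF q ev_slot(1)] ab
        witt_class_pfister_sum[OF ev ab] by simp
    moreover have "qdim (q_scale a \<rho> \<bottom>\<^sub>q q_scale b \<rho>) = qdim (pfister_qform \<gamma>s \<delta>)"
      using \<gamma>s(1) len by (simp add: dim flip: \<gamma>s(1)) (simp flip: power_Suc add: Suc_diff_Suc)
    ultimately have "q_scale a \<rho> \<bottom>\<^sub>q q_scale b \<rho> \<cong>\<^sub>q pfister_qform \<gamma>s \<delta>"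
      using ev_slot(3)[OF ab] even_nonsingular_pfister[OF \<gamma>s(2)] by (intro isometric_of_witt_class)
    then show ?thesis
      using represents_isometric[OF q_isometric_sym pfister_represents_1] by blast
  qed
  show ?thesis
  proof
    assume linked: "\<forall>p \<in> S. \<forall>q \<in> S. left_linked n {p, q}"
    define R where "R c d \<longleftrightarrow> represents (\<rho> \<bottom>\<^sub>q q_scale d \<rho>) c" for c d
    have R_sym: "R c d \<longleftrightarrow> R d c" if "c \<noteq> 0" "d \<noteq> 0" for c d
      using represents_pfister_sum_commute[OF round reg pos that] by (simp add: R_def)
    have R_mult: "R (c * c') d" if "R c d" "R c' d" "d \<noteq> 0" for c c' d
      using that represents_mult[OF round_form_orth_scale[OF round regularD(1)[OF reg]]]
        regularD(1)[OF regular_orth[OF reg regular_scale[OF reg]]] by (simp add: R_def)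
    \<comment> \<open>All slots of every form in \<open>S\<close> are collected, so no slot has to
      be chosen. Two slots of one form are compared through the pair \<open>{p, p}\<close>.\<close>
    define A where "A = {a. a \<noteq> 0 \<and> (\<exists>q \<in> S. q \<cong>\<^sub>q \<rho> \<bottom>\<^sub>q q_scale a \<rho>)}"
    have R_A: "R a b" if "a \<in> A" "b \<in> A" for a b
    proof -
      from that obtain p q where S': "p \<in> S" "q \<in> S" and ab: "a \<noteq> 0" "b \<noteq> 0"
        and p: "p \<cong>\<^sub>q \<rho> \<bottom>\<^sub>q q_scale a \<rho>" and q: "q \<cong>\<^sub>q \<rho> \<bottom>\<^sub>q q_scale b \<rho>"
        by (auto simp: A_def)
      with linked obtain B \<gamma> \<delta> where B: "is_bpfister (n - 1) B"
        and iso: "p \<cong>\<^sub>q B \<otimes>\<^sub>q binary_qform 1 \<gamma>" "q \<cong>\<^sub>q B \<otimes>\<^sub>q binary_qform 1 \<delta>"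
        unfolding left_linked_def by (metis insertI1 insert_commute)
      from B obtain \<gamma>s where \<gamma>s: "length \<gamma>s = n - 1" "0 \<notin> set \<gamma>s" and "B \<cong>\<^sub>b pfister_bform \<gamma>s"
        unfolding is_bpfister_def by blast
      note tensor = isometric_bform_tensor[OF _ B _ this(3)]
      have reg_S: "regular p" "regular q" using ev_S S' by (simp_all add: even_nonsingular_iff)
      \<comment> \<open>Over the common bilinear factor the last slots add, so the sum is again a
        Pfister class and \<open>rep_of_pfister\<close> applies.\<close>
      have "witt_class p \<otimes>\<^bsub>Iq1\<^esub> witt_class q = witt_class (pfister_qform \<gamma>s (\<gamma> + \<delta>))"
        using witt_class_isometric[OF tensor[OF reg_S(1) iso(1)] even_nonsingular_pfister[OF \<gamma>s(2)]]
          witt_class_isometric[OF tensor[OF reg_S(2) iso(2)] even_nonsingular_pfister[OF \<gamma>s(2)]]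
        by (simp add: witt_class_pfister_add[OF \<gamma>s(2)])
      then have "represents (q_scale a \<rho> \<bottom>\<^sub>q q_scale b \<rho>) 1"
        using \<gamma>s n by (intro rep_of_pfister[OF ab p q]) auto
      then show ?thesis using represents_one_iff[OF round reg pos ab] by (simp add: R_def)
    qed
    \<comment> \<open>A double commutant with respect to \<open>R\<close>. Elements of
      \<open>\<Gamma>\<^sub>1\<close> are only known to be related to \<open>A\<close>; passing to
      \<open>\<Gamma>\<close> makes any two elements related to each other, because
      \<open>A \<subseteq> \<Gamma>\<^sub>1\<close> yields
      \<open>\<Gamma> \<subseteq> \<Gamma>\<^sub>1\<close>.\<close>
    define \<Gamma>\<^sub>1 where "\<Gamma>\<^sub>1 = {c. c \<noteq> 0 \<and> (\<forall>a \<in> A. R c a)}"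
    define \<Gamma> where "\<Gamma> = {c. c \<noteq> 0 \<and> (\<forall>d \<in> \<Gamma>\<^sub>1. R c d)}"
    have A_\<Gamma>\<^sub>1: "A \<subseteq> \<Gamma>\<^sub>1" using R_A by (auto simp: \<Gamma>\<^sub>1_def A_def)
    have A_\<Gamma>: "A \<subseteq> \<Gamma>" using R_sym by (auto simp: \<Gamma>_def \<Gamma>\<^sub>1_def A_def)
    have \<Gamma>_\<Gamma>\<^sub>1: "\<Gamma> \<subseteq> \<Gamma>\<^sub>1" using A_\<Gamma>\<^sub>1 by (auto simp: \<Gamma>_def \<Gamma>\<^sub>1_def)
    have \<Gamma>_mult: "c * c' \<in> \<Gamma>" if "c \<in> \<Gamma>" "c' \<in> \<Gamma>" for c c'
      using that R_mult by (auto simp: \<Gamma>_def \<Gamma>\<^sub>1_def)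
    have one_rep: "represents \<rho> 1" unfolding \<rho>_def by (rule pfister_represents_1)
    have "R 1 d" for d
      unfolding R_def represents_pfister_sum
      by (rule exI[of _ 1], rule exI[of _ 0]) (simp add: one_rep represents_0[OF regularD(1)[OF reg]])
    then have \<Gamma>_1: "1 \<in> \<Gamma>" by (simp add: \<Gamma>_def)
    define W where "W c = witt_class (\<rho> \<bottom>\<^sub>q q_scale c \<rho>)" for c
    have W_1: "W 1 = \<one>\<^bsub>Iq1\<^esub>"
      using Iq1_mult_self[OF ev] by (simp add: W_def Iq1_mult[OF ev ev])
    have W_mult: "W c \<otimes>\<^bsub>Iq1\<^esub> W c' = W (c * c')" if "c \<in> \<Gamma>" "c' \<in> \<Gamma>" for c c'
    proof -
      have nz: "c \<noteq> 0" "c' \<noteq> 0" "c * c' \<noteq> 0" using that by (auto simp: \<Gamma>_def)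
      \<comment> \<open>The slot \<open>c'\<close> lies in \<open>\<Gamma>\<^sub>1\<close> as well,
        and \<open>c\<close> is related to all of \<open>\<Gamma>\<^sub>1\<close>.\<close>
      have "R c c'" using that \<Gamma>_\<Gamma>\<^sub>1 by (auto simp: \<Gamma>_def)
      then have "q_scale c \<rho> \<bottom>\<^sub>q q_scale c' \<rho> \<cong>\<^sub>q \<rho> \<bottom>\<^sub>q q_scale (c * c') \<rho>"
        using binary_sum_isometric[OF round reg pos nz(1,2)] by (simp add: R_def)
      from witt_class_isometric[OF this ev_slot(1)[OF nz(1,3)]]
      show ?thesis by (simp add: W_def witt_class_pfister_sum[OF ev nz(1,2)])
    qed
    have W_S: "\<exists>c \<in> \<Gamma>. h = W c" if "h \<in> witt_class ` S" for h
    proof -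
      from that obtain q where q: "q \<in> S" and h: "h = witt_class q" by blast
      from slot[OF q] obtain \<beta> where "\<beta> \<noteq> 0" "q \<cong>\<^sub>q \<rho> \<bottom>\<^sub>q q_scale \<beta> \<rho>" by blast
      then show ?thesis
        using q A_\<Gamma> witt_class_isometric[OF _ ev_slot(1), of q \<beta> \<beta>] unfolding h W_def A_def by blast
    qed
    show "strongly_tight n S"
      unfolding strongly_tight_def
    proof
      fix X assume "X \<in> generate (Iq n) (witt_class ` S)"
      then have "\<exists>c \<in> \<Gamma>. X = W c"
      proof (induction rule: generate.induct)
        case one
        show ?case using \<Gamma>_1 unfolding one_Iq W_1[symmetric] by blast
      next
        case (incl h)
        then show ?case by (rule W_S)
      next
        case (inv h)
        then obtain q where q: "q \<in> S" and h: "h = witt_class q" by blast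
        \<comment> \<open>The scalar 1 exhibits the class of \<open>q\<close> as one of the
          generators of \<open>Iq n\<close>. Membership in the carrier is what lets the class be
          identified with its own inverse there.\<close>
        have "witt_class (q_scale 1 q) \<in> carrier (Iq n)"
          using S q unfolding Iq_def by (auto intro!: generate.incl exI[of _ 1] exI[of _ q])
        then have "h \<in> carrier (Iq n)" by (simp add: h)
        moreover have "h \<otimes>\<^bsub>Iq n\<^esub> h = \<one>\<^bsub>Iq n\<^esub>"
          using Iq1_mult_self[OF ev_S[OF q]] by (simp add: h mult_Iq one_Iq)
        ultimately have "inv\<^bsub>Iq n\<^esub> h = h" by (intro In.inv_equality)
        then show ?case using W_S[OF inv] by simp
      next
        case (eng h1 h2)
        then obtain c1 c2 where c: "c1 \<in> \<Gamma>" "c2 \<in> \<Gamma>" and h: "h1 = W c1" "h2 = W c2" by blast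
        show ?case unfolding h mult_Iq W_mult[OF c] using \<Gamma>_mult[OF c] by blast
      qed
      then obtain c where c: "c \<in> \<Gamma>" and X: "X = W c" by blast
      have nz: "0 \<notin> set (c # \<beta>s)" using c \<beta>s by (auto simp: \<Gamma>_def)
      have "is_qpfister n (pfister_qform (c # \<beta>s) \<alpha>)"
        unfolding is_qpfister_def using nz len n
        by (intro conjI is_qform_pfister exI[of _ "c # \<beta>s"] exI[of _ \<alpha>] q_isometric_refl) auto
      moreover have "X = witt_class (pfister_qform (c # \<beta>s) \<alpha>)"
        using witt_class_isometric[OF pfister_Cons[OF nz]] ev_slot(1)[of c c] nz
        unfolding X W_def \<rho>_def by auto
      ultimately show "X \<in> {witt_class q |q. is_qpfister n q}" by blast
    qed
  next
    assume tight: "strongly_tight n S"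
    show "\<forall>p \<in> S. \<forall>q \<in> S. left_linked n {p, q}"
    proof (intro ballI)
      fix p q assume S': "p \<in> S" "q \<in> S"
      from slot[OF S'(1)] obtain a where a: "a \<noteq> 0" and p: "p \<cong>\<^sub>q \<rho> \<bottom>\<^sub>q q_scale a \<rho>" by blast
      from slot[OF S'(2)] obtain b where b: "b \<noteq> 0" and q: "q \<cong>\<^sub>q \<rho> \<bottom>\<^sub>q q_scale b \<rho>" by blast
      \<comment> \<open>Strong tightness is applied to the sum of the two classes, which is thereby
        a Pfister class. Then \<open>rep_of_pfister\<close> yields the relation between the slots,
        and the change of slots yields the linkage.\<close>
      have "witt_class p \<otimes>\<^bsub>Iq n\<^esub> witt_class q \<in> generate (Iq n) (witt_class ` S)"
        using S' by (intro generate.eng generate.incl) auto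
      then obtain \<pi> where "is_qpfister n \<pi>" and W\<pi>: "witt_class p \<otimes>\<^bsub>Iq1\<^esub> witt_class q = witt_class \<pi>"
        using tight unfolding strongly_tight_def mult_Iq by blast
      then obtain \<gamma>s \<delta> where \<gamma>s: "Suc (length \<gamma>s) = n" "0 \<notin> set \<gamma>s" "\<pi> \<cong>\<^sub>q pfister_qform \<gamma>s \<delta>"
        unfolding is_qpfister_def by blast
      have "represents (q_scale a \<rho> \<bottom>\<^sub>q q_scale b \<rho>) 1"
        using W\<pi> witt_class_isometric[OF \<gamma>s(3) even_nonsingular_pfister[OF \<gamma>s(2)]]
        by (intro rep_of_pfister[OF a b p q \<gamma>s(1,2)]) simp
      then obtain \<gamma>s' \<delta>' \<epsilon> where \<gamma>s': "length \<gamma>s' = Suc (length \<beta>s)" "0 \<notin> set \<gamma>s'"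
        and "\<rho> \<bottom>\<^sub>q q_scale a \<rho> \<cong>\<^sub>q pfister_qform \<gamma>s' \<delta>'"
        and "\<rho> \<bottom>\<^sub>q q_scale b \<rho> \<cong>\<^sub>q pfister_qform \<gamma>s' \<epsilon>"
        unfolding \<rho>_def by (rule left_linked_of_represents[OF \<beta>s a b])
      then have "p \<cong>\<^sub>q pfister_qform \<gamma>s' \<delta>'" "q \<cong>\<^sub>q pfister_qform \<gamma>s' \<epsilon>"
        using p q q_isometric_trans by blast+
      moreover have "is_bpfister (n - 1) (pfister_bform \<gamma>s')"
        unfolding is_bpfister_def using \<gamma>s' len
        by (intro conjI is_bform_pfister exI[of _ \<gamma>s'] b_isometric_refl) auto
      ultimately show "left_linked n {p, q}"
        unfolding left_linked_def pfister_qform_def by blast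
    qed
  qed
qed

end

theorem theorem7p4:
  fixes S :: "'a::field qform set" and n :: nat
  assumes "CHAR('a) = 2"
    and "n \<ge> 2"
    and "\<forall>q \<in> S. is_qpfister n q"
    and "right_linked n S"
  shows "(\<forall>p \<in> S. \<forall>q \<in> S. left_linked n {p, q}) \<longleftrightarrow> strongly_tight n S"
proof -
  interpret char_two "TYPE('a)" by standard (rule assms(1))
  show ?thesis by (rule strongly_tight_iff_pairwise_left_linked[OF assms(2-4)])
qed

end
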